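(* Let $U(R)$ be the general linear RLL Hopf superalgebra, and let $\mathfrak R^R_u$ be the canonical element of the restriction of the skew-pairing $(\cdot,\cdot)_{\widetilde R}$ to $U^<(R)\times U^>(R)$ (the reduced, or unipotent, part of the canonical element of the double $\mathcal D(U^{\le}(R),U^{\ge}(R))$). Then $\mathfrak R^R_u$ factorizes as $$\mathfrak R^R_u=\prod^{\leftarrow}_{\gamma\in\Phi^+}\left(\sum_{\substack{k\ge0\\ k\le1\text{ if }\gamma\text{ is odd}}}\frac{\mathbf e_\gamma^k\otimes\mathbf f_\gamma^k}{(\mathbf f_\gamma^k,\mathbf e_\gamma^k)_{\widetilde R}}\right),$$ where the arrow indicates that the factors are ordered so that the roots $\gamma$ increase from right to left with respect to the convex order $\prec$.
   Context: Super conventions: superspaces are $\mathbb Z_2$-graded, $|x|$ is the degree of homogeneous $x$; tensor products of superalgebras have product $(a\otimes b)(a'\otimes b')=(-1)^{|b||a'|}aa'\otimes bb'$; $\tau(a\otimes b)=(-1)^{|a||b|}b\otimes a$, $\Delta^{\mathrm{op}}=\tau\Delta$. A skew-pairing between superbialgebras $A,B$ is a degree-preserving bilinear map $(\cdot,\cdot)\colon A\times B\to\mathbb C(q)$ with $(1,b)=\epsilon(b)$, $(a,1)=\epsilon(a)$, $(aa',b)=(a\otimes a',\Delta(b))$, $(a,bb')=(\Delta^{\mathrm{op}}(a),b\otimes b')$, where $(a\otimes a',b\otimes b')=(-1)^{|a'||b|}(a,b)(a',b')$. Data: $V$ is a complex superspace of dimension $(m,n)$, $N=m+n$, with an ordered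 homogeneous basis $v_1,\dots,v_N$; $\bar i:=|v_i|$; $(\varepsilon_i,\varepsilon_j)=\delta_{ij}(-1)^{\bar i}$; $V_q=\mathbb C(q)\otimes V$, matrix units $E_{ij}$ of parity $\bar i+\bar j$; $$R=\sum_{i,j}q^{-(\varepsilon_i,\varepsilon_j)}E_{ii}\otimes E_{jj}-(q-q^{-1})\sum_{i<j}(-1)^{\bar j}E_{ij}\otimes E_{ji},$$ $$R^{-1}=\sum_{i,j}q^{(\varepsilon_i,\varepsilon_j)}E_{ii}\otimes E_{jj}+(q-q^{-1})\sum_{i<j}(-1)^{\bar j}E_{ij}\otimes E_{ji}.$$ $U(R)$ is the $\mathbb C(q)$-superalgebra generated by $l^+_{ij},l^-_{ji}$ ($1\le i\le j\le N$), graded by $Q=\bigoplus_{i<N}\mathbb Z(\varepsilon_i-\varepsilon_{i+1})$ via $\deg l^\pm_{ij}=\varepsilon_i-\varepsilon_j$ and with $|l^\pm_{ij}|=\bar i+\bar j$; put $l^+_{ij}=0=l^-_{ji}$ for $i>j$, $L^\pm=\sum l^\pm_{ij}\otimes E_{ij}$. Relations: $l^\pm_{ii}l^\mp_{ii}=1$ and all coefficients of $R_{12}L^\pm_1L^\pm_2=L^\pm_2L^\pm_1R_{12}$, $R_{12}L^+_1L^-_2=L^-_2L^+_1R_{12}$ computed in the tensor product of superalgebras (algebra)$\,\otimes\mathrm{End}(V_q)^{\otimes2}$, with $L^\pm_1=\sum l^\pm_{ij}\otimes E_{ij}\otimes\mathrm I$, $L^\pm_2=\sum l^\pm_{ij}\otimes\mathrm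 I\otimes E_{ij}$, $R_{12}=1\otimes R$. Hopf structure: $\Delta(l^\pm_{ij})=\sum_k(-1)^{(\bar i+\bar k)(\bar k+\bar j)}l^\pm_{ik}\otimes l^\pm_{kj}$, $\epsilon(l^\pm_{ij})=\delta_{ij}$, $S(L^\pm)=(L^\pm)^{-1}$. For $i<j$ define $\mathbf e_{ij},\mathbf f_{ji}$ by $$(l^+_{ii})^{-1}l^+_{ij}=(-1)^{\bar i\,\bar j}q^{-(\varepsilon_i,\varepsilon_i)}(q-q^{-1})\,\mathbf e_{ij},\qquad l^-_{ji}(l^-_{ii})^{-1}=-(-1)^{\bar i+\overline{i+1}+\cdots+\overline{j-1}}(-1)^{\bar i\,\bar j}q^{(\varepsilon_i,\varepsilon_i)}(q-q^{-1})\,\mathbf f_{ji}.$$ $\Phi^+=\{\gamma_{ij}=\varepsilon_i-\varepsilon_j\mid1\le i<j\le N\}$; $\gamma_{ij}$ is odd iff $\bar i\ne\bar j$; $\mathbf e_{\gamma_{ij}}=\mathbf e_{ij}$, $\mathbf f_{\gamma_{ij}}=\mathbf f_{ji}$. The order $\prec$ on $\Phi^+$ is the lexicographic order on pairs $(i,j)$. $U^>(R)$, $U^<(R)$, $U^0(R)$ are the subalgebras generated by all $\mathbf e_{ij}$, all $\mathbf f_{ji}$, all $l^\pm_{kk}$, respectively; $U^{\ge}(R)$ (resp. $U^{\le}(R)$) is generated by all $l^+_{ij}$ and $l^-_{kk}$ (resp. all $l^-_{ji}$ and $l^+_{kk}$). $(\cdot,\cdot)_{\widetilde R}\colon U^{\le}(R)\times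 U^{\ge}(R)\to\mathbb C(q)$ is the unique skew-pairing with $\sum(-1)^{(\bar i+\bar j)(\bar k+\bar l)}(l^-_{ij},l^+_{kl})_{\widetilde R}\,E_{ij}\otimes E_{kl}=\tau(R^{-1})$; it is non-degenerate, as are its restrictions to $U^0(R)\times U^0(R)$ and $U^<(R)\times U^>(R)$, and it pairs graded components of opposite degree. The canonical element of the restriction to $U^<(R)\times U^>(R)$ is $\sum_iu_i^e\otimes u_i^f\in\prod_{\lambda}U^>(R)_\lambda\otimes U^<(R)_{-\lambda}$, for any homogeneous bases $\{u_i^f\}$ of $U^<(R)$ and $\{u_i^e\}$ of $U^>(R)$ that are dual: $(u_i^f,u_j^e)_{\widetilde R}=\delta_{ij}$. The product is taken in this completed tensor product with the super sign rule. *)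

theory Defs
  imports
    "HOL-Library.Poly_Mapping"
    "HOL-Library.Product_Lexorder"
    "HOL-Library.Groups_Big_Fun"
    "HOL-Computational_Algebra.Polynomial"
    "HOL-Computational_Algebra.Fraction_Field"
begin

section \<open>The ground field and superalgebras\<close>

type_synonym cq = "complex poly fract"

definition qq :: cq
  where "qq = Fract (monom 1 1) 1"

definition sign :: "bool \<Rightarrow> cq"
  where "sign b = (if b then - 1 else 1)"

class cq_space = ab_group_add +
  fixes scaleQ :: "cq \<Rightarrow> 'a \<Rightarrow> 'a"  (infixr \<open>*\<^sub>Q\<close> 75)
  assumes scaleQ_right_distrib: "c *\<^sub>Q (x + y) = c *\<^sub>Q x + c *\<^sub>Q y"
    and scaleQ_left_distrib: "(c + d) *\<^sub>Q x = c *\<^sub>Q x + d *\<^sub>Q x"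
    and scaleQ_scaleQ: "c *\<^sub>Q (d *\<^sub>Q x) = (c * d) *\<^sub>Q x"
    and scaleQ_one: "1 *\<^sub>Q x = x"

global_interpretation cq: vector_space "scaleQ :: cq \<Rightarrow> 'a::cq_space \<Rightarrow> 'a"
  by unfold_locales (rule scaleQ_right_distrib scaleQ_left_distrib scaleQ_scaleQ scaleQ_one)+

text \<open>Parities are Booleans, with \<^term>\<open>True\<close> standing for odd, so that sums of parities are
  written \<open>s \<noteq> t\<close> and products \<open>s \<and> t\<close>.  A grading by \<open>\<int>/2\<close> is given by the projections
  \<open>hcomp s\<close> onto the homogeneous subspaces.\<close>

class cq_superalgebra = cq_space + ring + monoid_mult +
  fixes hcomp :: "bool \<Rightarrow> 'a \<Rightarrow> 'a"
  assumes scaleQ_mult_left: "(c *\<^sub>Q x) * y = c *\<^sub>Q (x * y)"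
    and scaleQ_mult_right: "x * (c *\<^sub>Q y) = c *\<^sub>Q (x * y)"
    and hcomp_add: "hcomp s (x + y) = hcomp s x + hcomp s y"
    and hcomp_scaleQ: "hcomp s (c *\<^sub>Q x) = c *\<^sub>Q hcomp s x"
    and hcomp_hcomp: "hcomp s (hcomp t x) = (if s = t then hcomp t x else 0)"
    and hcomp_sum: "hcomp False x + hcomp True x = x"
    and hcomp_one: "hcomp False 1 = 1"
    and hcomp_mult: "hcomp (s \<noteq> t) (hcomp s x * hcomp t y) = hcomp s x * hcomp t y"

abbreviation homogeneous :: "bool \<Rightarrow> 'a::cq_superalgebra \<Rightarrow> bool"
  where "homogeneous s x \<equiv> hcomp s x = x"

lifting_forget fract.lifting
lifting_forget poly.lifting

subsection \<open>Linear extension\<close>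

lift_definition pm_scale :: "cq \<Rightarrow> ('k \<Rightarrow>\<^sub>0 cq) \<Rightarrow> ('k \<Rightarrow>\<^sub>0 cq)"
  is "\<lambda>c f k. c * f k"
  by (erule rev_finite_subset) auto

definition pm_extend :: "(cq \<Rightarrow> 'a \<Rightarrow> 'a::comm_monoid_add) \<Rightarrow> ('k \<Rightarrow> 'a) \<Rightarrow> ('k \<Rightarrow>\<^sub>0 cq) \<Rightarrow> 'a"
  where "pm_extend s \<phi> x = (\<Sum>k\<in>Poly_Mapping.keys x. s (Poly_Mapping.lookup x k) (\<phi> k))"

lemma lookup_pm_scale [simp]: "Poly_Mapping.lookup (pm_scale c x) k = c * Poly_Mapping.lookup x k"
  by transfer simp

lemma pm_scale_single: "pm_scale c (Poly_Mapping.single k d) = Poly_Mapping.single k (c * d)"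
  by (rule poly_mapping_eqI) (simp add: lookup_single when_def)

lemma pm_scale_zero [simp]: "pm_scale c 0 = 0" "pm_scale 0 x = 0"
  by (rule poly_mapping_eqI, simp)+

lemma pm_scale_distribs:
  "pm_scale c (x + y) = pm_scale c x + pm_scale c y"
  "pm_scale (c + d) x = pm_scale c x + pm_scale d x"
  "pm_scale c (pm_scale d x) = pm_scale (c * d) x"
  "pm_scale 1 x = x"
  by (rule poly_mapping_eqI, simp add: lookup_add algebra_simps)+

lemma pm_scale_minus_one: "pm_scale (- 1) x = - x"
  by (rule poly_mapping_eqI, simp)

context
  fixes s :: "cq \<Rightarrow> 'a \<Rightarrow> 'a::ab_group_add"
  assumes s: "module s"
begin

interpretation module s by (rule s)

lemma pm_extend_superset:
  assumes "finite A" "Poly_Mapping.keys x \<subseteq> A"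
  shows "pm_extend s \<phi> x = (\<Sum>k\<in>A. s (Poly_Mapping.lookup x k) (\<phi> k))"
  unfolding pm_extend_def using assms
  by (intro sum.mono_neutral_left) (auto simp: in_keys_iff)

lemma pm_extend_zero: "pm_extend s \<phi> 0 = 0"
  by (simp add: pm_extend_def)

lemma pm_extend_single: "pm_extend s \<phi> (Poly_Mapping.single k c) = s c (\<phi> k)"
  by (subst pm_extend_superset[of "{k}"]) auto

lemma pm_extend_add: "pm_extend s \<phi> (x + y) = pm_extend s \<phi> x + pm_extend s \<phi> y"
proof -
  let ?A = "Poly_Mapping.keys x \<union> Poly_Mapping.keys y"
  have "finite ?A" "Poly_Mapping.keys (x + y) \<subseteq> ?A"
    by (auto simp: Poly_Mapping.keys_add)
  then show ?thesis
    by (simp add: pm_extend_superset[of ?A] lookup_add scale_left_distrib sum.distrib)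
qed

lemma pm_extend_scale: "pm_extend s \<phi> (pm_scale c x) = s c (pm_extend s \<phi> x)"
proof -
  have "Poly_Mapping.keys (pm_scale c x) \<subseteq> Poly_Mapping.keys x"
    by (auto simp: in_keys_iff)
  then show ?thesis
    by (simp add: pm_extend_superset[of "Poly_Mapping.keys x"] scale_sum_right)
qed

end

lemma module_scaleQ: "module (scaleQ :: cq \<Rightarrow> 'a \<Rightarrow> 'a::cq_space)"
  by (rule cq.module_axioms)

lemma module_cq: "module ((*) :: cq \<Rightarrow> cq \<Rightarrow> cq)"
  by unfold_locales (simp_all add: algebra_simps)


section \<open>Tensor products over the ground field\<close>

inductive_set tensor_null :: "('a::cq_space \<times> 'b::cq_space \<Rightarrow>\<^sub>0 cq) set" where
  zero: "0 \<in> tensor_null"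
| add: "x \<in> tensor_null \<Longrightarrow> y \<in> tensor_null \<Longrightarrow> x + y \<in> tensor_null"
| scale: "x \<in> tensor_null \<Longrightarrow> pm_scale c x \<in> tensor_null"
| add_left: "Poly_Mapping.single (a + a', b) 1 - Poly_Mapping.single (a, b) 1
    - Poly_Mapping.single (a', b) 1 \<in> tensor_null"
| add_right: "Poly_Mapping.single (a, b + b') 1 - Poly_Mapping.single (a, b) 1
    - Poly_Mapping.single (a, b') 1 \<in> tensor_null"
| scale_left: "Poly_Mapping.single (c *\<^sub>Q a, b) 1 - Poly_Mapping.single (a, b) c \<in> tensor_null"
| scale_right: "Poly_Mapping.single (a, c *\<^sub>Q b) 1 - Poly_Mapping.single (a, b) c \<in> tensor_null"

lemma tensor_null_minus: "x \<in> tensor_null \<Longrightarrow> - x \<in> tensor_null"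
  using tensor_null.scale[of x "- 1"] by (simp add: pm_scale_minus_one)

definition tensor_eq :: "('a::cq_space \<times> 'b::cq_space \<Rightarrow>\<^sub>0 cq) \<Rightarrow> ('a \<times> 'b \<Rightarrow>\<^sub>0 cq) \<Rightarrow> bool"
  where "tensor_eq x y \<longleftrightarrow> x - y \<in> tensor_null"

lemma equivp_tensor_eq: "equivp tensor_eq"
proof (rule equivpI)
  show "reflp tensor_eq"
    by (rule reflpI) (simp add: tensor_eq_def tensor_null.zero)
  show "symp tensor_eq"
    by (rule sympI) (metis minus_diff_eq tensor_eq_def tensor_null_minus)
  show "transp tensor_eq"
  proof (rule transpI, unfold tensor_eq_def, goal_cases)
    case (1 x y z)
    then show ?case
      using tensor_null.add[of "x - y" "y - z"] by simp
  qed
qed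

quotient_type (overloaded) ('a, 'b) tensor = "'a::cq_space \<times> 'b::cq_space \<Rightarrow>\<^sub>0 cq" / tensor_eq
  by (rule equivp_tensor_eq)

instantiation tensor :: (cq_space, cq_space) cq_space
begin

lift_definition zero_tensor :: "('a, 'b) tensor" is 0 .

lift_definition plus_tensor :: "('a, 'b) tensor \<Rightarrow> ('a, 'b) tensor \<Rightarrow> ('a, 'b) tensor" is "(+)"
  unfolding tensor_eq_def by (metis add_diff_add tensor_null.add)

lift_definition uminus_tensor :: "('a, 'b) tensor \<Rightarrow> ('a, 'b) tensor" is uminus
  unfolding tensor_eq_def by (metis minus_diff_minus tensor_null_minus)

lift_definition minus_tensor :: "('a, 'b) tensor \<Rightarrow> ('a, 'b) tensor \<Rightarrow> ('a, 'b) tensor" is "(-)"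
proof -
  fix x y z w :: "'a \<times> 'b \<Rightarrow>\<^sub>0 cq"
  assume "tensor_eq x y" "tensor_eq z w"
  then show "tensor_eq (x - z) (y - w)"
    unfolding tensor_eq_def
    using tensor_null.add[of "x - y" "- (z - w)"] tensor_null_minus[of "z - w"]
    by (simp add: algebra_simps)
qed

lift_definition scaleQ_tensor :: "cq \<Rightarrow> ('a, 'b) tensor \<Rightarrow> ('a, 'b) tensor" is pm_scale
proof -
  fix c and x y :: "'a \<times> 'b \<Rightarrow>\<^sub>0 cq"
  assume "tensor_eq x y"
  moreover have "pm_scale c x - pm_scale c y = pm_scale c (x - y)"
    by (rule poly_mapping_eqI) (simp add: lookup_minus algebra_simps)
  ultimately show "tensor_eq (pm_scale c x) (pm_scale c y)"
    unfolding tensor_eq_def by (simp add: tensor_null.scale)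
qed

instance
  by standard
    (transfer, simp add: tensor_eq_def algebra_simps pm_scale_distribs tensor_null.zero)+

end

lift_definition tens :: "'a::cq_space \<Rightarrow> 'b::cq_space \<Rightarrow> ('a, 'b) tensor"  (infixr \<open>\<otimes>\<close> 76)
  is "\<lambda>a b. Poly_Mapping.single (a, b) 1" .

lemma tens_add_left: "(a + a') \<otimes> b = a \<otimes> b + a' \<otimes> b"
  by transfer (metis diff_diff_add tensor_eq_def tensor_null.add_left)

lemma tens_add_right: "a \<otimes> (b + b') = a \<otimes> b + a \<otimes> b'"
  by transfer (metis diff_diff_add tensor_eq_def tensor_null.add_right)

lemma tens_scale_left: "(c *\<^sub>Q a) \<otimes> b = c *\<^sub>Q (a \<otimes> b)"
  by transfer (simp add: tensor_eq_def pm_scale_single tensor_null.scale_left)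

lemma tens_scale_right: "a \<otimes> (c *\<^sub>Q b) = c *\<^sub>Q (a \<otimes> b)"
  by transfer (simp add: tensor_eq_def pm_scale_single tensor_null.scale_right)

lemma tens_zero [simp]: "0 \<otimes> b = 0" "a \<otimes> 0 = 0"
  using tens_add_left[of 0 0 b] tens_add_right[of a 0 0] by auto

lemma tens_sum_left: "(\<Sum>i\<in>A. f i) \<otimes> b = (\<Sum>i\<in>A. f i \<otimes> b)"
  by (induction A rule: infinite_finite_induct) (auto simp: tens_add_left)

lemma tens_sum_right: "a \<otimes> (\<Sum>i\<in>A. f i) = (\<Sum>i\<in>A. a \<otimes> f i)"
  by (induction A rule: infinite_finite_induct) (auto simp: tens_add_right)

lemma abs_tensor_single: "abs_tensor (Poly_Mapping.single (a, b) c) = (c *\<^sub>Q a) \<otimes> b"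
  unfolding tens_scale_left by transfer (simp add: pm_scale_single tensor_eq_def tensor_null.zero)

lemma tensor_induct [case_names zero add_tens]:
  assumes "P 0" and step: "\<And>a b t. P t \<Longrightarrow> P (a \<otimes> b + t)"
  shows "P t"
proof -
  have *: "P (abs_tensor x)" if "finite A" "Poly_Mapping.keys x \<subseteq> A" for x A
    using that
  proof (induction A arbitrary: x rule: finite_induct)
    case empty
    then show ?case using assms(1) by (simp add: zero_tensor.abs_eq)
  next
    case (insert k A)
    define y where "y = x - Poly_Mapping.single k (Poly_Mapping.lookup x k)"
    have "Poly_Mapping.keys y \<subseteq> A"
      using insert.prems by (auto simp: y_def in_keys_iff lookup_minus lookup_single when_def split: if_splits)
    then have "P (abs_tensor y)" by (rule insert.IH)
    moreover have "abs_tensor x = abs_tensor (Poly_Mapping.single k (Poly_Mapping.lookup x k)) + abs_tensor y"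
      by (simp add: plus_tensor.abs_eq y_def)
    ultimately show ?case
      using step by (cases k) (simp add: abs_tensor_single)
  qed
  show ?thesis
    by (induction t rule: tensor.abs_induct) (rule *[OF finite_keys order_refl])
qed

definition bilinearQ :: "('a::cq_space \<Rightarrow> 'b::cq_space \<Rightarrow> 'c::cq_space) \<Rightarrow> bool"
  where "bilinearQ f \<longleftrightarrow>
    (\<forall>x y z. f (x + y) z = f x z + f y z) \<and> (\<forall>c x z. f (c *\<^sub>Q x) z = c *\<^sub>Q f x z) \<and>
    (\<forall>x y z. f x (y + z) = f x y + f x z) \<and> (\<forall>c x z. f x (c *\<^sub>Q z) = c *\<^sub>Q f x z)"

text \<open>Computed on an arbitrary representative, hence meaningful only for bilinear \<open>f\<close>; then it is the
  linear map induced by \<open>f\<close>.\<close>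

definition tensor_lift :: "('a::cq_space \<Rightarrow> 'b::cq_space \<Rightarrow> 'c::cq_space) \<Rightarrow> ('a, 'b) tensor \<Rightarrow> 'c"
  where "tensor_lift f t = pm_extend scaleQ (\<lambda>(a, b). f a b) (rep_tensor t)"

lemma bilinear_tens: "bilinearQ tens"
  by (simp add: bilinearQ_def tens_add_left tens_add_right tens_scale_left tens_scale_right)

lemmas pm_extend_Q = pm_extend_zero[OF module_scaleQ] pm_extend_single[OF module_scaleQ]
  pm_extend_add[OF module_scaleQ] pm_extend_scale[OF module_scaleQ]

lemma pm_extend_Q_diff: "pm_extend scaleQ f (x - y) = pm_extend scaleQ f x - pm_extend scaleQ f y"
  using pm_extend_Q(3)[of f "x - y" y] by simp

context
  fixes f :: "'a::cq_space \<Rightarrow> 'b::cq_space \<Rightarrow> 'c::cq_space"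
  assumes f: "bilinearQ f"
begin

lemma pm_extend_null: "x \<in> tensor_null \<Longrightarrow> pm_extend scaleQ (\<lambda>(a, b). f a b) x = 0"
  by (induction rule: tensor_null.induct)
    (use f in \<open>simp_all add: pm_extend_Q pm_extend_Q_diff bilinearQ_def scaleQ_one\<close>)

lemma tensor_lift_abs: "tensor_lift f (abs_tensor x) = pm_extend scaleQ (\<lambda>(a, b). f a b) x"
proof -
  have "tensor_eq (rep_tensor (abs_tensor x)) x"
    by (simp add: Quotient3_abs_rep[OF Quotient3_tensor] flip: tensor.abs_eq_iff)
  then show ?thesis
    using pm_extend_null[of "rep_tensor (abs_tensor x) - x"]
    by (simp add: tensor_lift_def tensor_eq_def pm_extend_Q_diff)
qed

lemma tensor_lift_tens: "tensor_lift f (a \<otimes> b) = f a b"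
  by (simp add: tens.abs_eq tensor_lift_abs pm_extend_Q scaleQ_one)

lemma tensor_lift_add: "tensor_lift f (t + u) = tensor_lift f t + tensor_lift f u"
  by (induction t rule: tensor.abs_induct; induction u rule: tensor.abs_induct)
    (simp add: plus_tensor.abs_eq tensor_lift_abs pm_extend_Q)

lemma tensor_lift_scale: "tensor_lift f (c *\<^sub>Q t) = c *\<^sub>Q tensor_lift f t"
  by (induction t rule: tensor.abs_induct) (simp add: scaleQ_tensor.abs_eq tensor_lift_abs pm_extend_Q)

lemma tensor_lift_zero: "tensor_lift f 0 = 0"
  using tensor_lift_add[of 0 0] by simp

end


lemma tensor_lift_plus_fun:
  "tensor_lift (\<lambda>a b. f a b + g a b) t = tensor_lift f t + tensor_lift g t"
  by (simp add: tensor_lift_def pm_extend_def case_prod_beta scaleQ_right_distrib sum.distrib)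

lemma tensor_lift_scale_fun:
  "tensor_lift (\<lambda>a b. c *\<^sub>Q f a b) t = c *\<^sub>Q tensor_lift f t"
  by (simp add: tensor_lift_def pm_extend_def case_prod_beta cq.scale_sum_right mult.commute)

subsection \<open>The tensor product of two superalgebras\<close>

lemma hcomp_homogeneous:
  "homogeneous s x \<Longrightarrow> hcomp t x = (if t = s then x else 0)"
  using hcomp_hcomp[of t s x] by simp

lemma homogeneous_hcomp [simp]: "homogeneous s (hcomp s x)"
  by (simp add: hcomp_hcomp)

lemma hcomp_zero [simp]: "hcomp s 0 = 0"
  using hcomp_add[of s 0 0] by simp

lemma homogeneous_mult:
  "homogeneous s x \<Longrightarrow> homogeneous t y \<Longrightarrow> homogeneous (s \<noteq> t) (x * y)"
  using hcomp_mult[of s t x y] by simp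

lemma hcomp_other_parity:
  "homogeneous True x \<Longrightarrow> hcomp False x = 0" "homogeneous False x \<Longrightarrow> hcomp True x = 0"
  using hcomp_homogeneous[of True x False] hcomp_homogeneous[of False x True] by auto

lemma tens_decompose:
  "a \<otimes> b = (\<Sum>s\<in>UNIV. \<Sum>t\<in>UNIV. hcomp s a \<otimes> hcomp t b)"
proof -
  have "a \<otimes> b = (hcomp False a + hcomp True a) \<otimes> (hcomp False b + hcomp True b)"
    by (simp add: hcomp_sum)
  also have "\<dots> = (\<Sum>s\<in>UNIV. \<Sum>t\<in>UNIV. hcomp s a \<otimes> hcomp t b)"
    by (simp only: UNIV_bool tens_add_left tens_add_right add_ac) (simp add: add_ac)
  finally show ?thesis .
qed

lemma tensor_homogeneous_induct [case_names zero add_tens]: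
  fixes t :: "('a::cq_superalgebra, 'b::cq_superalgebra) tensor"
  assumes "P 0"
    and "\<And>a b r s t. homogeneous r a \<Longrightarrow> homogeneous s b \<Longrightarrow> P t \<Longrightarrow> P (a \<otimes> b + t)"
  shows "P t"
proof (induction t rule: tensor_induct)
  case zero
  show ?case by fact
next
  case (add_tens a b t)
  have "a \<otimes> b + t = hcomp False a \<otimes> hcomp False b + (hcomp False a \<otimes> hcomp True b +
      (hcomp True a \<otimes> hcomp False b + (hcomp True a \<otimes> hcomp True b + t)))"
    by (subst tens_decompose) (simp add: UNIV_bool add.assoc)
  also have "P \<dots>"
    by (intro assms(2)[OF homogeneous_hcomp homogeneous_hcomp] add_tens)
  finally show ?case .
qed

definition tensor_mult_tens ::
    "'a::cq_superalgebra \<Rightarrow> 'b::cq_superalgebra \<Rightarrow> 'a \<Rightarrow> 'b \<Rightarrow> ('a, 'b) tensor"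
  where "tensor_mult_tens a b a' b' =
    (\<Sum>s\<in>UNIV. \<Sum>t\<in>UNIV. sign (s \<and> t) *\<^sub>Q ((a * hcomp t a') \<otimes> (hcomp s b * b')))"

lemma tensor_mult_tens_linear:
  "tensor_mult_tens (a + x) b a' b' = tensor_mult_tens a b a' b' + tensor_mult_tens x b a' b'"
  "tensor_mult_tens a (b + y) a' b' = tensor_mult_tens a b a' b' + tensor_mult_tens a y a' b'"
  "tensor_mult_tens a b (a' + x) b' = tensor_mult_tens a b a' b' + tensor_mult_tens a b x b'"
  "tensor_mult_tens a b a' (b' + y) = tensor_mult_tens a b a' b' + tensor_mult_tens a b a' y"
  "tensor_mult_tens (c *\<^sub>Q a) b a' b' = c *\<^sub>Q tensor_mult_tens a b a' b'"
  "tensor_mult_tens a (c *\<^sub>Q b) a' b' = c *\<^sub>Q tensor_mult_tens a b a' b'"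
  "tensor_mult_tens a b (c *\<^sub>Q a') b' = c *\<^sub>Q tensor_mult_tens a b a' b'"
  "tensor_mult_tens a b a' (c *\<^sub>Q b') = c *\<^sub>Q tensor_mult_tens a b a' b'"
  unfolding tensor_mult_tens_def
  by (simp_all add: hcomp_add hcomp_scaleQ distrib_left distrib_right sum.distrib
      scaleQ_right_distrib scaleQ_mult_left scaleQ_mult_right tens_add_left tens_add_right
      tens_scale_left tens_scale_right cq.scale_sum_right mult.commute)

lemma bilinear_tensor_mult_tens:
  "bilinearQ (tensor_mult_tens a b)" "bilinearQ (\<lambda>a b. tensor_mult_tens a b a' b')"
  by (simp_all add: bilinearQ_def tensor_mult_tens_linear)

lemma bilinear_times_aux:
  fixes y :: "('a::cq_superalgebra, 'b::cq_superalgebra) tensor"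
  shows "bilinearQ (\<lambda>a b. tensor_lift (tensor_mult_tens a b) y)"
proof -
  have "tensor_mult_tens (a + a') b = (\<lambda>c d. tensor_mult_tens a b c d + tensor_mult_tens a' b c d)"
    "tensor_mult_tens a (b + b') = (\<lambda>c d. tensor_mult_tens a b c d + tensor_mult_tens a b' c d)"
    "tensor_mult_tens (c *\<^sub>Q a) b = (\<lambda>c' d. c *\<^sub>Q tensor_mult_tens a b c' d)"
    "tensor_mult_tens a (c *\<^sub>Q b) = (\<lambda>c' d. c *\<^sub>Q tensor_mult_tens a b c' d)"
    for a a' :: 'a and b b' :: 'b and c
    by (rule ext, rule ext, rule tensor_mult_tens_linear)+
  then show ?thesis
    by (simp add: bilinearQ_def tensor_lift_plus_fun tensor_lift_scale_fun)
qed

definition hcomp_tens :: "bool \<Rightarrow> 'a::cq_superalgebra \<Rightarrow> 'b::cq_superalgebra \<Rightarrow> ('a, 'b) tensor"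
  where "hcomp_tens r a b = (\<Sum>s\<in>UNIV. hcomp s a \<otimes> hcomp (s \<noteq> r) b)"

lemma bilinear_hcomp_tens: "bilinearQ (hcomp_tens r)"
  by (simp add: bilinearQ_def hcomp_tens_def hcomp_add hcomp_scaleQ tens_add_left tens_add_right
      tens_scale_left tens_scale_right UNIV_bool algebra_simps)

instantiation tensor :: (cq_superalgebra, cq_superalgebra) cq_superalgebra
begin

definition one_tensor :: "('a, 'b) tensor"
  where "1 = 1 \<otimes> 1"

definition times_tensor :: "('a, 'b) tensor \<Rightarrow> ('a, 'b) tensor \<Rightarrow> ('a, 'b) tensor"
  where "x * y = tensor_lift (\<lambda>a b. tensor_lift (tensor_mult_tens a b) y) x"

definition hcomp_tensor :: "bool \<Rightarrow> ('a, 'b) tensor \<Rightarrow> ('a, 'b) tensor"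
  where "hcomp r = tensor_lift (hcomp_tens r)"

lemma tensor_mult_tens: "(a \<otimes> b) * (a' \<otimes> b') = tensor_mult_tens a b a' (b' :: 'b) "
  by (simp add: times_tensor_def tensor_lift_tens bilinear_tensor_mult_tens)

lemma tensor_mult_homogeneous:
  "homogeneous s b \<Longrightarrow> homogeneous t a' \<Longrightarrow>
    (a \<otimes> b) * (a' \<otimes> b') = sign (s \<and> t) *\<^sub>Q ((a * a') \<otimes> (b * b' :: 'b))"
  by (cases s; cases t)
    (simp_all add: tensor_mult_tens tensor_mult_tens_def UNIV_bool hcomp_other_parity)

lemma hcomp_tens_homogeneous:
  "homogeneous s a \<Longrightarrow> homogeneous t b \<Longrightarrow>
    hcomp r (a \<otimes> b) = (if r = (s \<noteq> t) then a \<otimes> b else 0)"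
  by (cases r; cases s; cases t)
    (simp_all add: hcomp_tensor_def hcomp_tens_def tensor_lift_tens bilinear_hcomp_tens UNIV_bool hcomp_other_parity)

lemma tensor_mult_linear:
  fixes x y z :: "('a, 'b) tensor"
  shows "(x + y) * z = x * z + y * z" "x * (y + z) = x * y + x * z"
    "(c *\<^sub>Q x) * z = c *\<^sub>Q (x * z)" "x * (c *\<^sub>Q z) = c *\<^sub>Q (x * z)" "0 * z = 0" "z * 0 = 0"
  by (simp_all add: times_tensor_def tensor_lift_add tensor_lift_scale tensor_lift_zero
      bilinear_times_aux bilinear_tensor_mult_tens tensor_lift_plus_fun tensor_lift_scale_fun)
    (simp add: tensor_lift_def pm_extend_def)

lemma hcomp_tensor_linear:
  fixes x y :: "('a, 'b) tensor"
  shows "hcomp s (x + y) = hcomp s x + hcomp s y" "hcomp s (c *\<^sub>Q x) = c *\<^sub>Q hcomp s x"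
    "hcomp s (0 :: ('a, 'b) tensor) = 0"
  by (simp_all add: hcomp_tensor_def tensor_lift_add tensor_lift_scale tensor_lift_zero
      bilinear_hcomp_tens)

instance
proof
  fix x y z :: "('a, 'b) tensor" and c :: cq and s t :: bool
  note lin = tensor_mult_linear hcomp_tensor_linear
  have assoc1: "(a \<otimes> b) * (a' \<otimes> b') * (a'' \<otimes> b'') = (a \<otimes> b) * ((a' \<otimes> b') * (a'' \<otimes> b''))"
    if "homogeneous u b" "homogeneous v a'" "homogeneous w b'" "homogeneous r a''"
    for a a' a'' :: 'a and b b' b'' :: 'b and u v w r
  proof -
    have "(a \<otimes> b) * (a' \<otimes> b') * (a'' \<otimes> b'') =
      (sign (u \<and> v) * sign ((u \<noteq> w) \<and> r)) *\<^sub>Q ((a * a' * a'') \<otimes> (b * b' * b''))"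
      by (simp add: tensor_mult_homogeneous[OF that(1,2)] tensor_mult_linear
          tensor_mult_homogeneous[OF homogeneous_mult[OF that(1,3)] that(4)])
    moreover have "(a \<otimes> b) * ((a' \<otimes> b') * (a'' \<otimes> b'')) =
      (sign (w \<and> r) * sign (u \<and> (v \<noteq> r))) *\<^sub>Q ((a * a' * a'') \<otimes> (b * b' * b''))"
      by (simp add: tensor_mult_homogeneous[OF that(3,4)] tensor_mult_linear mult.assoc
          tensor_mult_homogeneous[OF that(1) homogeneous_mult[OF that(2,4)]])
    moreover have "sign (u \<and> v) * sign ((u \<noteq> w) \<and> r) = sign (w \<and> r) * sign (u \<and> (v \<noteq> r))"
      by (auto simp: sign_def)
    ultimately show ?thesis by simp
  qed
  have assoc2: "(a \<otimes> b) * (a' \<otimes> b') * z = (a \<otimes> b) * ((a' \<otimes> b') * z)"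
    if "homogeneous u b" "homogeneous v a'" "homogeneous w b'" for a a' b b' u v w z
    by (induction z rule: tensor_homogeneous_induct) (simp_all add: lin assoc1[OF that])
  have assoc3: "(a \<otimes> b) * y * z = (a \<otimes> b) * (y * z)" if "homogeneous u b" for a b u y z
    by (induction y rule: tensor_homogeneous_induct) (simp_all add: lin assoc2[OF that])
  show "x * y * z = x * (y * z)"
    by (induction x rule: tensor_homogeneous_induct) (simp_all add: lin assoc3)
  show "(x + y) * z = x * z + y * z" "x * (y + z) = x * y + x * z"
    "(c *\<^sub>Q x) * y = c *\<^sub>Q (x * y)" "x * (c *\<^sub>Q y) = c *\<^sub>Q (x * y)"
    "hcomp s (x + y) = hcomp s x + hcomp s y" "hcomp s (c *\<^sub>Q x) = c *\<^sub>Q hcomp s x"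
    by (rule lin)+
  show "1 * x = x"
    by (induction x rule: tensor_homogeneous_induct)
      (simp_all add: lin one_tensor_def tensor_mult_homogeneous[of False] hcomp_one sign_def)
  show "x * 1 = x"
    by (induction x rule: tensor_homogeneous_induct)
      (simp_all add: lin one_tensor_def tensor_mult_homogeneous[of _ _ False] hcomp_one sign_def)
  show "hcomp s (hcomp t x) = (if s = t then hcomp t x else 0)"
    by (induction x rule: tensor_homogeneous_induct) (auto simp: lin hcomp_tens_homogeneous)
  show "hcomp False x + hcomp True x = x"
  proof (induction x rule: tensor_homogeneous_induct)
    case (add_tens a b r s t)
    then show ?case
      by (cases "r = s") (auto simp: lin hcomp_tens_homogeneous add_ac)
  qed (simp add: lin)
  show "hcomp False (1 :: ('a, 'b) tensor) = 1"
    by (simp add: one_tensor_def hcomp_tens_homogeneous[of False _ False] hcomp_one)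
  have hm1: "hcomp (p \<noteq> t) ((a \<otimes> b) * hcomp t y) = (a \<otimes> b) * hcomp t y"
    if "homogeneous u a" "homogeneous v b" "p = (u \<noteq> v)" for a b u v y p
  proof (induction y rule: tensor_homogeneous_induct)
    case (add_tens a' b' r w y)
    have "hcomp (p \<noteq> t) ((a \<otimes> b) * hcomp t (a' \<otimes> b')) = (a \<otimes> b) * hcomp t (a' \<otimes> b')"
    proof (cases "t = (r \<noteq> w)")
      case True
      then have pt: "(p \<noteq> t) = ((u \<noteq> r) \<noteq> (v \<noteq> w))"
        using that(3) by auto
      have "hcomp ((u \<noteq> r) \<noteq> (v \<noteq> w)) ((a * a') \<otimes> (b * b')) = (a * a') \<otimes> (b * b')"
        by (subst hcomp_tens_homogeneous[OF homogeneous_mult[OF that(1) add_tens(1)]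
              homogeneous_mult[OF that(2) add_tens(2)]]) (rule if_P, rule refl)
      then show ?thesis
        unfolding pt by (simp only: hcomp_tens_homogeneous[OF add_tens(1,2)] True if_P[OF refl]
            tensor_mult_homogeneous[OF that(2) add_tens(1)] lin)
    next
      case False
      then show ?thesis
        by (simp only: hcomp_tens_homogeneous[OF add_tens(1,2)] if_False lin)
    qed
    with add_tens(3) show ?case
      by (simp only: lin)
  qed (simp add: lin)
  show "hcomp (s \<noteq> t) (hcomp s x * hcomp t y) = hcomp s x * hcomp t y"
  proof (induction x rule: tensor_homogeneous_induct)
    case (add_tens a b r w x)
    have "hcomp (s \<noteq> t) (hcomp s (a \<otimes> b) * hcomp t y) = hcomp s (a \<otimes> b) * hcomp t y"
    proof (cases "s = (r \<noteq> w)")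
      case True
      show ?thesis
        using hm1[OF add_tens(1,2) True]
        by (simp only: hcomp_tens_homogeneous[OF add_tens(1,2)] if_P[OF True])
    next
      case False
      show ?thesis
        by (simp only: hcomp_tens_homogeneous[OF add_tens(1,2)] if_not_P[OF False] lin)
    qed
    with add_tens(3) show ?case
      by (simp only: lin)
  qed (simp add: lin)
qed

end

subsection \<open>Super matrices in two tensor factors\<close>

text \<open>An index type is an ordered homogeneous basis of \<open>V\<close>; \<open>odd_index i\<close> is the parity of the
  basis vector \<open>v\<^sub>i\<close>.\<close>

class super_index = finite + linorder +
  fixes odd_index :: "'a \<Rightarrow> bool"

abbreviation par :: "'n::super_index \<Rightarrow> 'n \<Rightarrow> bool"
  where "par i j \<equiv> odd_index i \<noteq> odd_index j"

text \<open>An element of \<open>A \<otimes> End V \<otimes> End V\<close> is represented by its coefficients: \<open>X i j k l\<close> is the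
  coefficient in \<open>A\<close> of \<open>E\<^sub>i\<^sub>j \<otimes> E\<^sub>k\<^sub>l\<close>.  The signs in the product come from moving the \<open>s\<close>-component
  of \<open>Y a j c l\<close> past \<open>E\<^sub>i\<^sub>a \<otimes> E\<^sub>k\<^sub>c\<close> and \<open>E\<^sub>a\<^sub>j\<close> past \<open>E\<^sub>k\<^sub>c\<close>.\<close>

type_synonym ('n, 'a) mat2 = "'n \<Rightarrow> 'n \<Rightarrow> 'n \<Rightarrow> 'n \<Rightarrow> 'a"

definition mat2_mult ::
    "('n::super_index, 'a::cq_superalgebra) mat2 \<Rightarrow> ('n, 'a) mat2 \<Rightarrow> ('n, 'a) mat2"
    (infixl \<open>\<odot>\<close> 70)
  where "(X \<odot> Y) i j k l = (\<Sum>a\<in>UNIV. \<Sum>c\<in>UNIV. \<Sum>s\<in>UNIV.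
    (sign ((par i a \<noteq> par k c) \<and> s) * sign (par k c \<and> par a j)) *\<^sub>Q
      (X i a k c * hcomp s (Y a j c l)))"

definition mat2_const :: "('n, cq) mat2 \<Rightarrow> ('n, 'a::cq_superalgebra) mat2"
  where "mat2_const X i j k l = X i j k l *\<^sub>Q 1"

definition leg1 :: "('n \<Rightarrow> 'n \<Rightarrow> 'a::zero) \<Rightarrow> ('n, 'a) mat2"
  where "leg1 L i j k l = (if k = l then L i j else 0)"

definition leg2 :: "('n \<Rightarrow> 'n \<Rightarrow> 'a::zero) \<Rightarrow> ('n, 'a) mat2"
  where "leg2 L i j k l = (if i = j then L k l else 0)"

subsection \<open>The R-matrix\<close>

definition eps_form :: "'n::super_index \<Rightarrow> 'n \<Rightarrow> int"
  where "eps_form i j = (if i = j then (if odd_index i then - 1 else 1) else 0)"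

definition Rmat :: "('n::super_index, cq) mat2"
  where "Rmat i j k l =
    (if i = j \<and> k = l then qq powi (- eps_form i k) else 0)
    - (qq - inverse qq) * (if i < j \<and> k = j \<and> l = i then sign (odd_index j) else 0)"

definition Rmat_inv :: "('n::super_index, cq) mat2"
  where "Rmat_inv i j k l =
    (if i = j \<and> k = l then qq powi eps_form i k else 0)
    + (qq - inverse qq) * (if i < j \<and> k = j \<and> l = i then sign (odd_index j) else 0)"

text \<open>\<open>\<tau>(E\<^sub>i\<^sub>j \<otimes> E\<^sub>k\<^sub>l) = \<plusminus>E\<^sub>k\<^sub>l \<otimes> E\<^sub>i\<^sub>j\<close>\<close>

definition mat2_flip :: "('n::super_index, cq) mat2 \<Rightarrow> ('n, cq) mat2"
  where "mat2_flip X i j k l = sign (par i j \<and> par k l) * X k l i j"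

subsection \<open>Matrices of even elements\<close>

definition even_mat2 :: "('n::super_index, 'a::cq_superalgebra) mat2 \<Rightarrow> bool"
  where "even_mat2 X \<longleftrightarrow> (\<forall>i j k l. homogeneous (par i j \<noteq> par k l) (X i j k l))"

definition even_mat :: "('n::super_index \<Rightarrow> 'n \<Rightarrow> 'a::cq_superalgebra) \<Rightarrow> bool"
  where "even_mat L \<longleftrightarrow> (\<forall>i j. homogeneous (par i j) (L i j))"

lemma homogeneous_scaleQ: "homogeneous s x \<Longrightarrow> homogeneous s (c *\<^sub>Q x)"
  by (simp add: hcomp_scaleQ)

lemma hcomp_sum_distrib: "hcomp s (\<Sum>i\<in>A. f i) = (\<Sum>i\<in>A. hcomp s (f i))"
  by (induction A rule: infinite_finite_induct) (auto simp: hcomp_add)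

lemma homogeneous_sum: "(\<And>i. i \<in> A \<Longrightarrow> homogeneous s (f i)) \<Longrightarrow> homogeneous s (\<Sum>i\<in>A. f i)"
  by (simp add: hcomp_sum_distrib)

lemma mat2_mult_even:
  assumes "even_mat2 Y"
  shows "(X \<odot> Y) i j k l = (\<Sum>a\<in>UNIV. \<Sum>c\<in>UNIV.
    (sign ((par i a \<noteq> par k c) \<and> (par a j \<noteq> par c l)) * sign (par k c \<and> par a j)) *\<^sub>Q
      (X i a k c * Y a j c l))"
  unfolding mat2_mult_def
proof (intro sum.cong refl, goal_cases)
  case (1 a c)
  have h: "hcomp s (Y a j c l) = (if s = (par a j \<noteq> par c l) then Y a j c l else 0)" for s
    using assms hcomp_homogeneous unfolding even_mat2_def by blast
  show ?case
    by (cases "par a j \<noteq> par c l") (simp_all add: UNIV_bool h)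
qed

lemma even_mat2_mult:
  assumes "even_mat2 X" "even_mat2 Y"
  shows "even_mat2 (X \<odot> Y)"
  unfolding even_mat2_def mat2_mult_even[OF assms(2)]
proof (intro allI homogeneous_sum homogeneous_scaleQ)
  fix i j k l a c :: 'a
  have "homogeneous ((par i a \<noteq> par k c) \<noteq> (par a j \<noteq> par c l)) (X i a k c * Y a j c l)"
    using assms by (intro homogeneous_mult) (auto simp: even_mat2_def)
  moreover have "((par i a \<noteq> par k c) \<noteq> (par a j \<noteq> par c l)) = (par i j \<noteq> par k l)"
    by auto
  ultimately show "homogeneous (par i j \<noteq> par k l) (X i a k c * Y a j c l)"
    by simp
qed

lemma mat2_mult_assoc:
  fixes X :: "('n::super_index, 'a::cq_superalgebra) mat2"
  assumes "even_mat2 Y" "even_mat2 Z"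
  shows "(X \<odot> Y) \<odot> Z = X \<odot> (Y \<odot> Z)"
proof (intro ext)
  fix i j k l :: 'n
  have sgn: "sign ((par i b \<noteq> par k d) \<and> (par b j \<noteq> par d l)) * sign (par k d \<and> par b j) *
      (sign ((par i a \<noteq> par k c) \<and> (par a b \<noteq> par c d)) * sign (par k c \<and> par a b)) =
    sign ((par i a \<noteq> par k c) \<and> (par a j \<noteq> par c l)) * sign (par k c \<and> par a j) *
      (sign ((par a b \<noteq> par c d) \<and> (par b j \<noteq> par d l)) * sign (par c d \<and> par b j))"
    for a b c d :: 'n
    by (cases "odd_index i"; cases "odd_index j"; cases "odd_index k"; cases "odd_index l";
        cases "odd_index a"; cases "odd_index b"; cases "odd_index c"; cases "odd_index d")
      (simp_all add: sign_def)
  have "((X \<odot> Y) \<odot> Z) i j k l = (\<Sum>b\<in>UNIV. \<Sum>d\<in>UNIV. \<Sum>a\<in>UNIV. \<Sum>c\<in>UNIV.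
      (sign ((par i b \<noteq> par k d) \<and> (par b j \<noteq> par d l)) * sign (par k d \<and> par b j) *
      (sign ((par i a \<noteq> par k c) \<and> (par a b \<noteq> par c d)) * sign (par k c \<and> par a b))) *\<^sub>Q
      (X i a k c * Y a b c d * Z b j d l))"
    by (simp add: mat2_mult_even assms sum_distrib_right cq.scale_sum_right scaleQ_mult_left)
  also have "\<dots> = (\<Sum>b\<in>UNIV. \<Sum>d\<in>UNIV. \<Sum>a\<in>UNIV. \<Sum>c\<in>UNIV.
      (sign ((par i a \<noteq> par k c) \<and> (par a j \<noteq> par c l)) * sign (par k c \<and> par a j) *
      (sign ((par a b \<noteq> par c d) \<and> (par b j \<noteq> par d l)) * sign (par c d \<and> par b j))) *\<^sub>Q
      (X i a k c * (Y a b c d * Z b j d l)))"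
    by (intro sum.cong refl arg_cong2[where f = scaleQ]) (rule sgn mult.assoc)+
  also have "\<dots> = (\<Sum>b\<in>UNIV. \<Sum>a\<in>UNIV. \<Sum>d\<in>UNIV. \<Sum>c\<in>UNIV.
      (sign ((par i a \<noteq> par k c) \<and> (par a j \<noteq> par c l)) * sign (par k c \<and> par a j) *
      (sign ((par a b \<noteq> par c d) \<and> (par b j \<noteq> par d l)) * sign (par c d \<and> par b j))) *\<^sub>Q
      (X i a k c * (Y a b c d * Z b j d l)))"
    by (intro sum.cong refl sum.swap)
  also have "\<dots> = (\<Sum>a\<in>UNIV. \<Sum>b\<in>UNIV. \<Sum>c\<in>UNIV. \<Sum>d\<in>UNIV.
      (sign ((par i a \<noteq> par k c) \<and> (par a j \<noteq> par c l)) * sign (par k c \<and> par a j) *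
      (sign ((par a b \<noteq> par c d) \<and> (par b j \<noteq> par d l)) * sign (par c d \<and> par b j))) *\<^sub>Q
      (X i a k c * (Y a b c d * Z b j d l)))"
    by (subst sum.swap, intro sum.cong refl sum.swap)
  also have "\<dots> = (\<Sum>a\<in>UNIV. \<Sum>c\<in>UNIV. \<Sum>b\<in>UNIV. \<Sum>d\<in>UNIV.
      (sign ((par i a \<noteq> par k c) \<and> (par a j \<noteq> par c l)) * sign (par k c \<and> par a j) *
      (sign ((par a b \<noteq> par c d) \<and> (par b j \<noteq> par d l)) * sign (par c d \<and> par b j))) *\<^sub>Q
      (X i a k c * (Y a b c d * Z b j d l)))"
    by (intro sum.cong refl sum.swap)
  also have "\<dots> = (X \<odot> (Y \<odot> Z)) i j k l"
    by (simp add: mat2_mult_even assms even_mat2_mult sum_distrib_left cq.scale_sum_right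
        scaleQ_mult_right)
  finally show "((X \<odot> Y) \<odot> Z) i j k l = (X \<odot> (Y \<odot> Z)) i j k l" .
qed

lemma even_leg: "even_mat L \<Longrightarrow> even_mat2 (leg1 L)" "even_mat L \<Longrightarrow> even_mat2 (leg2 L)"
  by (auto simp: even_mat_def even_mat2_def leg1_def leg2_def)

lemma even_Rmat: "even_mat2 (mat2_const Rmat :: ('n::super_index, 'a::cq_superalgebra) mat2)"
  unfolding even_mat2_def
proof (intro allI)
  fix i j k l :: 'n
  show "homogeneous (par i j \<noteq> par k l) (mat2_const Rmat i j k l :: 'a)"
  proof (cases "Rmat i j k l = 0")
    case True
    then show ?thesis by (simp add: mat2_const_def)
  next
    case False
    then have "(par i j \<noteq> par k l) = False"
      by (auto simp: Rmat_def split: if_splits)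
    then show ?thesis
      by (simp only: mat2_const_def hcomp_scaleQ hcomp_one)
  qed
qed

lemma sign_simps [simp]: "sign False = 1" "sign s * sign s = 1"
  by (simp_all add: sign_def)

lemma sign_square_left [simp]: "sign s * (sign s * c) = c"
  by (simp add: sign_def)

lemma leg_mult:
  fixes A B :: "'n::super_index \<Rightarrow> 'n \<Rightarrow> 'a::cq_superalgebra"
  assumes "even_mat A" "even_mat B"
  shows "(leg1 A \<odot> leg2 B) i j k l = sign (par i j \<and> par k l) *\<^sub>Q (A i j * B k l)"
    and "(leg2 B \<odot> leg1 A) i j k l = B k l * A i j"
proof -
  have *: "(\<Sum>a\<in>UNIV. \<Sum>c\<in>UNIV. if a = x \<and> c = y then f a c else 0) = (f x y :: 'a)"
    for f and x y :: 'n
    by (simp add: sum.If_cases flip: if_if_eq_conj)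
  have "(leg1 A \<odot> leg2 B) i j k l = (\<Sum>a\<in>UNIV. \<Sum>c\<in>UNIV. if a = j \<and> c = k then
     (sign ((par i a \<noteq> par k c) \<and> (par a j \<noteq> par c l)) * sign (par k c \<and> par a j)) *\<^sub>Q
      (A i a * B c l) else 0)"
    unfolding mat2_mult_even[OF even_leg(2)[OF assms(2)]]
    by (intro sum.cong refl) (auto simp: leg1_def leg2_def)
  then show "(leg1 A \<odot> leg2 B) i j k l = sign (par i j \<and> par k l) *\<^sub>Q (A i j * B k l)"
    unfolding * by simp
  have "(leg2 B \<odot> leg1 A) i j k l = (\<Sum>a\<in>UNIV. \<Sum>c\<in>UNIV. if a = i \<and> c = l then
     (sign ((par i a \<noteq> par k c) \<and> (par a j \<noteq> par c l)) * sign (par k c \<and> par a j)) *\<^sub>Q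
      (B k c * A a j) else 0)"
    unfolding mat2_mult_even[OF even_leg(1)[OF assms(1)]]
    by (intro sum.cong refl) (auto simp: leg1_def leg2_def)
  then show "(leg2 B \<odot> leg1 A) i j k l = B k l * A i j"
    unfolding * by (auto simp: sign_def)
qed

definition mat_mult :: "('n::super_index \<Rightarrow> 'n \<Rightarrow> 'a::cq_superalgebra) \<Rightarrow> ('n \<Rightarrow> 'n \<Rightarrow> 'a) \<Rightarrow> 'n \<Rightarrow> 'n \<Rightarrow> 'a"
  where "mat_mult A B i j = (\<Sum>k\<in>UNIV. sign (par i k \<and> par k j) *\<^sub>Q (A i k * B k j))"

lemma even_mat_mult:
  assumes "even_mat A" "even_mat B"
  shows "even_mat (mat_mult A B)"
  unfolding even_mat_def mat_mult_def
proof (intro allI homogeneous_sum homogeneous_scaleQ)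
  fix i j k :: 'a
  have "homogeneous (par i k \<noteq> par k j) (A i k * B k j)"
    using assms by (intro homogeneous_mult) (auto simp: even_mat_def)
  moreover have "(par i k \<noteq> par k j) = par i j"
    by auto
  ultimately show "homogeneous (par i j) (A i k * B k j)"
    by simp
qed

lemma leg_mat_mult:
  fixes A B :: "'n::super_index \<Rightarrow> 'n \<Rightarrow> 'a::cq_superalgebra"
  assumes "even_mat A" "even_mat B"
  shows "leg1 (mat_mult A B) = leg1 A \<odot> leg1 B"
    and "leg2 (mat_mult A B) = leg2 A \<odot> leg2 B"
proof -
  have *: "(\<Sum>a\<in>UNIV. \<Sum>c\<in>UNIV. if c = k \<and> k = l then f a c else 0) =
      (if k = l then (\<Sum>a\<in>UNIV. f a k) else (0::'a))"
    "(\<Sum>a\<in>UNIV. \<Sum>c\<in>UNIV. if a = i \<and> i = j then f a c else 0) =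
      (if i = j then (\<Sum>c\<in>UNIV. f i c) else 0)"
    for f :: "'n \<Rightarrow> 'n \<Rightarrow> 'a" and i j k l :: 'n
  proof -
    have "(\<Sum>c\<in>UNIV. if a = i \<and> i = j then f a c else 0) =
      (if a = i then if i = j then (\<Sum>c\<in>UNIV. f i c) else 0 else 0)" for a
      by simp
    then show "(\<Sum>a\<in>UNIV. \<Sum>c\<in>UNIV. if a = i \<and> i = j then f a c else 0) =
      (if i = j then (\<Sum>c\<in>UNIV. f i c) else 0)"
      by (simp only:) simp
  qed (simp add: sum.If_cases flip: if_if_eq_conj)
  have "(leg1 A \<odot> leg1 B) i j k l = (\<Sum>a\<in>UNIV. \<Sum>c\<in>UNIV. if c = k \<and> k = l then
     (sign (par i a \<and> par a j)) *\<^sub>Q (A i a * B a j) else 0)" for i j k l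
    unfolding mat2_mult_even[OF even_leg(1)[OF assms(2)]]
    by (intro sum.cong refl) (auto simp: leg1_def)
  then show "leg1 (mat_mult A B) = leg1 A \<odot> leg1 B"
    by (intro ext) (simp only: *, simp add: leg1_def mat_mult_def)
  have "(leg2 A \<odot> leg2 B) i j k l = (\<Sum>a\<in>UNIV. \<Sum>c\<in>UNIV. if a = i \<and> i = j then
     (sign (par k c \<and> par c l)) *\<^sub>Q (A k c * B c l) else 0)" for i j k l
    unfolding mat2_mult_even[OF even_leg(2)[OF assms(2)]]
    by (intro sum.cong refl) (auto simp: leg2_def)
  then show "leg2 (mat_mult A B) = leg2 A \<odot> leg2 B"
    by (intro ext) (simp only: *, simp add: leg2_def mat_mult_def)
qed

definition rll_equation :: "('n::super_index \<Rightarrow> 'n \<Rightarrow> 'a::cq_superalgebra) \<Rightarrow> ('n \<Rightarrow> 'n \<Rightarrow> 'a) \<Rightarrow> bool"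
  where "rll_equation A B \<longleftrightarrow>
    mat2_const Rmat \<odot> leg1 A \<odot> leg2 B = leg2 B \<odot> leg1 A \<odot> mat2_const Rmat"

definition mats_commute :: "('n::super_index \<Rightarrow> 'n \<Rightarrow> 'a::cq_superalgebra) \<Rightarrow> ('n \<Rightarrow> 'n \<Rightarrow> 'a) \<Rightarrow> bool"
  where "mats_commute A B \<longleftrightarrow>
    (\<forall>i j k l. B k l * A i j = sign (par i j \<and> par k l) *\<^sub>Q (A i j * B k l))"

lemma rll_equation_mat_mult:
  assumes ev: "even_mat A" "even_mat A'" "even_mat B" "even_mat B'"
    and eq: "rll_equation A B" "rll_equation A' B'"
    and comm: "mats_commute A' B" "mats_commute A B'"
  shows "rll_equation (mat_mult A A') (mat_mult B B')"
proof -
  note even = even_leg[OF ev(1)] even_leg[OF ev(2)] even_leg[OF ev(3)] even_leg[OF ev(4)]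
    even_Rmat even_mat2_mult
  note assoc = mat2_mult_assoc[OF even_mat2_mult] mat2_mult_assoc
  let ?R = "mat2_const Rmat"
  have c: "leg1 A' \<odot> leg2 B = leg2 B \<odot> leg1 A'" "leg1 A \<odot> leg2 B' = leg2 B' \<odot> leg1 A"
    using comm by (intro ext, simp add: leg_mult ev mats_commute_def)+
  have e: "?R \<odot> leg1 A \<odot> leg2 B = leg2 B \<odot> leg1 A \<odot> ?R"
    "?R \<odot> leg1 A' \<odot> leg2 B' = leg2 B' \<odot> leg1 A' \<odot> ?R"
    using eq by (auto simp: rll_equation_def)
  have "?R \<odot> leg1 (mat_mult A A') \<odot> leg2 (mat_mult B B') =
      ?R \<odot> leg1 A \<odot> (leg1 A' \<odot> leg2 B) \<odot> leg2 B'"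
    by (simp add: leg_mat_mult ev mat2_mult_assoc even)
  also have "\<dots> = (?R \<odot> leg1 A \<odot> leg2 B) \<odot> leg1 A' \<odot> leg2 B'"
    unfolding c by (simp add: mat2_mult_assoc even)
  also have "\<dots> = leg2 B \<odot> leg1 A \<odot> (?R \<odot> leg1 A' \<odot> leg2 B')"
    unfolding e(1) by (simp add: mat2_mult_assoc even)
  also have "\<dots> = leg2 B \<odot> (leg1 A \<odot> leg2 B') \<odot> leg1 A' \<odot> ?R"
    unfolding e(2) by (simp add: mat2_mult_assoc even)
  also have "\<dots> = leg2 (mat_mult B B') \<odot> leg1 (mat_mult A A') \<odot> ?R"
    unfolding c by (simp add: leg_mat_mult ev mat2_mult_assoc even)
  finally show ?thesis
    by (simp add: rll_equation_def)
qed

section \<open>The RLL superalgebra\<close>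

subsection \<open>The free superalgebra on the generators\<close>

datatype 'n gen = Lp 'n 'n | Lm 'n 'n

fun gen_odd :: "'n::super_index gen \<Rightarrow> bool"
  where "gen_odd (Lp i j) = par i j" | "gen_odd (Lm i j) = par i j"

datatype 'n word = Word (letters: "'n gen list")

instantiation word :: (type) monoid_add
begin

definition zero_word :: "'a word"
  where "0 = Word []"

definition plus_word :: "'a word \<Rightarrow> 'a word \<Rightarrow> 'a word"
  where "u + v = Word (letters u @ letters v)"

instance
  by standard (simp_all add: zero_word_def plus_word_def)

end

definition word_odd :: "'n::super_index word \<Rightarrow> bool"
  where "word_odd w = odd (length (filter gen_odd (letters w)))"

lemma word_odd_plus: "word_odd (u + v) = (word_odd u \<noteq> word_odd v)"
  by (auto simp: word_odd_def plus_word_def)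

lemma word_odd_zero: "\<not> word_odd 0"
  by (auto simp: word_odd_def zero_word_def)

lift_definition pm_restrict :: "('k \<Rightarrow> bool) \<Rightarrow> ('k \<Rightarrow>\<^sub>0 cq) \<Rightarrow> ('k \<Rightarrow>\<^sub>0 cq)"
  is "\<lambda>P f k. if P k then f k else 0"
  by (erule rev_finite_subset) auto

lemma lookup_pm_restrict [simp]:
  "Poly_Mapping.lookup (pm_restrict P x) k = (if P k then Poly_Mapping.lookup x k else 0)"
  by transfer simp

lemma pm_restrict_single:
  "pm_restrict P (Poly_Mapping.single k c) = (if P k then Poly_Mapping.single k c else 0)"
  by (rule poly_mapping_eqI) (auto simp: lookup_single when_def)

lemma pm_restrict_linear:
  "pm_restrict P (x + y) = pm_restrict P x + pm_restrict P y"
  "pm_restrict P (pm_scale c x) = pm_scale c (pm_restrict P x)"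
  "pm_restrict P 0 = 0"
  by (rule poly_mapping_eqI, simp add: lookup_add)+

lemma pm_induct [case_names zero add_single]:
  assumes "P 0" and step: "\<And>k c x. P x \<Longrightarrow> P (Poly_Mapping.single k c + x)"
  shows "P (x :: 'k \<Rightarrow>\<^sub>0 cq)"
proof -
  have "P x" if "finite A" "Poly_Mapping.keys x \<subseteq> A" for A x
    using that
  proof (induction A arbitrary: x rule: finite_induct)
    case empty
    then show ?case using assms(1) by simp
  next
    case (insert k A)
    define y where "y = x - Poly_Mapping.single k (Poly_Mapping.lookup x k)"
    have "Poly_Mapping.keys y \<subseteq> A"
      using insert.prems by (auto simp: y_def in_keys_iff lookup_minus lookup_single when_def split: if_splits)
    then have "P y" by (rule insert.IH)
    from step[OF this, of k "Poly_Mapping.lookup x k"] show ?case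
      by (simp add: y_def)
  qed
  from this[OF finite_keys order_refl] show ?thesis .
qed

lemma pm_scale_mult:
  fixes x y :: "'k::monoid_add \<Rightarrow>\<^sub>0 cq"
  shows "pm_scale c x * y = pm_scale c (x * y)" "x * pm_scale c y = pm_scale c (x * y)"
proof -
  have 1: "pm_scale c (Poly_Mapping.single k d) * y = pm_scale c (Poly_Mapping.single k d * y)"
    "Poly_Mapping.single k d * pm_scale c y = pm_scale c (Poly_Mapping.single k d * y)" for k d
    by (induction y rule: pm_induct)
      (simp_all add: algebra_simps pm_scale_distribs pm_scale_single mult_single)
  show "pm_scale c x * y = pm_scale c (x * y)"
    by (induction x rule: pm_induct) (simp_all add: 1 algebra_simps pm_scale_distribs)
  show "x * pm_scale c y = pm_scale c (x * y)"
    by (induction x rule: pm_induct) (simp_all add: 1 algebra_simps pm_scale_distribs)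
qed

typedef 'n free = "UNIV :: ('n word \<Rightarrow>\<^sub>0 cq) set"
  by simp

setup_lifting type_definition_free

instantiation free :: (super_index) cq_superalgebra
begin

lift_definition zero_free :: "'a free" is 0 .
lift_definition one_free :: "'a free" is 1 .
lift_definition plus_free :: "'a free \<Rightarrow> 'a free \<Rightarrow> 'a free" is "(+)" .
lift_definition minus_free :: "'a free \<Rightarrow> 'a free \<Rightarrow> 'a free" is "(-)" .
lift_definition uminus_free :: "'a free \<Rightarrow> 'a free" is uminus .
lift_definition times_free :: "'a free \<Rightarrow> 'a free \<Rightarrow> 'a free" is "(*)" .
lift_definition scaleQ_free :: "cq \<Rightarrow> 'a free \<Rightarrow> 'a free" is pm_scale .
lift_definition hcomp_free :: "bool \<Rightarrow> 'a free \<Rightarrow> 'a free"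
  is "\<lambda>s. pm_restrict (\<lambda>w. word_odd w = s)" .

instance
proof
  fix x y z :: "'a free" and c d :: cq and s t :: bool
  show "x + y + z = x + (y + z)" "x + y = y + x" "0 + x = x" "- x + x = 0" "x - y = x + - y"
    "x * y * z = x * (y * z)" "(x + y) * z = x * z + y * z" "x * (y + z) = x * y + x * z"
    "1 * x = x" "x * 1 = x"
    by (transfer, simp add: algebra_simps)+
  show "c *\<^sub>Q (x + y) = c *\<^sub>Q x + c *\<^sub>Q y" "(c + d) *\<^sub>Q x = c *\<^sub>Q x + d *\<^sub>Q x"
    "c *\<^sub>Q d *\<^sub>Q x = (c * d) *\<^sub>Q x" "1 *\<^sub>Q x = x"
    by (transfer, simp add: pm_scale_distribs)+
  show "(c *\<^sub>Q x) * y = c *\<^sub>Q (x * y)" "x * (c *\<^sub>Q y) = c *\<^sub>Q (x * y)"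
    by (transfer, simp add: pm_scale_mult)+
  show "hcomp s (x + y) = hcomp s x + hcomp s y" "hcomp s (c *\<^sub>Q x) = c *\<^sub>Q hcomp s x"
    by (transfer, simp add: pm_restrict_linear)+
  show "hcomp s (hcomp t x) = (if s = t then hcomp t x else 0)"
    by (transfer, auto intro!: poly_mapping_eqI)
  show "hcomp False x + hcomp True x = x"
    by (transfer, auto intro!: poly_mapping_eqI simp: lookup_add)
  show "hcomp False 1 = (1 :: 'a free)"
    by (transfer, auto intro!: poly_mapping_eqI simp: lookup_one when_def word_odd_zero)
  show "hcomp (s \<noteq> t) (hcomp s x * hcomp t y) = hcomp s x * hcomp t y"
  proof (transfer, goal_cases)
    case (1 s t x y)
    let ?h = "\<lambda>s. pm_restrict (\<lambda>w. word_odd w = s)"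
    have *: "?h (s \<noteq> t) (?h s (Poly_Mapping.single k c) * ?h t y) =
        ?h s (Poly_Mapping.single k c) * ?h t y" for k c
      by (induction y rule: pm_induct)
        (auto simp: pm_restrict_linear algebra_simps pm_restrict_single mult_single word_odd_plus)
    show ?case
      by (induction x rule: pm_induct) (simp_all only: * pm_restrict_linear distrib_right mult_zero_left)
  qed
qed

end

lift_definition free_gen :: "'n gen \<Rightarrow> 'n free"
  is "\<lambda>g. Poly_Mapping.single (Word [g]) 1" .

lemma homogeneous_free_gen: "homogeneous (gen_odd g) (free_gen g)"
  by transfer (simp add: pm_restrict_single word_odd_def)

subsection \<open>The defining relations\<close>

text \<open>The generators \<open>l\<^sup>+\<^sub>i\<^sub>j\<close> and \<open>l\<^sup>-\<^sub>j\<^sub>i\<close> with \<open>i > j\<close> are superfluous and set to zero.\<close>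

abbreviation freeLp :: "'n \<Rightarrow> 'n \<Rightarrow> 'n free"
  where "freeLp i j \<equiv> free_gen (Lp i j)"

abbreviation freeLm :: "'n \<Rightarrow> 'n \<Rightarrow> 'n free"
  where "freeLm i j \<equiv> free_gen (Lm i j)"

inductive_set rll_relators :: "'n::super_index free set" where
  lower: "j < i \<Longrightarrow> freeLp i j \<in> rll_relators"
| upper: "i < j \<Longrightarrow> freeLm i j \<in> rll_relators"
| inv_pm: "freeLp i i * freeLm i i - 1 \<in> rll_relators"
| inv_mp: "freeLm i i * freeLp i i - 1 \<in> rll_relators"
| rll: "(A, B) \<in> {(freeLp, freeLp), (freeLm, freeLm), (freeLp, freeLm)} \<Longrightarrow>
    (mat2_const Rmat \<odot> leg1 A \<odot> leg2 B) i j k l - (leg2 B \<odot> leg1 A \<odot> mat2_const Rmat) i j k l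
      \<in> rll_relators"

inductive_set rll_ideal :: "'n::super_index free set" where
  zero: "0 \<in> rll_ideal"
| add: "x \<in> rll_ideal \<Longrightarrow> y \<in> rll_ideal \<Longrightarrow> x + y \<in> rll_ideal"
| relator: "r \<in> rll_relators \<Longrightarrow> a * r * b \<in> rll_ideal"

lemma rll_ideal_mult:
  assumes "x \<in> rll_ideal"
  shows "a * x \<in> rll_ideal" "x * a \<in> rll_ideal"
  using assms
proof (induction rule: rll_ideal.induct)
  case (relator r b c)
  case 1 show ?case using rll_ideal.relator[OF relator, of "a * b" c] by (simp add: mult.assoc)
  case 2 show ?case using rll_ideal.relator[OF relator, of b "c * a"] by (simp add: mult.assoc)
qed (auto simp: distrib_left distrib_right intro: rll_ideal.zero rll_ideal.add)

lemma rll_ideal_scale: "x \<in> rll_ideal \<Longrightarrow> c *\<^sub>Q x \<in> rll_ideal"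
  using rll_ideal_mult(1)[of x "c *\<^sub>Q 1"] by (simp add: scaleQ_mult_left)

lemma rll_ideal_uminus: "x \<in> rll_ideal \<Longrightarrow> - x \<in> rll_ideal"
  using rll_ideal_scale[of x "- 1"] by simp

lemma even_free: "even_mat freeLp" "even_mat freeLm"
  unfolding even_mat_def
  by (intro allI, rule homogeneous_free_gen[of "Lp i j" for i j, unfolded gen_odd.simps]
        homogeneous_free_gen[of "Lm i j" for i j, unfolded gen_odd.simps])+

lemma homogeneous_diff: "homogeneous s x \<Longrightarrow> homogeneous s y \<Longrightarrow> homogeneous s (x - y)"
  using hcomp_add[of s "x - y" y] by (simp add: eq_diff_eq)

lemma rll_relators_homogeneous: "r \<in> rll_relators \<Longrightarrow> \<exists>s. homogeneous s r"
proof (induction rule: rll_relators.induct)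
  case (lower j i)
  show ?case using homogeneous_free_gen by blast
next
  case (upper i j)
  show ?case using homogeneous_free_gen by blast
next
  case (inv_pm i)
  show ?case
    using homogeneous_mult[OF homogeneous_free_gen[of "Lp i i"] homogeneous_free_gen[of "Lm i i"]]
    by (intro exI[of _ False] homogeneous_diff hcomp_one) simp
next
  case (inv_mp i)
  show ?case
    using homogeneous_mult[OF homogeneous_free_gen[of "Lm i i"] homogeneous_free_gen[of "Lp i i"]]
    by (intro exI[of _ False] homogeneous_diff hcomp_one) simp
next
  case (rll A B i j k l)
  then have AB: "even_mat A" "even_mat B"
    using even_free by auto
  have "even_mat2 (mat2_const Rmat \<odot> leg1 A \<odot> leg2 B)" "even_mat2 (leg2 B \<odot> leg1 A \<odot> mat2_const Rmat)"
    by (auto intro!: even_mat2_mult even_leg even_Rmat AB)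
  then show ?case
    unfolding even_mat2_def by (metis homogeneous_diff)
qed

lemma rll_ideal_hcomp: "x \<in> rll_ideal \<Longrightarrow> hcomp s x \<in> rll_ideal"
proof (induction rule: rll_ideal.induct)
  case (relator r a b)
  then obtain t where t: "homogeneous t r"
    using rll_relators_homogeneous by blast
  have hom: "homogeneous ((u \<noteq> t) \<noteq> v) (hcomp u a * r * hcomp v b)" for u v
    by (intro homogeneous_mult t homogeneous_hcomp)
  have in_ideal: "hcomp s (hcomp u a * r * hcomp v b) \<in> rll_ideal" for u v
    using hcomp_homogeneous[OF hom, of s u v] rll_ideal.relator[OF relator, of "hcomp u a" "hcomp v b"]
    by (cases "s = ((u \<noteq> t) \<noteq> v)") (simp_all only: if_P[OF refl] if_False rll_ideal.zero)
  have "a * r * b = (hcomp False a + hcomp True a) * r * (hcomp False b + hcomp True b)"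
    by (simp add: hcomp_sum)
  then have "hcomp s (a * r * b) =
     hcomp s (hcomp False a * r * hcomp False b) + hcomp s (hcomp False a * r * hcomp True b) +
     (hcomp s (hcomp True a * r * hcomp False b) + hcomp s (hcomp True a * r * hcomp True b))"
    by (simp only: distrib_left distrib_right hcomp_add add_ac)
  then show ?case
    using in_ideal rll_ideal.add by metis
qed (simp_all add: hcomp_add rll_ideal.zero rll_ideal.add)

subsection \<open>The superalgebra \<open>U(R)\<close>\<close>

definition rll_eq :: "'n::super_index free \<Rightarrow> 'n free \<Rightarrow> bool"
  where "rll_eq x y \<longleftrightarrow> x - y \<in> rll_ideal"

lemma equivp_rll_eq: "equivp rll_eq"
proof (rule equivpI)
  show "reflp rll_eq"
    by (rule reflpI) (simp add: rll_eq_def rll_ideal.zero)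
  show "symp rll_eq"
    by (rule sympI) (metis minus_diff_eq rll_eq_def rll_ideal_uminus)
  show "transp rll_eq"
  proof (rule transpI, unfold rll_eq_def, goal_cases)
    case (1 x y z)
    then show ?case
      using rll_ideal.add[of "x - y" "y - z"] by simp
  qed
qed

quotient_type (overloaded) 'n rll = "'n::super_index free" / rll_eq
  by (rule equivp_rll_eq)

instantiation rll :: (super_index) cq_superalgebra
begin

lift_definition zero_rll :: "'a rll" is 0 .
lift_definition one_rll :: "'a rll" is 1 .
lift_definition plus_rll :: "'a rll \<Rightarrow> 'a rll \<Rightarrow> 'a rll" is "(+)"
  unfolding rll_eq_def by (metis add_diff_add rll_ideal.add)
lift_definition minus_rll :: "'a rll \<Rightarrow> 'a rll \<Rightarrow> 'a rll" is "(-)"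
proof -
  fix x y z w :: "'a free"
  assume "rll_eq x y" "rll_eq z w"
  then show "rll_eq (x - z) (y - w)"
    unfolding rll_eq_def
    using rll_ideal.add[of "x - y" "- (z - w)"] rll_ideal_uminus[of "z - w"]
    by (simp add: algebra_simps)
qed
lift_definition uminus_rll :: "'a rll \<Rightarrow> 'a rll" is uminus
  unfolding rll_eq_def by (metis minus_diff_minus rll_ideal_uminus)
lift_definition times_rll :: "'a rll \<Rightarrow> 'a rll \<Rightarrow> 'a rll" is "(*)"
proof -
  fix x y z w :: "'a free"
  assume "rll_eq x y" "rll_eq z w"
  then show "rll_eq (x * z) (y * w)"
    unfolding rll_eq_def
    using rll_ideal.add[OF rll_ideal_mult(2)[of "x - y" z] rll_ideal_mult(1)[of "z - w" y]]
    by (simp add: algebra_simps)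
qed
lift_definition scaleQ_rll :: "cq \<Rightarrow> 'a rll \<Rightarrow> 'a rll" is scaleQ
proof -
  fix c and x y :: "'a free"
  assume "rll_eq x y"
  then show "rll_eq (c *\<^sub>Q x) (c *\<^sub>Q y)"
    unfolding rll_eq_def using rll_ideal_scale[of "x - y" c] by (simp add: cq.scale_right_diff_distrib)
qed
lift_definition hcomp_rll :: "bool \<Rightarrow> 'a rll \<Rightarrow> 'a rll" is hcomp
proof -
  fix s and x y :: "'a free"
  assume "rll_eq x y"
  moreover have "hcomp s (x - y) = hcomp s x - hcomp s y"
    using hcomp_add[of s "x - y" y] by (simp add: algebra_simps)
  ultimately show "rll_eq (hcomp s x) (hcomp s y)"
    unfolding rll_eq_def using rll_ideal_hcomp[of "x - y" s] by simp
qed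

lemma rll_eq_refl: "x = y \<Longrightarrow> rll_eq x (y :: 'a free)"
  using equivp_reflp[OF equivp_rll_eq] by simp

instance
proof
  fix x y z :: "'a rll" and c d :: cq and s t :: bool
  show "x + y + z = x + (y + z)" "x + y = y + x" "0 + x = x" "- x + x = 0" "x - y = x + - y"
    "x * y * z = x * (y * z)" "(x + y) * z = x * z + y * z" "x * (y + z) = x * y + x * z"
    "1 * x = x" "x * 1 = x"
    by (transfer, rule rll_eq_refl, simp add: algebra_simps)+
  show "c *\<^sub>Q (x + y) = c *\<^sub>Q x + c *\<^sub>Q y" "(c + d) *\<^sub>Q x = c *\<^sub>Q x + d *\<^sub>Q x"
    "c *\<^sub>Q d *\<^sub>Q x = (c * d) *\<^sub>Q x" "1 *\<^sub>Q x = x"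
    by (transfer, rule rll_eq_refl, rule scaleQ_right_distrib scaleQ_left_distrib scaleQ_scaleQ scaleQ_one)+
  show "(c *\<^sub>Q x) * y = c *\<^sub>Q (x * y)" "x * (c *\<^sub>Q y) = c *\<^sub>Q (x * y)"
    by (transfer, rule rll_eq_refl, rule scaleQ_mult_left scaleQ_mult_right)+
  show "hcomp s (x + y) = hcomp s x + hcomp s y" "hcomp s (c *\<^sub>Q x) = c *\<^sub>Q hcomp s x"
    "hcomp False x + hcomp True x = x" "hcomp False 1 = (1 :: 'a rll)"
    "hcomp (s \<noteq> t) (hcomp s x * hcomp t y) = hcomp s x * hcomp t y"
    by (transfer, rule rll_eq_refl, rule hcomp_add hcomp_scaleQ hcomp_sum hcomp_one hcomp_mult)+
  show "hcomp s (hcomp t x) = (if s = t then hcomp t x else 0)"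
    by (cases "s = t") (simp_all, (transfer, rule rll_eq_refl, simp add: hcomp_hcomp)+)
qed

end

lift_definition lp :: "'n::super_index \<Rightarrow> 'n \<Rightarrow> 'n rll" is freeLp .
lift_definition lm :: "'n::super_index \<Rightarrow> 'n \<Rightarrow> 'n rll" is freeLm .

subsection \<open>Homomorphisms out of \<open>U(R)\<close>\<close>

definition free_extend ::
    "(cq \<Rightarrow> 'a \<Rightarrow> 'a) \<Rightarrow> ('n gen \<Rightarrow> 'a) \<Rightarrow> 'n free \<Rightarrow> 'a::{ring, monoid_mult}"
  where "free_extend s \<phi> x = pm_extend s (\<lambda>w. prod_list (map \<phi> (letters w))) (Rep_free x)"

definition rll_extend ::
    "(cq \<Rightarrow> 'a \<Rightarrow> 'a) \<Rightarrow> ('n gen \<Rightarrow> 'a) \<Rightarrow> 'n::super_index rll \<Rightarrow> 'a::{ring, monoid_mult}"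
  where "rll_extend s \<phi> u = free_extend s \<phi> (rep_rll u)"

locale algebra_over_cq = module s for s :: "cq \<Rightarrow> 'a::{ring, monoid_mult} \<Rightarrow> 'a" +
  assumes mult_s: "s c x * y = s c (x * y)" "x * s c y = s c (x * y)"
begin

lemmas pm_extend_simps =
  pm_extend_zero[OF module_axioms] pm_extend_single[OF module_axioms]
  pm_extend_add[OF module_axioms] pm_extend_scale[OF module_axioms]

lemma free_extend_zero [simp]: "free_extend s \<phi> (0 :: 'n::super_index free) = 0"
  by (simp add: free_extend_def zero_free.rep_eq pm_extend_simps)

lemma free_extend_add:
  "free_extend s \<phi> (x + y :: 'n::super_index free) = free_extend s \<phi> x + free_extend s \<phi> y"
  by (simp add: free_extend_def plus_free.rep_eq pm_extend_simps)

lemma free_extend_diff: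
  "free_extend s \<phi> (x - y :: 'n::super_index free) = free_extend s \<phi> x - free_extend s \<phi> y"
  using free_extend_add[of \<phi> "x - y" y] by simp

lemma free_extend_scale:
  "free_extend s \<phi> (c *\<^sub>Q x :: 'n::super_index free) = s c (free_extend s \<phi> x)"
  by (simp add: free_extend_def scaleQ_free.rep_eq pm_extend_simps)

lemma free_extend_sum:
  "free_extend s \<phi> (\<Sum>i\<in>A. f i :: 'n::super_index free) = (\<Sum>i\<in>A. free_extend s \<phi> (f i))"
  by (induction A rule: infinite_finite_induct) (simp_all add: free_extend_add)

lemma free_extend_one [simp]: "free_extend s \<phi> (1 :: 'n::super_index free) = 1"
  by (simp add: free_extend_def one_free.rep_eq pm_extend_simps zero_word_def flip: single_one)

lemma free_extend_gen [simp]: "free_extend s \<phi> (free_gen g) = \<phi> g"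
  by (simp add: free_extend_def free_gen.rep_eq pm_extend_simps)

lemma free_extend_mult:
  "free_extend s \<phi> (x * y :: 'n::super_index free) = free_extend s \<phi> x * free_extend s \<phi> y"
proof -
  let ?f = "pm_extend s (\<lambda>w. prod_list (map \<phi> (letters w)))"
  have 1: "?f (Poly_Mapping.single k c * y) = ?f (Poly_Mapping.single k c) * ?f y" for k c y
    by (induction y rule: pm_induct)
      (simp_all add: pm_extend_simps distrib_left mult_single plus_word_def mult_s mult.commute)
  have "?f (x * y) = ?f x * ?f y" for x y
    by (induction x rule: pm_induct) (simp_all add: pm_extend_simps(1,3) distrib_right 1)
  then show ?thesis
    by (simp add: free_extend_def times_free.rep_eq)
qed

context
  fixes \<phi> :: "'n::super_index gen \<Rightarrow> 'a"
  assumes kill: "\<And>r. r \<in> rll_relators \<Longrightarrow> free_extend s \<phi> r = 0"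
begin

lemma free_extend_ideal: "x \<in> rll_ideal \<Longrightarrow> free_extend s \<phi> x = 0"
  by (induction rule: rll_ideal.induct) (simp_all add: free_extend_add free_extend_mult kill)

lemma rll_extend_abs: "rll_extend s \<phi> (abs_rll x) = free_extend s \<phi> x"
proof -
  have "rll_eq (rep_rll (abs_rll x)) x"
    by (simp add: Quotient3_abs_rep[OF Quotient3_rll] flip: rll.abs_eq_iff)
  then show ?thesis
    using free_extend_ideal[of "rep_rll (abs_rll x) - x"]
    by (simp add: rll_extend_def rll_eq_def free_extend_diff)
qed

lemma rll_extend_hom:
  "rll_extend s \<phi> (x + y) = rll_extend s \<phi> x + rll_extend s \<phi> y"
  "rll_extend s \<phi> (x * y) = rll_extend s \<phi> x * rll_extend s \<phi> y"
  "rll_extend s \<phi> (c *\<^sub>Q x) = s c (rll_extend s \<phi> x)"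
  "rll_extend s \<phi> 1 = 1"
proof -
  show "rll_extend s \<phi> (x + y) = rll_extend s \<phi> x + rll_extend s \<phi> y"
    by (induction x rule: rll.abs_induct; induction y rule: rll.abs_induct)
      (simp add: plus_rll.abs_eq rll_extend_abs free_extend_add)
  show "rll_extend s \<phi> (x * y) = rll_extend s \<phi> x * rll_extend s \<phi> y"
    by (induction x rule: rll.abs_induct; induction y rule: rll.abs_induct)
      (simp add: times_rll.abs_eq rll_extend_abs free_extend_mult)
  show "rll_extend s \<phi> (c *\<^sub>Q x) = s c (rll_extend s \<phi> x)"
    by (induction x rule: rll.abs_induct) (simp add: scaleQ_rll.abs_eq rll_extend_abs free_extend_scale)
  show "rll_extend s \<phi> 1 = 1"
    by (simp add: one_rll.abs_eq rll_extend_abs)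
qed

lemma rll_extend_gen: "rll_extend s \<phi> (lp i j) = \<phi> (Lp i j)" "rll_extend s \<phi> (lm i j) = \<phi> (Lm i j)"
  by (simp_all add: lp.abs_eq lm.abs_eq rll_extend_abs)

end

end

interpretation cq_algebra: algebra_over_cq "scaleQ :: cq \<Rightarrow> 'a::cq_superalgebra \<Rightarrow> 'a"
  by unfold_locales (simp_all add: scaleQ_mult_left scaleQ_mult_right scaleQ_right_distrib scaleQ_left_distrib)

interpretation cq_self: algebra_over_cq "(*) :: cq \<Rightarrow> cq \<Rightarrow> cq"
  by unfold_locales (simp_all add: algebra_simps)

subsection \<open>The counit\<close>

fun eps_gen :: "'n gen \<Rightarrow> cq"
  where "eps_gen (Lp i j) = (if i = j then 1 else 0)" | "eps_gen (Lm i j) = (if i = j then 1 else 0)"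

definition rll_counit :: "'n::super_index rll \<Rightarrow> cq"
  where "rll_counit = rll_extend (*) eps_gen"

lemma prod_list_eps_odd:
  "word_odd w \<Longrightarrow> prod_list (map eps_gen (letters w)) = 0"
proof (cases w)
  case (Word gs)
  have "odd (length (filter gen_odd gs)) \<Longrightarrow> 0 \<in> set (map eps_gen gs)"
  proof (induction gs)
    case (Cons g gs)
    then show ?case by (cases g) (auto split: if_splits)
  qed simp
  then show "word_odd w \<Longrightarrow> ?thesis"
    by (simp add: Word word_odd_def prod_list_zero_iff)
qed

abbreviation eps_free :: "'n::super_index free \<Rightarrow> cq"
  where "eps_free \<equiv> free_extend (*) eps_gen"

lemma eps_free_odd: "eps_free (hcomp True x) = 0"
proof -
  have "pm_extend (*) (\<lambda>w. prod_list (map eps_gen (letters w)))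
      (pm_restrict (\<lambda>w. word_odd w = True) x) = 0" for x
    by (induction x rule: pm_induct)
      (simp_all add: pm_restrict_linear pm_restrict_single cq_self.pm_extend_simps prod_list_eps_odd)
  then show ?thesis
    by (simp add: free_extend_def hcomp_free.rep_eq)
qed

lemma eps_free_even: "eps_free (hcomp False x) = eps_free x"
  using eps_free_odd[of x] arg_cong[OF hcomp_sum[of x], of eps_free]
  by (simp add: cq_self.free_extend_add)

lemma eps_mat2_mult:
  "eps_free ((X \<odot> Y) i j k l) = (\<Sum>a\<in>UNIV. \<Sum>c\<in>UNIV.
    sign (par k c \<and> par a j) * (eps_free (X i a k c) * eps_free (Y a j c l)))"
  by (simp add: mat2_mult_def cq_self.free_extend_sum cq_self.free_extend_scale
      cq_self.free_extend_mult UNIV_bool eps_free_odd eps_free_even cq_self.free_extend_add)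

lemma eps_relator: "r \<in> rll_relators \<Longrightarrow> eps_free r = 0"
proof (induction rule: rll_relators.induct)
  case (rll A B i j k l)
  then have AB: "eps_free (leg1 A i j k l) = (if i = j \<and> k = l then 1 else 0)"
    "eps_free (leg2 B i j k l) = (if i = j \<and> k = l then 1 else 0)" for i j k l
    by (auto simp: leg1_def leg2_def)
  have R: "eps_free (mat2_const Rmat i j k l) = Rmat i j k l" for i j k l
    by (simp add: mat2_const_def cq_self.free_extend_scale)
  have delta: "(\<Sum>a\<in>UNIV. \<Sum>c\<in>UNIV. f a c * (x a c * (if a = j \<and> c = l then 1 else 0))) =
      (f j l * x j l :: cq)"
    "(\<Sum>a\<in>UNIV. \<Sum>c\<in>UNIV. f a c * ((if j = a \<and> l = c then 1 else 0) * x a c)) =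
      (f j l * x j l :: cq)" for f x and j l :: 'a
  proof -
    have "(\<Sum>a\<in>UNIV. \<Sum>c\<in>UNIV. g a c * (if a = j \<and> c = l then 1 else 0)) = (g j l :: cq)" for g
    proof -
      have "(\<Sum>c\<in>UNIV. g a c * (if a = j \<and> c = l then 1 else 0)) = (if a = j then g j l else 0)" for a
        by (cases "a = j") (simp_all add: if_distrib[of "(*) _"] cong: if_cong)
      then show ?thesis by simp
    qed
    from this[of "\<lambda>a c. f a c * x a c"] show *:
      "(\<Sum>a\<in>UNIV. \<Sum>c\<in>UNIV. f a c * (x a c * (if a = j \<and> c = l then 1 else 0))) =
        (f j l * x j l :: cq)"
      by (simp only: mult.assoc)
    show "(\<Sum>a\<in>UNIV. \<Sum>c\<in>UNIV. f a c * ((if j = a \<and> l = c then 1 else 0) * x a c)) =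
        (f j l * x j l :: cq)"
      unfolding *[symmetric] by (intro sum.cong refl) auto
  qed
  have BA: "eps_free ((leg2 B \<odot> leg1 A) i j k l) = (if i = j \<and> k = l then 1 else 0)" for i j k l
    by (simp only: eps_mat2_mult AB delta) simp
  have RA: "eps_free ((mat2_const Rmat \<odot> leg1 A) i j k l) = Rmat i j k l" for i j k l
    by (simp only: eps_mat2_mult AB R delta) simp
  have "eps_free ((mat2_const Rmat \<odot> leg1 A \<odot> leg2 B) i j k l) = Rmat i j k l"
    by (subst eps_mat2_mult) (simp only: RA AB delta, simp)
  moreover have "eps_free ((leg2 B \<odot> leg1 A \<odot> mat2_const Rmat) i j k l) = Rmat i j k l"
    by (subst eps_mat2_mult) (simp only: BA R delta, simp)
  ultimately show ?case
    by (simp add: cq_self.free_extend_diff)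
qed (auto simp: cq_self.free_extend_diff cq_self.free_extend_mult)

lemmas rll_counit_hom = cq_self.rll_extend_hom[OF eps_relator, folded rll_counit_def]

lemma rll_counit_gen: "rll_counit (lp i j) = (if i = j then 1 else 0)" "rll_counit (lm i j) = (if i = j then 1 else 0)"
  by (simp_all add: rll_counit_def cq_self.rll_extend_gen eps_relator)

subsection \<open>The coproduct\<close>

fun coproduct_gen :: "'n::super_index gen \<Rightarrow> ('n rll, 'n rll) tensor"
  where
    "coproduct_gen (Lp i j) = (\<Sum>k\<in>UNIV. sign (par i k \<and> par k j) *\<^sub>Q (lp i k \<otimes> lp k j))"
  | "coproduct_gen (Lm i j) = (\<Sum>k\<in>UNIV. sign (par i k \<and> par k j) *\<^sub>Q (lm i k \<otimes> lm k j))"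

definition rll_coproduct :: "'n::super_index rll \<Rightarrow> ('n rll, 'n rll) tensor"
  where "rll_coproduct = rll_extend scaleQ coproduct_gen"

lemma rll_generators:
  "j < i \<Longrightarrow> lp i j = 0" "i < j \<Longrightarrow> lm i j = 0"
  "lp i i * lm i i = 1" "lm i i * lp i i = 1"
proof -
  have r: "abs_rll r = 0" if "r \<in> rll_relators" for r
    using rll_ideal.relator[OF that, of 1 1] by (simp add: zero_rll.abs_eq rll.abs_eq_iff rll_eq_def)
  show "j < i \<Longrightarrow> lp i j = 0" "i < j \<Longrightarrow> lm i j = 0"
    by (simp_all add: lp.abs_eq lm.abs_eq r rll_relators.lower rll_relators.upper)
  show "lp i i * lm i i = 1" "lm i i * lp i i = 1"
    using r[OF rll_relators.inv_pm[of i]] r[OF rll_relators.inv_mp[of i]]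
    by (simp_all add: lp.abs_eq lm.abs_eq flip: minus_rll.abs_eq times_rll.abs_eq one_rll.abs_eq)
qed

definition is_super_hom :: "('a::cq_superalgebra \<Rightarrow> 'b::cq_superalgebra) \<Rightarrow> bool"
  where "is_super_hom f \<longleftrightarrow> (\<forall>x y. f (x + y) = f x + f y) \<and> (\<forall>c x. f (c *\<^sub>Q x) = c *\<^sub>Q f x) \<and>
    (\<forall>x y. f (x * y) = f x * f y) \<and> f 1 = 1 \<and> (\<forall>s x. f (hcomp s x) = hcomp s (f x))"

lemma super_hom_simps:
  assumes "is_super_hom f"
  shows "f (x + y) = f x + f y" "f (c *\<^sub>Q x) = c *\<^sub>Q f x" "f (x * y) = f x * f y" "f 1 = 1"
    "f (hcomp s x) = hcomp s (f x)" "f 0 = 0"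
proof -
  show "f (x + y) = f x + f y" "f (c *\<^sub>Q x) = c *\<^sub>Q f x" "f (x * y) = f x * f y" "f 1 = 1"
    "f (hcomp s x) = hcomp s (f x)"
    using assms by (auto simp: is_super_hom_def)
  have "f (0 + 0) = f 0 + f 0"
    using assms unfolding is_super_hom_def by blast
  then show "f 0 = 0" by simp
qed

lemma super_hom_sum: "is_super_hom f \<Longrightarrow> f (\<Sum>i\<in>A. g i) = (\<Sum>i\<in>A. f (g i))"
  by (induction A rule: infinite_finite_induct) (auto simp: super_hom_simps)

lemma super_hom_mat2_mult:
  assumes "is_super_hom f"
  shows "f ((X \<odot> Y) i j k l) = ((\<lambda>i j k l. f (X i j k l)) \<odot> (\<lambda>i j k l. f (Y i j k l))) i j k l"
  by (simp add: mat2_mult_def super_hom_sum[OF assms] super_hom_simps[OF assms])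

lemma super_hom_rll_equation:
  assumes f: "is_super_hom f" and "rll_equation A B"
  shows "rll_equation (\<lambda>i j. f (A i j)) (\<lambda>i j. f (B i j))"
proof -
  have l: "leg1 (\<lambda>i j. f (A i j)) = (\<lambda>i j k l. f (leg1 A i j k l))"
    "leg2 (\<lambda>i j. f (B i j)) = (\<lambda>i j k l. f (leg2 B i j k l))"
    "mat2_const Rmat = (\<lambda>i j k l. f (mat2_const Rmat i j k l))"
    by (simp_all add: leg1_def leg2_def mat2_const_def super_hom_simps[OF f] fun_eq_iff)
  have "f ((mat2_const Rmat \<odot> leg1 A \<odot> leg2 B) i j k l) =
      f ((leg2 B \<odot> leg1 A \<odot> mat2_const Rmat) i j k l)" for i j k l
    using assms(2) by (simp add: rll_equation_def)
  then show ?thesis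
    unfolding rll_equation_def l by (intro ext) (simp add: super_hom_mat2_mult[OF f])
qed

lemma super_hom_abs_rll: "is_super_hom (abs_rll :: 'n::super_index free \<Rightarrow> 'n rll)"
  by (simp add: is_super_hom_def plus_rll.abs_eq scaleQ_rll.abs_eq times_rll.abs_eq one_rll.abs_eq
      hcomp_rll.abs_eq)

lemma super_hom_tens:
  "is_super_hom (\<lambda>x. x \<otimes> (1 :: 'b::cq_superalgebra) :: ('a::cq_superalgebra, 'b) tensor)"
  "is_super_hom (\<lambda>y. (1 :: 'a) \<otimes> y :: ('a, 'b) tensor)"
proof -
  have one: "hcomp True (1 :: 'c::cq_superalgebra) = 0"
    by (rule hcomp_other_parity(2)[OF hcomp_one])
  have h: "hcomp s (x \<otimes> (1 :: 'b)) = hcomp s x \<otimes> 1" "hcomp s ((1 :: 'a) \<otimes> y) = 1 \<otimes> hcomp s y"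
    for s and x :: 'a and y :: 'b
    by (cases s; simp add: hcomp_tensor_def tensor_lift_tens bilinear_hcomp_tens hcomp_tens_def
        UNIV_bool hcomp_one one)+
  have m: "(x \<otimes> (1 :: 'b)) * (x' \<otimes> 1) = (x * x') \<otimes> 1" "((1 :: 'a) \<otimes> y) * (1 \<otimes> y') = 1 \<otimes> (y * y')"
    for x x' :: 'a and y y' :: 'b
  proof -
    have "(x \<otimes> (1 :: 'b)) * (x' \<otimes> 1) = (x * (hcomp False x' + hcomp True x')) \<otimes> 1"
      by (simp only: distrib_left tens_add_left)
        (simp add: tensor_mult_tens tensor_mult_tens_def UNIV_bool one hcomp_one)
    then show "(x \<otimes> (1 :: 'b)) * (x' \<otimes> 1) = (x * x') \<otimes> 1"
      by (simp only: hcomp_sum)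
    have "((1 :: 'a) \<otimes> y) * (1 \<otimes> y') = 1 \<otimes> ((hcomp False y + hcomp True y) * y')"
      by (simp only: distrib_right tens_add_right)
        (simp add: tensor_mult_tens tensor_mult_tens_def UNIV_bool one hcomp_one)
    then show "((1 :: 'a) \<otimes> y) * (1 \<otimes> y') = 1 \<otimes> (y * y')"
      by (simp only: hcomp_sum)
  qed
  show "is_super_hom (\<lambda>x. x \<otimes> (1 :: 'b) :: ('a, 'b) tensor)"
    "is_super_hom (\<lambda>y. (1 :: 'a) \<otimes> y :: ('a, 'b) tensor)"
    by (simp_all add: is_super_hom_def tens_add_left tens_add_right tens_scale_left tens_scale_right
        h m one_tensor_def)
qed

lemma rll_equation_abs_rll:
  assumes "(A, B) \<in> {(freeLp, freeLp), (freeLm, freeLm), (freeLp, freeLm)}"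
  shows "rll_equation (\<lambda>i j. abs_rll (A i j)) (\<lambda>i j. abs_rll (B i j))"
proof -
  note f = super_hom_abs_rll
  have l: "leg1 (\<lambda>i j. abs_rll (A i j)) = (\<lambda>i j k l. abs_rll (leg1 A i j k l))"
    "leg2 (\<lambda>i j. abs_rll (B i j)) = (\<lambda>i j k l. abs_rll (leg2 B i j k l))"
    "mat2_const Rmat = (\<lambda>i j k l. abs_rll (mat2_const Rmat i j k l))"
    by (simp_all add: leg1_def leg2_def mat2_const_def super_hom_simps[OF f] fun_eq_iff)
  have "abs_rll ((mat2_const Rmat \<odot> leg1 A \<odot> leg2 B) i j k l) =
      abs_rll ((leg2 B \<odot> leg1 A \<odot> mat2_const Rmat) i j k l)" for i j k l
    using rll_ideal.relator[OF rll_relators.rll[OF assms, of i j k l], of 1 1]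
    by (simp add: rll.abs_eq_iff rll_eq_def)
  then show ?thesis
    unfolding rll_equation_def l by (intro ext) (simp add: super_hom_mat2_mult[OF f])
qed

lemma rll_equations_rll: "rll_equation lp lp" "rll_equation lm lm" "rll_equation lp lm"
  unfolding lp.abs_eq[abs_def] lm.abs_eq[abs_def] by (rule rll_equation_abs_rll, simp)+

lemma even_super_hom:
  assumes "is_super_hom f" "even_mat A"
  shows "even_mat (\<lambda>i j. f (A i j))"
  unfolding even_mat_def
proof (intro allI)
  fix i j
  have "hcomp (par i j) (A i j) = A i j"
    using assms(2) unfolding even_mat_def by blast
  then show "homogeneous (par i j) (f (A i j))"
    by (simp only: flip: super_hom_simps(5)[OF assms(1)])
qed

lemma even_rll: "even_mat lp" "even_mat lm"
  unfolding lp.abs_eq[abs_def] lm.abs_eq[abs_def]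
  by (rule even_super_hom[OF super_hom_abs_rll], rule even_free)+

lemma is_super_hom_free_extend:
  assumes "\<And>g. homogeneous (gen_odd g) (\<phi> g)"
  shows "is_super_hom (free_extend scaleQ \<phi> :: 'n::super_index free \<Rightarrow> 'a::cq_superalgebra)"
proof -
  have w: "homogeneous (odd (length (filter gen_odd gs))) (prod_list (map \<phi> gs))" for gs
  proof (induction gs)
    case Nil
    show ?case by (simp add: hcomp_one)
  next
    case (Cons g gs)
    have "odd (length (filter gen_odd (g # gs))) = (gen_odd g \<noteq> odd (length (filter gen_odd gs)))"
      by simp
    then show ?case
      using homogeneous_mult[OF assms[of g] Cons] by (simp only: list.map prod_list.Cons)
  qed
  have "pm_extend scaleQ (\<lambda>w. prod_list (map \<phi> (letters w))) (pm_restrict (\<lambda>w. word_odd w = s) x) =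
      hcomp s (pm_extend scaleQ (\<lambda>w. prod_list (map \<phi> (letters w))) x)" for s x
  proof (induction x rule: pm_induct)
    case (add_single k c x)
    have "hcomp s (prod_list (map \<phi> (letters k))) =
        (if word_odd k = s then prod_list (map \<phi> (letters k)) else 0)"
      using hcomp_homogeneous[OF w[of "letters k"], of s] unfolding word_odd_def by metis
    then show ?case
      using add_single
      by (simp add: pm_restrict_linear pm_restrict_single cq_algebra.pm_extend_simps hcomp_add hcomp_scaleQ)
  qed (simp add: pm_restrict_linear cq_algebra.pm_extend_simps)
  then show ?thesis
    unfolding is_super_hom_def
    by (auto simp: cq_algebra.free_extend_add cq_algebra.free_extend_mult cq_algebra.free_extend_scale)
      (simp add: free_extend_def hcomp_free.rep_eq)
qed

lemma free_extend_relator: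
  fixes P M :: "'n::super_index \<Rightarrow> 'n \<Rightarrow> 'a::cq_superalgebra"
  assumes "even_mat P" "even_mat M" "\<And>i j. j < i \<Longrightarrow> P i j = 0" "\<And>i j. i < j \<Longrightarrow> M i j = 0"
    and "\<And>i. P i i * M i i = 1" "\<And>i. M i i * P i i = 1"
    and eqs: "rll_equation P P" "rll_equation M M" "rll_equation P M"
    and \<phi>: "\<And>i j. \<phi> (Lp i j) = P i j" "\<And>i j. \<phi> (Lm i j) = M i j"
    and r: "r \<in> rll_relators"
  shows "free_extend scaleQ \<phi> r = 0"
proof -
  have hom: "homogeneous (gen_odd g) (\<phi> g)" for g
    using assms(1,2) by (cases g) (simp_all only: \<phi> even_mat_def gen_odd.simps)
  note f = is_super_hom_free_extend[of \<phi>, OF hom]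
  show ?thesis
    using r
  proof (induction rule: rll_relators.induct)
    case (rll A B i j k l)
    have l: "(\<lambda>i j k l. free_extend scaleQ \<phi> (leg1 A i j k l)) = leg1 (\<lambda>i j. free_extend scaleQ \<phi> (A i j))"
      "(\<lambda>i j k l. free_extend scaleQ \<phi> (leg2 B i j k l)) = leg2 (\<lambda>i j. free_extend scaleQ \<phi> (B i j))"
      "(\<lambda>i j k l. free_extend scaleQ \<phi> (mat2_const Rmat i j k l)) = mat2_const Rmat"
      by (simp_all add: leg1_def leg2_def mat2_const_def super_hom_simps[OF f] fun_eq_iff)
    have "rll_equation (\<lambda>i j. free_extend scaleQ \<phi> (A i j)) (\<lambda>i j. free_extend scaleQ \<phi> (B i j))"
      using rll eqs by (auto simp: \<phi>)
    then show ?case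
      by (simp add: cq_algebra.free_extend_diff super_hom_mat2_mult[OF f] l rll_equation_def)
  qed (simp_all add: \<phi> assms cq_algebra.free_extend_diff cq_algebra.free_extend_mult)
qed

lemma coproduct_relator: 
  fixes r :: "'n::super_index free"
  assumes "r \<in> rll_relators"
  shows "free_extend scaleQ coproduct_gen r = 0"
proof -
  let ?l = "\<lambda>x :: 'n rll. x \<otimes> (1 :: 'n rll)" and ?r = "\<lambda>x :: 'n rll. (1 :: 'n rll) \<otimes> x"
  let ?P1 = "\<lambda>i j. ?l (lp i j)" and ?M1 = "\<lambda>i j. ?l (lm i j)"
  let ?P2 = "\<lambda>i j. ?r (lp i j)" and ?M2 = "\<lambda>i j. ?r (lm i j)"
  note L = super_hom_tens(1)[where ?'a = "'n rll" and ?'b = "'n rll"]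
  note R = super_hom_tens(2)[where ?'a = "'n rll" and ?'b = "'n rll"]
  have ev: "even_mat ?P1" "even_mat ?M1" "even_mat ?P2" "even_mat ?M2"
    by (rule even_super_hom[OF L even_rll(1)] even_super_hom[OF L even_rll(2)]
        even_super_hom[OF R even_rll(1)] even_super_hom[OF R even_rll(2)])+
  have eqs: "rll_equation ?P1 ?P1" "rll_equation ?M1 ?M1" "rll_equation ?P1 ?M1"
    "rll_equation ?P2 ?P2" "rll_equation ?M2 ?M2" "rll_equation ?P2 ?M2"
    by (rule rll_equations_rll[THEN super_hom_rll_equation[OF L]]
        rll_equations_rll[THEN super_hom_rll_equation[OF R]])+
  have mult: "(x \<otimes> 1) * (1 \<otimes> y) = x \<otimes> (y :: 'n rll)" for x y :: "'n rll"
    using tensor_mult_homogeneous[OF hcomp_one hcomp_one, of x y] by simp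
  have mult': "(1 \<otimes> y) * (x \<otimes> 1) = sign (s \<and> t) *\<^sub>Q (x \<otimes> y)"
    if "homogeneous s x" "homogeneous t y" for s t and x y :: "'n rll"
    using tensor_mult_homogeneous[OF that(2,1), of 1 1] by (simp add: conj_commute)
  have comm: "mats_commute (\<lambda>i j. ?r (A i j)) (\<lambda>i j. ?l (B i j))"
    "mats_commute (\<lambda>i j. ?l (B i j)) (\<lambda>i j. ?r (A i j))"
    if "even_mat A" "even_mat B" for A B :: "'n \<Rightarrow> 'n \<Rightarrow> 'n rll"
    unfolding mats_commute_def
  proof (safe)
    fix i j k l
    have h: "homogeneous (par i j) (A i j)" "homogeneous (par k l) (A k l)"
      "homogeneous (par i j) (B i j)" "homogeneous (par k l) (B k l)"
      using that unfolding even_mat_def by blast+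
    show "?l (B k l) * ?r (A i j) = sign (par i j \<and> par k l) *\<^sub>Q (?r (A i j) * ?l (B k l))"
      unfolding mult mult'[OF h(4,1)] by (simp add: conj_commute)
    show "?r (A k l) * ?l (B i j) = sign (par i j \<and> par k l) *\<^sub>Q (?l (B i j) * ?r (A k l))"
      unfolding mult mult'[OF h(3,2)] by simp
  qed
  have cop: "coproduct_gen (Lp i j) = mat_mult ?P1 ?P2 i j" "coproduct_gen (Lm i j) = mat_mult ?M1 ?M2 i j"
    for i j
    by (simp_all add: mat_mult_def mult)
  show ?thesis
  proof (rule free_extend_relator[OF _ _ _ _ _ _ _ _ _ cop assms])
    show "even_mat (mat_mult ?P1 ?P2)" "even_mat (mat_mult ?M1 ?M2)"
      by (intro even_mat_mult ev)+
    show "rll_equation (mat_mult ?P1 ?P2) (mat_mult ?P1 ?P2)"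
      "rll_equation (mat_mult ?M1 ?M2) (mat_mult ?M1 ?M2)"
      "rll_equation (mat_mult ?P1 ?P2) (mat_mult ?M1 ?M2)"
      by (intro rll_equation_mat_mult ev eqs comm even_rll)+
    have tri: "lp i k \<otimes> lp k j = (if i \<le> k \<and> k \<le> j then lp i k \<otimes> lp k j else 0)"
      "lm i k \<otimes> lm k j = (if j \<le> k \<and> k \<le> i then lm i k \<otimes> lm k j else 0)" for i j k :: 'n
      by (auto simp: rll_generators not_le)
    show "mat_mult ?P1 ?P2 i j = 0" if "j < i" for i j
      unfolding mat_mult_def mult by (rule sum.neutral, subst tri) (use that in auto)
    show "mat_mult ?M1 ?M2 i j = 0" if "i < j" for i j
      unfolding mat_mult_def mult by (rule sum.neutral, subst tri) (use that in auto)
    have diag: "mat_mult ?P1 ?P2 i i = lp i i \<otimes> lp i i" "mat_mult ?M1 ?M2 i i = lm i i \<otimes> lm i i" for i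
    proof -
      have eq: "(if i \<le> k \<and> k \<le> i then x else 0) = (if k = i then x else 0)" for k and x :: "('n rll, 'n rll) tensor"
        by auto
      show "mat_mult ?P1 ?P2 i i = lp i i \<otimes> lp i i" "mat_mult ?M1 ?M2 i i = lm i i \<otimes> lm i i"
        unfolding mat_mult_def mult by (subst tri, simp add: eq if_distrib[of "scaleQ _"] cong: if_cong)+
    qed
    have d: "homogeneous False (lp i i)" "homogeneous False (lm i i)" for i :: 'n
      using even_rll[unfolded even_mat_def, THEN spec, THEN spec, of i i] by simp_all
    show "mat_mult ?P1 ?P2 i i * mat_mult ?M1 ?M2 i i = 1" "mat_mult ?M1 ?M2 i i * mat_mult ?P1 ?P2 i i = 1" for i
      unfolding diag
      by (simp_all add: tensor_mult_homogeneous[OF d(1) d(2)] tensor_mult_homogeneous[OF d(2) d(1)]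
          rll_generators one_tensor_def)
  qed
qed

lemmas rll_coproduct_hom = cq_algebra.rll_extend_hom[OF coproduct_relator, folded rll_coproduct_def]

lemma rll_coproduct_gen:
  "rll_coproduct (lp i j) = (\<Sum>k\<in>UNIV. sign (par i k \<and> par k j) *\<^sub>Q (lp i k \<otimes> lp k j))"
  "rll_coproduct (lm i j) = (\<Sum>k\<in>UNIV. sign (par i k \<and> par k j) *\<^sub>Q (lm i k \<otimes> lm k j))"
  by (simp_all add: rll_coproduct_def cq_algebra.rll_extend_gen[OF coproduct_relator])

subsection \<open>Root vectors, subalgebras and the grading by the root lattice\<close>

definition root_e :: "'n::super_index \<Rightarrow> 'n \<Rightarrow> 'n rll"
  where "root_e i j =
    inverse (sign (odd_index i \<and> odd_index j) * qq powi (- eps_form i i) * (qq - inverse qq))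
      *\<^sub>Q (lm i i * lp i j)"

text \<open>\<open>root_f j i\<close> is the vector \<open>f\<^sub>j\<^sub>i\<close> for \<open>i < j\<close>.  In both definitions \<^term>\<open>lp i i\<close> and
  \<^term>\<open>lm i i\<close> are inverse to each other.\<close>

definition root_f :: "'n::super_index \<Rightarrow> 'n \<Rightarrow> 'n rll"
  where "root_f j i =
    inverse (- (\<Prod>k\<in>{i..<j}. sign (odd_index k)) * sign (odd_index i \<and> odd_index j)
        * qq powi (eps_form i i) * (qq - inverse qq))
      *\<^sub>Q (lm j i * lp i i)"

definition subalgebra :: "'a::cq_superalgebra set \<Rightarrow> bool"
  where "subalgebra A \<longleftrightarrow> 1 \<in> A \<and> (\<forall>x\<in>A. \<forall>y\<in>A. x + y \<in> A \<and> x * y \<in> A) \<and> (\<forall>c. \<forall>x\<in>A. c *\<^sub>Q x \<in> A)"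

definition U_gt :: "'n::super_index rll set"
  where "U_gt = subalgebra hull {root_e i j | i j. i < j}"

definition U_lt :: "'n::super_index rll set"
  where "U_lt = subalgebra hull {root_f j i | i j. i < j}"

definition U_ge :: "'n::super_index rll set"
  where "U_ge = subalgebra hull ({lp i j | i j. True} \<union> {lm k k | k. True})"

definition U_le :: "'n::super_index rll set"
  where "U_le = subalgebra hull ({lm j i | i j. True} \<union> {lp k k | k. True})"

text \<open>Weights are elements of the free abelian group on the \<open>\<epsilon>\<^sub>i\<close>; those of nonzero elements of \<open>U(R)\<close>
  lie in the sublattice \<open>Q\<close>.\<close>

type_synonym 'n weight = "'n \<Rightarrow>\<^sub>0 int"

definition root :: "'n \<Rightarrow> 'n \<Rightarrow> 'n weight"
  where "root i j = frag_of i - frag_of j"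

fun gen_weight :: "'n gen \<Rightarrow> 'n weight"
  where "gen_weight (Lp i j) = root i j" | "gen_weight (Lm i j) = root i j"

definition word_weight :: "'n word \<Rightarrow> 'n weight"
  where "word_weight w = sum_list (map gen_weight (letters w))"

definition rll_component :: "'n weight \<Rightarrow> 'n::super_index rll set"
  where "rll_component \<nu> =
    abs_rll ` {x. \<forall>w\<in>Poly_Mapping.keys (Rep_free x). word_weight w = \<nu>}"

section \<open>The skew-pairing\<close>

definition tensor_flip ::
    "('a::cq_superalgebra, 'b::cq_superalgebra) tensor \<Rightarrow> ('b, 'a) tensor"
  where "tensor_flip =
    tensor_lift (\<lambda>a b. \<Sum>s\<in>UNIV. \<Sum>t\<in>UNIV. sign (s \<and> t) *\<^sub>Q (hcomp t b \<otimes> hcomp s a))"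

definition tensor_sum :: "('a::cq_space \<times> 'b::cq_space) list \<Rightarrow> ('a, 'b) tensor"
  where "tensor_sum xs = (\<Sum>(x, y)\<leftarrow>xs. x \<otimes> y)"

text \<open>The extension of \<open>(a \<otimes> a', b \<otimes> b') = (-1)\<^bsup>|a'||b|\<^esup> (a, b) (a', b')\<close> to sums of pure tensors.\<close>

definition pair_sums ::
    "('a::cq_superalgebra \<Rightarrow> 'b::cq_superalgebra \<Rightarrow> cq) \<Rightarrow> ('a \<times> 'a) list \<Rightarrow> ('b \<times> 'b) list \<Rightarrow> cq"
  where "pair_sums B xs ys = (\<Sum>(a, a')\<leftarrow>xs. \<Sum>(b, b')\<leftarrow>ys. \<Sum>s\<in>UNIV. \<Sum>t\<in>UNIV.
    sign (s \<and> t) * (B a (hcomp t b) * B (hcomp s a') b'))"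

text \<open>A skew-pairing between sub-superbialgebras \<open>A\<close> and \<open>C\<close> of \<open>U(R)\<close>.  Only the values of \<open>B\<close> on
  \<open>A \<times> C\<close> matter, so the pairing with a coproduct is evaluated on a presentation of the coproduct
  as a sum of pure tensors in \<open>C \<otimes> C\<close> or \<open>A \<otimes> A\<close>; by bilinearity the presentation is irrelevant.\<close>

definition skew_pairing ::
    "'n::super_index rll set \<Rightarrow> 'n rll set \<Rightarrow> ('n rll \<Rightarrow> 'n rll \<Rightarrow> cq) \<Rightarrow> bool"
  where "skew_pairing A C B \<longleftrightarrow>
    (\<forall>a\<in>A. \<forall>a'\<in>A. \<forall>b\<in>C. B (a + a') b = B a b + B a' b) \<and>
    (\<forall>a\<in>A. \<forall>b\<in>C. \<forall>b'\<in>C. B a (b + b') = B a b + B a b') \<and>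
    (\<forall>c. \<forall>a\<in>A. \<forall>b\<in>C. B (c *\<^sub>Q a) b = c * B a b \<and> B a (c *\<^sub>Q b) = c * B a b) \<and>
    (\<forall>a\<in>A. \<forall>b\<in>C. \<forall>s t. homogeneous s a \<longrightarrow> homogeneous t b \<longrightarrow> s \<noteq> t \<longrightarrow> B a b = 0) \<and>
    (\<forall>b\<in>C. B 1 b = rll_counit b) \<and>
    (\<forall>a\<in>A. B a 1 = rll_counit a) \<and>
    (\<forall>a\<in>A. \<forall>a'\<in>A. \<forall>b\<in>C. \<forall>ys. set ys \<subseteq> C \<times> C \<longrightarrow> rll_coproduct b = tensor_sum ys \<longrightarrow>
      B (a * a') b = pair_sums B [(a, a')] ys) \<and>
    (\<forall>a\<in>A. \<forall>b\<in>C. \<forall>b'\<in>C. \<forall>xs. set xs \<subseteq> A \<times> A \<longrightarrow>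
      tensor_flip (rll_coproduct a) = tensor_sum xs \<longrightarrow> B a (b * b') = pair_sums B xs [(b, b')])"

text \<open>The pairing \<open>(\<cdot>, \<cdot>)\<close> between \<open>U\<^sup>\<le>(R)\<close> and \<open>U\<^sup>\<ge>(R)\<close>: the last clause compares coefficients of
  \<open>E\<^sub>i\<^sub>j \<otimes> E\<^sub>k\<^sub>l\<close> with those of \<open>\<tau>(R\<^sup>-\<^sup>1)\<close>.\<close>

definition rll_pairing :: "('n::super_index rll \<Rightarrow> 'n rll \<Rightarrow> cq) \<Rightarrow> bool"
  where "rll_pairing B \<longleftrightarrow> skew_pairing U_le U_ge B \<and>
    (\<forall>i j k l. sign (par i j \<and> par k l) * B (lm i j) (lp k l) = mat2_flip Rmat_inv i j k l)"

section \<open>The completed tensor product and the canonical element\<close>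

text \<open>An element of \<open>\<Prod>\<^sub>\<lambda> U\<^sup>>\<^sub>\<lambda> \<otimes> U\<^sup><\<^sub>-\<^sub>\<lambda>\<close> is the family of its components.  In the product only finitely
  many \<open>\<mu>\<close> contribute, because the weights of \<open>U\<^sup>>\<close> are sums of positive roots.\<close>

type_synonym 'n completed = "'n weight \<Rightarrow> ('n rll, 'n rll) tensor"

definition completed_one :: "'n::super_index completed"
  where "completed_one \<nu> = (if \<nu> = 0 then 1 else 0)"

definition completed_mult ::
    "'n::super_index completed \<Rightarrow> 'n completed \<Rightarrow> 'n completed"
  where "completed_mult X Y \<nu> = Sum_any (\<lambda>\<mu>. X \<mu> * Y (\<nu> - \<mu>))"

text \<open>Dual homogeneous bases \<open>E\<close> of \<open>U\<^sup>>\<close> and \<open>g ` E\<close> of \<open>U\<^sup><\<close>, the basis vector dual to \<open>u\<close> being \<open>g u\<close>.\<close>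

definition dual_bases ::
    "('n::super_index rll \<Rightarrow> 'n rll \<Rightarrow> cq) \<Rightarrow> 'n rll set \<Rightarrow> ('n rll \<Rightarrow> 'n rll) \<Rightarrow> bool"
  where "dual_bases B E g \<longleftrightarrow>
    cq.independent E \<and> cq.span E = U_gt \<and>
    inj_on g E \<and> cq.independent (g ` E) \<and> cq.span (g ` E) = U_lt \<and>
    (\<forall>u\<in>E. \<exists>\<nu>. u \<in> rll_component \<nu>) \<and> (\<forall>u\<in>E. \<exists>\<nu>. g u \<in> rll_component \<nu>) \<and>
    (\<forall>u\<in>E. \<forall>v\<in>E. B (g u) v = (if u = v then 1 else 0))"

definition canonical_element :: "('n::super_index rll \<Rightarrow> 'n rll \<Rightarrow> cq) \<Rightarrow> 'n completed"
  where "canonical_element B =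
    (THE X. \<exists>E g. dual_bases B E g \<and> X = (\<lambda>\<nu>. \<Sum>u\<in>E \<inter> rll_component \<nu>. u \<otimes> g u))"

section \<open>The factorization\<close>

text \<open>The component of weight \<open>\<nu>\<close> of the factor of the root \<open>\<gamma> = \<epsilon>\<^sub>i - \<epsilon>\<^sub>j\<close>: the \<open>k\<close>-th summand has weight
  \<open>k\<gamma>\<close>, so at most one \<open>k\<close> contributes.\<close>

definition root_factor ::
    "('n::super_index rll \<Rightarrow> 'n rll \<Rightarrow> cq) \<Rightarrow> 'n \<times> 'n \<Rightarrow> 'n completed"
  where "root_factor B = (\<lambda>(i, j) \<nu>.
    \<Sum>k | (par i j \<longrightarrow> k \<le> 1) \<and> frag_cmul (int k) (root i j) = \<nu>.
      inverse (B (root_f j i ^ k) (root_e i j ^ k)) *\<^sub>Q ((root_e i j ^ k) \<otimes> (root_f j i ^ k)))"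

text \<open>The order on pairs is the lexicographic one.  Reversing the list puts the factor of the largest
  root leftmost.\<close>

definition positive_roots :: "('n::super_index \<times> 'n) list"
  where "positive_roots = sorted_list_of_set {(i, j). i < j}"

definition descending_product ::
    "('n::super_index \<times> 'n \<Rightarrow> 'n completed) \<Rightarrow> 'n completed"
  where "descending_product F = foldr completed_mult (map F (rev positive_roots)) completed_one"

end

theory Submission
  imports Defs
begin

text \<open>The idea is to exhibit the canonical element in a basis that is orthogonal for the pairing.  For
  an exponent function \<open>\<kappa>\<close> on the positive roots (with \<open>\<kappa> \<gamma> \<le> 1\<close> for odd \<open>\<gamma>\<close>) let \<open>e\<^sup>\<kappa>\<close> and \<open>f\<^sup>\<kappa>\<close> be the
  products of the \<open>e\<^sub>\<gamma>\<^bsup>\<kappa> \<gamma>\<^esup>\<close> and of the \<open>f\<^sub>\<gamma>\<^bsup>\<kappa> \<gamma>\<^esup>\<close>, larger roots to the left.  The \<open>e\<^sup>\<kappa>\<close> span \<open>U\<^sup>>\<close>, the \<open>f\<^sup>\<kappa>\<close>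
  span \<open>U\<^sup><\<close>, and \<open>(f\<^sup>\<kappa>, e\<^sup>\<kappa>\<^sup>')\<close> vanishes unless \<open>\<kappa> = \<kappa>'\<close>, in which case it is, up to a sign, the product of
  the numbers \<open>(f\<^sub>\<gamma>\<^bsup>\<kappa> \<gamma>\<^esup>, e\<^sub>\<gamma>\<^bsup>\<kappa> \<gamma>\<^esup>)\<close>, none of which is zero.  Hence the \<open>e\<^sup>\<kappa>\<close> and the rescaled \<open>f\<^sup>\<kappa>\<close> are dual
  bases, and the canonical element is the sum of \<open>e\<^sup>\<kappa> \<otimes> f\<^sup>\<kappa> / (f\<^sup>\<kappa>, e\<^sup>\<kappa>)\<close>.  Multiplying out the product of
  the series of the single roots gives the same sum; the sign that arises from moving
  \<open>f\<close>'s past \<open>e\<close>'s in the tensor product is exactly the sign in the pairing of the monomials.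

  Spanning.  In coordinates the RLL relations say that for \<open>\<gamma> < \<delta>\<close> the product \<open>e\<^sub>\<gamma> e\<^sub>\<delta>\<close> is a multiple of
  \<open>e\<^sub>\<delta> e\<^sub>\<gamma>\<close> plus a product of two root vectors in which \<open>e\<^sub>\<gamma>\<close> may occur only as the right factor and all else
  belongs to roots above \<open>\<gamma>\<close>: this is the convexity of the lexicographic order.  So the algebra
  generated by the roots from \<open>\<gamma>\<close> on is spanned by the powers of \<open>e\<^sub>\<gamma>\<close> multiplied from the left by the algebra
  of the roots above \<open>\<gamma>\<close> (\<open>ordered_monomials_span\<close>).

  Orthogonality.  Right multiplication by \<open>f\<^sub>\<gamma>\<close> has an adjoint, obtained by contracting the second
  tensor factor of the coproduct with \<open>f\<^sub>\<gamma>\<close>.  For \<open>l\<^sup>-\<^sub>a\<^sub>b\<close> this operator replaces the column index \<open>a\<close> of a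
  generator by \<open>b\<close>, and the operators of all \<open>l\<^sup>-\<^sub>a\<^sub>b\<close> obey a Leibniz rule shaped like matrix multiplication.
  On the algebra of the roots from \<open>\<gamma> = \<epsilon>\<^sub>i - \<epsilon>\<^sub>j\<close> on only two terms of that rule survive, and the adjoint of \<open>f\<^sub>\<gamma>\<close> is a
  skew derivation that kills \<open>e\<^sub>\<delta>\<close> for \<open>\<delta> > \<gamma>\<close> and maps \<open>e\<^sub>\<gamma>\<close> to a nonzero scalar.  This strips the factors
  \<open>f\<^sub>\<gamma>\<close> and \<open>e\<^sub>\<gamma>\<close> off the right ends in pairs (\<open>pairing_peel\<close>).  A surplus \<open>f\<^sub>\<gamma>\<close> gives zero at once; a surplus \<open>e\<^sub>\<gamma>\<close>
  gives zero because the left ideal generated by the \<open>e\<^sub>i\<^sub>p\<close> with \<open>i < p \<le> j\<close> is stable under the adjoints of all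
  \<open>f\<^sub>\<delta>\<close> with \<open>\<delta> > \<gamma>\<close> and is killed by the counit.  The scalars that appear are geometric sums in
  \<open>q\<^sup>2\<close> or \<open>q\<^sup>-\<^sup>2\<close>, nonzero because \<open>q\<close> is not a root of unity.

  Independence of choices.  The weight decomposition of \<open>U(R)\<close> makes every component of the canonical element a finite
  sum that is the same for all pairs of dual homogeneous bases (\<open>canonical_unique\<close>).

  The normalization of the root vectors cancels in every factor of the product, so all computations
  use the multiples \<open>l\<^sup>-\<^sub>i\<^sub>i l\<^sup>+\<^sub>i\<^sub>j\<close> and \<open>l\<^sup>-\<^sub>j\<^sub>i l\<^sup>+\<^sub>i\<^sub>i\<close> instead.\<close>

section \<open>Powers of \<open>q\<close>\<close>

lemma qq_power: "qq ^ n = Fract (monom 1 n) 1"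
proof (induction n)
  case 0
  show ?case
    by (simp only: power_0 monom_0 flip: one_pCons) (rule One_fract_def)
qed (simp add: qq_def mult_monom)

lemma qq_power_neq_1: "0 < n \<Longrightarrow> qq ^ n \<noteq> 1"
proof
  assume "0 < n" "qq ^ n = 1"
  then have "monom (1 :: complex) n = 1"
    unfolding qq_power One_fract_def by (simp add: eq_fract)
  then have "degree (monom (1 :: complex) n) = 0"
    by simp
  with \<open>0 < n\<close> show False
    by (simp add: degree_monom_eq)
qed

lemma qq_nonzero [simp]: "qq \<noteq> 0"
  unfolding qq_def Zero_fract_def by (simp add: eq_fract)

lemma qq_powi_neq_1: "n \<noteq> 0 \<Longrightarrow> qq powi n \<noteq> 1"
proof (cases "0 < n")
  case True
  then show ?thesis
    using qq_power_neq_1[of "nat n"] by (simp add: power_int_def)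
next
  case False
  assume "n \<noteq> 0"
  with False show ?thesis
    using qq_power_neq_1[of "nat (- n)"] by (simp add: power_int_def power_inverse)
qed

definition qdiff :: cq
  where "qdiff = qq - inverse qq"

lemma qdiff_nonzero [simp]: "qdiff \<noteq> 0"
proof
  assume "qdiff = 0"
  then have "qq = inverse qq"
    unfolding qdiff_def by (rule eq_iff_diff_eq_0[THEN iffD2])
  then have "qq * qq = 1"
    using right_inverse[OF qq_nonzero] by simp
  then have "qq ^ 2 = 1"
    by (simp only: power2_eq_square)
  then show False
    using qq_power_neq_1[of 2] by (simp only: zero_less_numeral)
qed

lemma sign_nonzero [simp]: "sign s \<noteq> 0"
  by (simp add: sign_def)

lemma inverse_sign [simp]: "inverse (sign s) = sign s"
  by (simp add: sign_def)

section \<open>The RLL relations in coordinates\<close>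

text \<open>Row \<open>(i, k)\<close> of the R-matrix has nonzero entries only at \<open>(i, k)\<close> and, if \<open>i < k\<close>, at \<open>(k, i)\<close>, and
  similarly for columns; so the double sums of the RLL equation have at most two terms.\<close>

lemma sum_two_pairs:
  fixes f :: "'n::finite \<Rightarrow> 'n \<Rightarrow> 'a::comm_monoid_add"
  assumes f: "\<And>a c. \<not> (a = x \<and> c = y) \<Longrightarrow> \<not> (P \<and> a = y \<and> c = x) \<Longrightarrow> f a c = 0"
    and "P \<Longrightarrow> x \<noteq> y"
  shows "(\<Sum>a\<in>UNIV. \<Sum>c\<in>UNIV. f a c) = f x y + (if P then f y x else 0)"
proof -
  let ?S = "if P then {(x, y), (y, x)} else {(x, y)}"
  have "(\<Sum>a\<in>UNIV. \<Sum>c\<in>UNIV. f a c) = (\<Sum>p\<in>UNIV. case_prod f p)"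
    by (simp add: sum.cartesian_product)
  also have "\<dots> = (\<Sum>p\<in>?S. case_prod f p)"
  proof (rule sum.mono_neutral_right; safe?)
    fix a c
    assume "(a, c) \<notin> ?S"
    then show "f a c = 0"
      by (intro f) (cases P; simp)+
  qed auto
  also have "\<dots> = f x y + (if P then f y x else 0)"
    using assms(2) by (cases P) auto
  finally show ?thesis .
qed

lemma Rmat_entries:
  shows Rmat_diag: "Rmat i i k k = qq powi (- eps_form i k)"
    and Rmat_swap: "i < k \<Longrightarrow> Rmat i k k i = - (qdiff * sign (odd_index k))"
    and Rmat_other: "\<lbrakk>\<not> (i = j \<and> k = l); \<not> (i < j \<and> k = j \<and> l = i)\<rbrakk> \<Longrightarrow> Rmat i j k l = 0"
proof -
  show "Rmat i i k k = qq powi (- eps_form i k)"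
    by (simp only: Rmat_def order.irrefl simp_thms if_True if_False mult_zero_right diff_0_right)
  show "Rmat i j k l = 0" if "\<not> (i = j \<and> k = l)" "\<not> (i < j \<and> k = j \<and> l = i)"
    by (simp only: Rmat_def that if_False mult_zero_right diff_0_right)
  assume "i < k"
  then have "i \<noteq> k" by (rule less_imp_neq)
  with \<open>i < k\<close> show "Rmat i k k i = - (qdiff * sign (odd_index k))"
    by (simp only: Rmat_def simp_thms if_True if_False diff_0 qdiff_def)
qed

text \<open>The coefficient of \<open>E\<^sub>i\<^sub>j \<otimes> E\<^sub>k\<^sub>l\<close> in the RLL equation.  The signs come from the graded product of
  matrices and from \<open>L\<^sub>1 L\<^sub>2\<close>, whose entries \<open>\<plusminus> l\<^sub>i\<^sub>j l\<^sub>k\<^sub>l\<close> carry one while those of \<open>L\<^sub>2 L\<^sub>1\<close> do not.\<close>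

lemma rll_equation_coords:
  fixes A B :: "'n::super_index \<Rightarrow> 'n \<Rightarrow> 'a::cq_superalgebra"
  assumes eq: "rll_equation A B" and ev: "even_mat A" "even_mat B"
  shows "(qq powi (- eps_form i k) * sign (par i j \<and> par k l)) *\<^sub>Q (A i j * B k l)
      - (if i < k then qdiff * sign (odd_index k \<noteq> ((par i k \<and> par k j) \<noteq> (par k j \<and> par i l))) else 0)
          *\<^sub>Q (A k j * B i l)
    = qq powi (- eps_form j l) *\<^sub>Q (B k l * A i j)
      - (if l < j then qdiff * sign (odd_index j \<noteq> (par k j \<and> par l j)) else 0) *\<^sub>Q (B k j * A i l)"
    (is "?s1 - ?s2 = ?s3 - ?s4")
proof -
  let ?R = "mat2_const Rmat :: ('n, 'a) mat2"
  let ?f = "\<lambda>a c. sign ((par i a \<noteq> par k c) \<and> (par a j \<noteq> par c l)) * sign (par k c \<and> par a j) *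
    (Rmat i a k c * sign (par a j \<and> par c l))"
  let ?g = "\<lambda>a c. sign ((par i a \<noteq> par k c) \<and> (par a j \<noteq> par c l)) * sign (par k c \<and> par a j) *
    Rmat a j c l"
  have even: "even_mat2 (leg1 A \<odot> leg2 B)"
    by (intro even_mat2_mult even_leg ev)
  have "(?R \<odot> leg1 A \<odot> leg2 B) i j k l = (?R \<odot> (leg1 A \<odot> leg2 B)) i j k l"
    by (simp only: mat2_mult_assoc[OF even_leg(1)[OF ev(1)] even_leg(2)[OF ev(2)]])
  also have "\<dots> = (\<Sum>a\<in>UNIV. \<Sum>c\<in>UNIV. ?f a c *\<^sub>Q (A a j * B c l))"
    unfolding mat2_mult_even[OF even]
    by (simp only: mat2_const_def leg_mult(1)[OF ev] scaleQ_mult_left scaleQ_mult_right mult_1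
        scaleQ_scaleQ ac_simps)
  also have "\<dots> = ?f i k *\<^sub>Q (A i j * B k l) + (if i < k then ?f k i *\<^sub>Q (A k j * B i l) else 0)"
  proof (rule sum_two_pairs)
    show "?f a c *\<^sub>Q (A a j * B c l) = 0"
      if "\<not> (a = i \<and> c = k)" "\<not> (i < k \<and> a = k \<and> c = i)" for a c
    proof -
      have "Rmat i a k c = 0"
        by (rule Rmat_other) (use that in blast)+
      then show ?thesis by simp
    qed
  qed (rule less_imp_neq)
  also have "?f i k = qq powi (- eps_form i k) * sign (par i j \<and> par k l)"
    by (simp only: Rmat_diag) simp
  also have "(if i < k then ?f k i *\<^sub>Q (A k j * B i l) else 0) =
    - ((if i < k then qdiff * sign (odd_index k \<noteq> ((par i k \<and> par k j) \<noteq> (par k j \<and> par i l))) else 0)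
          *\<^sub>Q (A k j * B i l))"
  proof (cases "i < k")
    case True
    have "?f k i = - (qdiff * sign (odd_index k \<noteq> ((par i k \<and> par k j) \<noteq> (par k j \<and> par i l))))"
      unfolding Rmat_swap[OF True]
      by (cases "odd_index i"; cases "odd_index j"; cases "odd_index k"; cases "odd_index l")
        (simp_all add: sign_def)
    with True show ?thesis
      by (simp only: if_True cq.scale_minus_left)
  qed (simp only: if_False cq.scale_zero_left minus_zero)
  finally have left: "(?R \<odot> leg1 A \<odot> leg2 B) i j k l = ?s1 + - ?s2" .
  have "(leg2 B \<odot> leg1 A \<odot> ?R) i j k l = (\<Sum>a\<in>UNIV. \<Sum>c\<in>UNIV. ?g a c *\<^sub>Q (B k c * A i a))"
    unfolding mat2_mult_even[OF even_Rmat]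
    by (simp only: mat2_const_def leg_mult(2)[OF ev] scaleQ_mult_right mult_1_right scaleQ_scaleQ)
  also have "\<dots> = ?g j l *\<^sub>Q (B k l * A i j) + (if l < j then ?g l j *\<^sub>Q (B k j * A i l) else 0)"
  proof (rule sum_two_pairs)
    show "?g a c *\<^sub>Q (B k c * A i a) = 0"
      if "\<not> (a = j \<and> c = l)" "\<not> (l < j \<and> a = l \<and> c = j)" for a c
    proof -
      have "Rmat a j c l = 0"
        by (rule Rmat_other) (use that in blast)+
      then show ?thesis by simp
    qed
  qed (use less_imp_neq in blast)
  also have "?g j l = qq powi (- eps_form j l)"
    by (simp only: Rmat_diag) simp
  also have "(if l < j then ?g l j *\<^sub>Q (B k j * A i l) else 0) =
    - ((if l < j then qdiff * sign (odd_index j \<noteq> (par k j \<and> par l j)) else 0) *\<^sub>Q (B k j * A i l))"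
  proof (cases "l < j")
    case True
    have "?g l j = - (qdiff * sign (odd_index j \<noteq> (par k j \<and> par l j)))"
      unfolding Rmat_swap[OF True]
      by (cases "odd_index i"; cases "odd_index j"; cases "odd_index k"; cases "odd_index l")
        (simp_all add: sign_def)
    with True show ?thesis
      by (simp only: if_True cq.scale_minus_left)
  qed (simp only: if_False cq.scale_zero_left minus_zero)
  finally have right: "(leg2 B \<odot> leg1 A \<odot> ?R) i j k l = ?s3 + - ?s4" .
  show ?thesis
    using eq left right unfolding rll_equation_def by (simp only: diff_conv_add_uminus)
qed

lemma scaleQ_cancel: "c \<noteq> 0 \<Longrightarrow> c *\<^sub>Q x = y \<longleftrightarrow> x = inverse c *\<^sub>Q (y :: 'a::cq_space)"
  by (metis scaleQ_scaleQ scaleQ_one left_inverse right_inverse)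

text \<open>Put both indices of one factor equal: triangularity then removes the two terms with exchanged
  indices, and diagonal generators commute with all others up to a power of \<open>q\<close>.\<close>

lemma lm_lp_diag:
  fixes i j k :: "'n::super_index"
  shows "lp i j * lm k k = qq powi (eps_form i k - eps_form j k) *\<^sub>Q (lm k k * lp i j)"
    and "lp k k * lm i j = qq powi (eps_form i k - eps_form j k) *\<^sub>Q (lm i j * lp k k)"
    and "lm i i * lm k k = lm k k * lm i i"
    and "lp i i * lp k k = lp k k * lp i i"
proof -
  have sym: "eps_form a b = eps_form b a" for a b :: 'n
    by (simp add: eps_form_def)
  have "qq powi (- eps_form i k) *\<^sub>Q (lp i j * lm k k) = qq powi (- eps_form j k) *\<^sub>Q (lm k k * lp i j)"
    using rll_equation_coords[OF rll_equations_rll(3) even_rll, of i k j k]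
    by (auto simp: rll_generators split: if_splits)
  then show "lp i j * lm k k = qq powi (eps_form i k - eps_form j k) *\<^sub>Q (lm k k * lp i j)"
    by (subst (asm) scaleQ_cancel) (simp_all add: power_int_minus power_int_diff divide_inverse)
  have "qq powi (- eps_form k i) *\<^sub>Q (lp k k * lm i j) = qq powi (- eps_form k j) *\<^sub>Q (lm i j * lp k k)"
    using rll_equation_coords[OF rll_equations_rll(3) even_rll, of k i k j]
    by (auto simp: rll_generators split: if_splits)
  then show "lp k k * lm i j = qq powi (eps_form i k - eps_form j k) *\<^sub>Q (lm i j * lp k k)"
    by (subst (asm) scaleQ_cancel) (simp_all add: power_int_minus power_int_diff divide_inverse sym)
  have "qq powi (- eps_form i k) *\<^sub>Q (lm i i * lm k k) = qq powi (- eps_form i k) *\<^sub>Q (lm k k * lm i i)"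
    using rll_equation_coords[OF rll_equations_rll(2) even_rll(2) even_rll(2), of i k i k]
    by (cases i k rule: linorder_cases) (auto simp: rll_generators split: if_splits)
  then show "lm i i * lm k k = lm k k * lm i i"
    by (subst (asm) scaleQ_cancel) auto
  have "qq powi (- eps_form i k) *\<^sub>Q (lp i i * lp k k) = qq powi (- eps_form i k) *\<^sub>Q (lp k k * lp i i)"
    using rll_equation_coords[OF rll_equations_rll(1) even_rll(1) even_rll(1), of i k i k]
    by (cases i k rule: linorder_cases) (auto simp: rll_generators split: if_splits)
  then show "lp i i * lp k k = lp k k * lp i i"
    by (subst (asm) scaleQ_cancel) auto
qed

section \<open>Root vectors and their straightening relations\<close>

text \<open>The root vectors without their scalar factors.  On the diagonal they are \<open>1\<close> and beyond it \<open>0\<close>,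
  so the relations between them need no case distinctions on the indices.\<close>

definition ebar :: "'n::super_index \<times> 'n \<Rightarrow> 'n rll"
  where "ebar = (\<lambda>(i, j). lm i i * lp i j)"

definition fbar :: "'n::super_index \<times> 'n \<Rightarrow> 'n rll"
  where "fbar = (\<lambda>(i, j). lm j i * lp i i)"

lemma bar_triangular:
  "ebar (i, i) = 1" "fbar (i, i) = 1" "j < i \<Longrightarrow> ebar (i, j) = 0" "j < i \<Longrightarrow> fbar (i, j) = 0"
  by (simp_all add: ebar_def fbar_def rll_generators)

lemma scaleQ_diff_eqD:
  "a - x *\<^sub>Q b = t - y *\<^sub>Q b \<Longrightarrow> a = t + (x - y) *\<^sub>Q (b :: 'a::cq_space)"
  by (simp add: cq.scale_left_diff_distrib algebra_simps)

text \<open>In the RLL relation for the rows \<open>i < k\<close> the product \<open>l\<^sub>k\<^sub>j l\<^sub>i\<^sub>l\<close> occurs on both sides.  For \<open>l < j\<close> both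
  occurrences have the same coefficient and cancel, which is where the convexity of the root order enters.\<close>

lemma lp_exchange:
  assumes "i < k"
  obtains c c' where "lp i j * lp k l = c *\<^sub>Q (lp k l * lp i j) + c' *\<^sub>Q (lp k j * lp i l)"
    and "l < j \<Longrightarrow> c' = 0"
proof -
  let ?s = "sign (par i j \<and> par k l)"
  let ?x = "qdiff * sign (odd_index k \<noteq> ((par i k \<and> par k j) \<noteq> (par k j \<and> par i l)))"
  let ?y = "if l < j then qdiff * sign (odd_index j \<noteq> (par k j \<and> par l j)) else 0"
  have xy: "?x = ?y" if "l < j"
    using that by (cases "odd_index i"; cases "odd_index j"; cases "odd_index k"; cases "odd_index l")
      (simp_all add: sign_def)
  have "eps_form i k = 0"
    using assms by (simp add: eps_form_def)
  then have "?s *\<^sub>Q (lp i j * lp k l) - ?x *\<^sub>Q (lp k j * lp i l)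
      = qq powi (- eps_form j l) *\<^sub>Q (lp k l * lp i j) - ?y *\<^sub>Q (lp k j * lp i l)"
    using rll_equation_coords[OF rll_equations_rll(1) even_rll(1) even_rll(1), of i k j l] assms by simp
  then have "?s *\<^sub>Q (lp i j * lp k l)
      = qq powi (- eps_form j l) *\<^sub>Q (lp k l * lp i j) + (?x - ?y) *\<^sub>Q (lp k j * lp i l)"
    by (rule scaleQ_diff_eqD)
  then have "lp i j * lp k l
      = (?s * qq powi (- eps_form j l)) *\<^sub>Q (lp k l * lp i j) + (?s * (?x - ?y)) *\<^sub>Q (lp k j * lp i l)"
    by (subst (asm) scaleQ_cancel) (simp_all only: sign_nonzero not_False_eq_True inverse_sign scaleQ_right_distrib scaleQ_scaleQ)
  then show ?thesis
    by (rule that) (use xy in simp)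
qed

text \<open>The mirror image of the previous lemma.  The roles of the two factors in the RLL relation are
  interchanged, so that the column \<open>k\<close> stands to the left of the column \<open>i < k\<close> in the extra term.\<close>

lemma lm_exchange:
  assumes "i < k"
  obtains c c' where "lm j i * lm l k = c *\<^sub>Q (lm l k * lm j i) + c' *\<^sub>Q (lm j k * lm l i)"
    and "l < j \<Longrightarrow> c' = 0"
proof -
  let ?s = "sign (par l k \<and> par j i)"
  let ?x = "qdiff * sign (odd_index k \<noteq> (par j k \<and> par i k))"
  let ?y = "if l < j then qdiff * sign (odd_index j \<noteq> ((par l j \<and> par j k) \<noteq> (par j k \<and> par l i))) else 0"
  have xy: "?x = ?y" if "l < j"
    using that by (cases "odd_index i"; cases "odd_index j"; cases "odd_index k"; cases "odd_index l")
      (simp_all add: sign_def)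
  have "eps_form k i = 0"
    using assms by (simp add: eps_form_def)
  then have "(qq powi (- eps_form l j) * ?s) *\<^sub>Q (lm l k * lm j i) - ?y *\<^sub>Q (lm j k * lm l i)
      = lm j i * lm l k - ?x *\<^sub>Q (lm j k * lm l i)"
    using rll_equation_coords[OF rll_equations_rll(2) even_rll(2) even_rll(2), of l j k i] assms by simp
  then have "lm j i * lm l k
      = (qq powi (- eps_form l j) * ?s) *\<^sub>Q (lm l k * lm j i) + (?x - ?y) *\<^sub>Q (lm j k * lm l i)"
    by (simp add: cq.scale_left_diff_distrib algebra_simps)
  then show ?thesis
    by (rule that) (use xy in simp)
qed

lemma lp_same_row:
  assumes "j < l"
  obtains c where "lp i j * lp i l = c *\<^sub>Q (lp i l * lp i j)"
proof -
  have "eps_form j l = 0"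
    using assms by (simp add: eps_form_def)
  then have "(qq powi (- eps_form i i) * sign (par i j \<and> par i l)) *\<^sub>Q (lp i j * lp i l) = lp i l * lp i j"
    using rll_equation_coords[OF rll_equations_rll(1) even_rll(1) even_rll(1), of i i j l] less_not_sym[OF assms]
    by simp
  then show ?thesis
    by (subst (asm) scaleQ_cancel) (simp, rule that)
qed

lemma lm_same_column:
  assumes "j < l"
  obtains c where "lm j i * lm l i = c *\<^sub>Q (lm l i * lm j i)"
proof -
  have "eps_form j l = 0"
    using assms by (simp add: eps_form_def)
  then have "sign (par j i \<and> par l i) *\<^sub>Q (lm j i * lm l i)
      - (qdiff * sign (odd_index l \<noteq> ((par j l \<and> par l i) \<noteq> (par l i \<and> par j i)))) *\<^sub>Q (lm l i * lm j i)
      = qq powi (- eps_form i i) *\<^sub>Q (lm l i * lm j i)"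
    using rll_equation_coords[OF rll_equations_rll(2) even_rll(2) even_rll(2), of j l i i] assms by simp
  then have "sign (par j i \<and> par l i) *\<^sub>Q (lm j i * lm l i)
      = (qq powi (- eps_form i i) + qdiff * sign (odd_index l \<noteq> ((par j l \<and> par l i) \<noteq> (par l i \<and> par j i))))
        *\<^sub>Q (lm l i * lm j i)"
    by (simp only: diff_eq_eq scaleQ_left_distrib)
  then show ?thesis
    by (subst (asm) scaleQ_cancel) (simp, simp only: scaleQ_scaleQ, rule that)
qed

text \<open>For odd \<open>l\<^sub>i\<^sub>j\<close> the RLL relation reads \<open>- q\<^sup>\<plusminus>\<^sup>1 l\<^sup>2 = q\<^sup>\<mp>\<^sup>1 l\<^sup>2\<close>, and \<open>q\<^sup>2 \<noteq> - 1\<close>.\<close>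

lemma odd_square_zero:
  assumes "par i j"
  shows "lp i j * lp i j = 0" "lm i j * lm i j = 0"
proof -
  have "- (qq powi (- eps_form i i)) \<noteq> qq powi (- eps_form j j)"
  proof
    assume eq: "- (qq powi (- eps_form i i)) = qq powi (- eps_form j j)"
    have "eps_form j j = - eps_form i i"
      using assms by (simp add: eps_form_def)
    with eq have "- 1 = qq powi (2 * eps_form i i)"
      by (simp add: power_int_minus field_simps flip: power_int_add)
    then have "(- 1) * (- 1) = qq powi (2 * eps_form i i) * qq powi (2 * eps_form i i)"
      by simp
    then have "qq powi (4 * eps_form i i) = 1"
      by (simp flip: power_int_add)
    moreover have "4 * eps_form i i \<noteq> 0"
      by (simp add: eps_form_def)
    ultimately show False
      using qq_powi_neq_1 by blast
  qed
  then have *: "x = 0" if "- (qq powi (- eps_form i i)) *\<^sub>Q x = qq powi (- eps_form j j) *\<^sub>Q (x :: 'a rll)" for x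
    using that by (simp only: cq.scale_cancel_right) simp
  show "lp i j * lp i j = 0"
    using rll_equation_coords[OF rll_equations_rll(1) even_rll(1) even_rll(1), of i i j j] assms
    by (intro *) (simp add: sign_def)
  show "lm i j * lm i j = 0"
    using rll_equation_coords[OF rll_equations_rll(2) even_rll(2) even_rll(2), of i i j j] assms
    by (intro *) (simp add: sign_def)
qed

text \<open>The relations that allow products of root vectors to be reordered, common to both triangular
  parts.  The last clause contains \<open>x (k, j)\<close>, which is \<open>1\<close> for \<open>k = j\<close> and \<open>0\<close> for \<open>k > j\<close>.\<close>

definition straightening :: "('n::super_index \<times> 'n \<Rightarrow> 'a::cq_superalgebra) \<Rightarrow> bool"
  where "straightening x \<longleftrightarrow>
    (\<forall>i j. x (i, i) = 1 \<and> (j < i \<longrightarrow> x (i, j) = 0) \<and> (par i j \<longrightarrow> x (i, j) * x (i, j) = 0)) \<and>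
    (\<forall>i j l. j < l \<longrightarrow> (\<exists>c. x (i, j) * x (i, l) = c *\<^sub>Q (x (i, l) * x (i, j)))) \<and>
    (\<forall>i j k l. i < k \<longrightarrow> (\<exists>c c'. (l < j \<longrightarrow> c' = 0) \<and>
      x (i, j) * x (k, l) = c *\<^sub>Q (x (k, l) * x (i, j)) + c' *\<^sub>Q (x (k, j) * x (i, l))))"

text \<open>Collecting the diagonal factors on one side carries the exchange relations of the \<open>l\<^sup>+\<^sub>i\<^sub>j\<close> over to
  the root vectors; the second equation is the way back.\<close>

lemma ebar_mult:
  "ebar (i, j) * ebar (k, l) = qq powi (eps_form i k - eps_form j k) *\<^sub>Q ((lm i i * lm k k) * (lp i j * lp k l))"
  "(lm i i * lm k k) * (lp i j * lp k l) = qq powi (eps_form j k - eps_form i k) *\<^sub>Q (ebar (i, j) * ebar (k, l))"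
proof -
  have "ebar (i, j) * ebar (k, l) = lm i i * ((lp i j * lm k k) * lp k l)"
    by (simp only: ebar_def case_prod_conv mult.assoc)
  also have "\<dots> = qq powi (eps_form i k - eps_form j k) *\<^sub>Q ((lm i i * lm k k) * (lp i j * lp k l))"
    by (simp only: lm_lp_diag(1) scaleQ_mult_left scaleQ_mult_right mult.assoc)
  finally show *: "ebar (i, j) * ebar (k, l) = \<dots>" .
  show "(lm i i * lm k k) * (lp i j * lp k l) = qq powi (eps_form j k - eps_form i k) *\<^sub>Q (ebar (i, j) * ebar (k, l))"
    unfolding * by (simp flip: power_int_add)
qed

lemma fbar_mult:
  "fbar (i, j) * fbar (k, l) = qq powi (eps_form l i - eps_form k i) *\<^sub>Q ((lm j i * lm l k) * (lp i i * lp k k))"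
  "(lm j i * lm l k) * (lp i i * lp k k) = qq powi (eps_form k i - eps_form l i) *\<^sub>Q (fbar (i, j) * fbar (k, l))"
proof -
  have "fbar (i, j) * fbar (k, l) = lm j i * ((lp i i * lm l k) * lp k k)"
    by (simp only: fbar_def case_prod_conv mult.assoc)
  also have "\<dots> = qq powi (eps_form l i - eps_form k i) *\<^sub>Q ((lm j i * lm l k) * (lp i i * lp k k))"
    by (simp only: lm_lp_diag(2) scaleQ_mult_left scaleQ_mult_right mult.assoc)
  finally show *: "fbar (i, j) * fbar (k, l) = \<dots>" .
  show "(lm j i * lm l k) * (lp i i * lp k k) = qq powi (eps_form k i - eps_form l i) *\<^sub>Q (fbar (i, j) * fbar (k, l))"
    unfolding * by (simp flip: power_int_add)
qed

lemma straightening_ebar: "straightening (ebar :: 'n::super_index \<times> 'n \<Rightarrow> 'n rll)"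
  unfolding straightening_def
proof (intro conjI allI impI)
  fix i j k l :: 'n
  show "ebar (i, i) = 1" "j < i \<Longrightarrow> ebar (i, j) = 0"
    by (simp_all add: bar_triangular)
  show "ebar (i, j) * ebar (i, j) = 0" if "par i j"
    by (simp add: ebar_mult odd_square_zero[OF that])
  show "\<exists>c. ebar (i, j) * ebar (i, l) = c *\<^sub>Q (ebar (i, l) * ebar (i, j))" if h: "j < l"
  proof -
    obtain c where c: "lp i j * lp i l = c *\<^sub>Q (lp i l * lp i j)"
      using lp_same_row[OF h] by blast
    show ?thesis
      unfolding ebar_mult(1)[of i j i l] c scaleQ_mult_right ebar_mult(2)[of i i l j] scaleQ_scaleQ by blast
  qed
  show "\<exists>c c'. (l < j \<longrightarrow> c' = 0) \<and>
      ebar (i, j) * ebar (k, l) = c *\<^sub>Q (ebar (k, l) * ebar (i, j)) + c' *\<^sub>Q (ebar (k, j) * ebar (i, l))"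
    if h: "i < k"
  proof -
    obtain c c' where c: "lp i j * lp k l = c *\<^sub>Q (lp k l * lp i j) + c' *\<^sub>Q (lp k j * lp i l)"
      and c': "l < j \<Longrightarrow> c' = 0"
      using lp_exchange[OF h] by blast
    show ?thesis
      unfolding ebar_mult(1)[of i j k l] c distrib_left scaleQ_right_distrib scaleQ_mult_right
        lm_lp_diag(3)[of i k] ebar_mult(2) scaleQ_scaleQ
      by (intro exI, rule conjI[rotated], rule refl) (simp add: c')
  qed
qed

lemma straightening_fbar: "straightening (fbar :: 'n::super_index \<times> 'n \<Rightarrow> 'n rll)"
  unfolding straightening_def
proof (intro conjI allI impI)
  fix i j k l :: 'n
  show "fbar (i, i) = 1" "j < i \<Longrightarrow> fbar (i, j) = 0"
    by (simp_all add: bar_triangular)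
  show "fbar (i, j) * fbar (i, j) = 0" if "par i j"
  proof -
    have "par j i"
      using that by blast
    then show ?thesis
      by (simp add: fbar_mult odd_square_zero)
  qed
  show "\<exists>c. fbar (i, j) * fbar (i, l) = c *\<^sub>Q (fbar (i, l) * fbar (i, j))" if h: "j < l"
  proof -
    obtain c where c: "lm j i * lm l i = c *\<^sub>Q (lm l i * lm j i)"
      using lm_same_column[OF h] by blast
    show ?thesis
      unfolding fbar_mult(1)[of i j i l] c scaleQ_mult_left fbar_mult(2)[of l i j i] scaleQ_scaleQ by blast
  qed
  show "\<exists>c c'. (l < j \<longrightarrow> c' = 0) \<and>
      fbar (i, j) * fbar (k, l) = c *\<^sub>Q (fbar (k, l) * fbar (i, j)) + c' *\<^sub>Q (fbar (k, j) * fbar (i, l))"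
    if h: "i < k"
  proof -
    obtain c c' where c: "lm j i * lm l k = c *\<^sub>Q (lm l k * lm j i) + c' *\<^sub>Q (lm j k * lm l i)"
      and c': "l < j \<Longrightarrow> c' = 0"
      using lm_exchange[OF h] by blast
    show ?thesis
      unfolding fbar_mult(1)[of i j k l] c distrib_right scaleQ_right_distrib scaleQ_mult_left
        lm_lp_diag(4)[of i k] fbar_mult(2) scaleQ_scaleQ
      by (intro exI, rule conjI[rotated], rule refl) (simp add: c')
  qed
qed

section \<open>Ordered monomials span\<close>

lemma subalgebraI:
  assumes "1 \<in> A" "\<And>x y. x \<in> A \<Longrightarrow> y \<in> A \<Longrightarrow> x + y \<in> A" "\<And>x y. x \<in> A \<Longrightarrow> y \<in> A \<Longrightarrow> x * y \<in> A"
    "\<And>c x. x \<in> A \<Longrightarrow> c *\<^sub>Q x \<in> A"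
  shows "subalgebra A"
  using assms unfolding subalgebra_def by blast

lemma subalgebra_hull: "subalgebra (subalgebra hull S)"
  by (rule hull_in) (auto simp: subalgebra_def)

lemma subalgebraD:
  assumes "subalgebra A"
  shows "1 \<in> A" "x \<in> A \<Longrightarrow> y \<in> A \<Longrightarrow> x + y \<in> A" "x \<in> A \<Longrightarrow> y \<in> A \<Longrightarrow> x * y \<in> A"
    "x \<in> A \<Longrightarrow> c *\<^sub>Q x \<in> A" "0 \<in> A" "x \<in> A \<Longrightarrow> x ^ n \<in> A"
proof -
  show *: "1 \<in> A" "x \<in> A \<Longrightarrow> y \<in> A \<Longrightarrow> x + y \<in> A" "x \<in> A \<Longrightarrow> y \<in> A \<Longrightarrow> x * y \<in> A"
    "x \<in> A \<Longrightarrow> c *\<^sub>Q x \<in> A" for x y c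
    using assms unfolding subalgebra_def by blast+
  show "0 \<in> A"
    using *(4)[OF *(1), of 0] by simp
  show "x \<in> A \<Longrightarrow> x ^ n \<in> A"
    by (induction n) (simp_all add: *)
qed

lemma subalgebra_subspace: "subalgebra A \<Longrightarrow> cq.subspace A"
  by (simp add: cq.subspace_def subalgebraD)

text \<open>The list is increasing, so \<open>rev\<close> puts the power of the largest root leftmost and the head of the
  list rightmost.\<close>

definition monomial :: "('k \<Rightarrow> 'a::monoid_mult) \<Rightarrow> 'k list \<Rightarrow> ('k \<Rightarrow> nat) \<Rightarrow> 'a"
  where "monomial x rs \<kappa> = prod_list (map (\<lambda>\<gamma>. x \<gamma> ^ \<kappa> \<gamma>) (rev rs))"

lemma monomial_simps [simp]:
  "monomial x [] \<kappa> = 1"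
  "monomial x (\<gamma> # rs) \<kappa> = monomial x rs \<kappa> * x \<gamma> ^ \<kappa> \<gamma>"
  by (simp_all add: monomial_def)

lemma monomial_cong: "(\<And>\<gamma>. \<gamma> \<in> set rs \<Longrightarrow> \<kappa> \<gamma> = \<kappa>' \<gamma>) \<Longrightarrow> monomial x rs \<kappa> = monomial x rs \<kappa>'"
  by (induction rs) auto

definition exponents :: "('n::super_index \<times> 'n) list \<Rightarrow> ('n \<times> 'n \<Rightarrow> nat) set"
  where "exponents rs = {\<kappa>. (\<forall>\<gamma>. \<gamma> \<notin> set rs \<longrightarrow> \<kappa> \<gamma> = 0) \<and> (\<forall>i j. par i j \<longrightarrow> \<kappa> (i, j) \<le> 1)}"

definition roots_above :: "'n::super_index \<times> 'n \<Rightarrow> ('n \<times> 'n) set"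
  where "roots_above \<gamma> = {\<delta>. fst \<delta> < snd \<delta> \<and> \<gamma> < \<delta>}"

lemma roots_above_iff: "(k, l) \<in> roots_above (i, j) \<longleftrightarrow> k < l \<and> (i < k \<or> i = k \<and> j < l)"
  by (auto simp: roots_above_def less_le)

context
  fixes x :: "'n::super_index \<times> 'n \<Rightarrow> 'a::cq_superalgebra"
  assumes x: "straightening x"
begin

text \<open>Of the two terms in the exchange relation the first ends in \<open>x \<gamma>\<close>.  In the second, \<open>x (k, j)\<close> is
  above \<open>\<gamma> = (i, j)\<close>, or \<open>1\<close>, or \<open>0\<close>, and \<open>x (i, l)\<close> is above \<open>\<gamma>\<close> or equal to it, since the coefficient
  vanishes for \<open>l < j\<close>.\<close>

lemma straighten_generator:
  assumes "\<delta> \<in> roots_above \<gamma>"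
  obtains u v where "u \<in> subalgebra hull (x ` roots_above \<gamma>)" "v \<in> subalgebra hull (x ` roots_above \<gamma>)"
    "x \<gamma> * x \<delta> = u * x \<gamma> + v"
proof -
  let ?A = "subalgebra hull (x ` roots_above \<gamma>)"
  note A = subalgebraD[OF subalgebra_hull[of "x ` roots_above \<gamma>"]]
  obtain i j k l where gd: "\<gamma> = (i, j)" "\<delta> = (k, l)"
    by (metis prod.exhaust)
  have gen: "x \<eta> \<in> ?A" if "\<eta> \<in> roots_above \<gamma>" for \<eta>
    using that by (intro hull_inc imageI)
  have kl: "k < l" and "i < k \<or> i = k \<and> j < l"
    using assms by (simp_all add: gd roots_above_iff)
  from this(2) show ?thesis
  proof
    assume "i = k \<and> j < l"
    then obtain c where "x \<gamma> * x \<delta> = c *\<^sub>Q (x \<delta> * x \<gamma>)"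
      using x unfolding straightening_def gd by blast
    then show ?thesis
      by (intro that[of "c *\<^sub>Q x \<delta>" 0] A gen assms) (simp add: scaleQ_mult_left)
  next
    assume ik: "i < k"
    then obtain c c' where c': "l < j \<longrightarrow> c' = 0"
      and eq: "x \<gamma> * x \<delta> = c *\<^sub>Q (x \<delta> * x \<gamma>) + c' *\<^sub>Q (x (k, j) * x (i, l))"
      using x unfolding straightening_def gd by blast
    have kj: "x (k, j) \<in> ?A"
    proof (cases k j rule: linorder_cases)
      case less
      then show ?thesis
        using ik by (intro gen) (simp add: gd roots_above_iff)
    next
      case equal
      then show ?thesis
        using x A(1) unfolding straightening_def by metis
    next
      case greater
      then show ?thesis
        using x A(5) unfolding straightening_def by metis
    qed
    show ?thesis
    proof (cases l j rule: linorder_cases)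
      case less
      then show ?thesis
        using eq c' by (intro that[of "c *\<^sub>Q x \<delta>" 0] A gen assms) (simp add: scaleQ_mult_left)
    next
      case equal
      then show ?thesis
        using eq by (intro that[of "c *\<^sub>Q x \<delta> + c' *\<^sub>Q x (k, j)" 0] A gen assms kj)
          (simp add: gd scaleQ_mult_left distrib_right)
    next
      case greater
      then have il: "x (i, l) \<in> ?A"
        using ik kl by (intro gen) (auto simp: gd roots_above_iff)
      show ?thesis
        using eq by (intro that[of "c *\<^sub>Q x \<delta>" "c' *\<^sub>Q (x (k, j) * x (i, l))"] A gen[OF assms] kj il)
          (simp_all add: scaleQ_mult_left)
    qed
  qed
qed

text \<open>The elements past which \<open>x \<gamma>\<close> can be moved in this way form a subalgebra, and they contain the
  generators by the previous lemma.\<close>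

lemma straighten_subalgebra:
  assumes "y \<in> subalgebra hull (x ` roots_above \<gamma>)"
  shows "\<exists>u\<in>subalgebra hull (x ` roots_above \<gamma>). \<exists>v\<in>subalgebra hull (x ` roots_above \<gamma>).
    x \<gamma> * y = u * x \<gamma> + v"
proof -
  let ?A = "subalgebra hull (x ` roots_above \<gamma>)"
  note A = subalgebraD[OF subalgebra_hull[of "x ` roots_above \<gamma>"]]
  let ?P = "\<lambda>y. y \<in> ?A \<and> (\<exists>u\<in>?A. \<exists>v\<in>?A. x \<gamma> * y = u * x \<gamma> + v)"
  have "?P y"
    using assms
  proof (rule hull_induct[where P = ?P])
    fix y
    assume "y \<in> x ` roots_above \<gamma>"
    then obtain \<delta> where "\<delta> \<in> roots_above \<gamma>" "y = x \<delta>"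
      by blast
    then show "?P y"
      using straighten_generator[of \<delta> \<gamma>] by (metis hull_inc imageI)
  next
    show "subalgebra {y. ?P y}"
    proof (rule subalgebraI)
      have "\<exists>u\<in>?A. \<exists>v\<in>?A. x \<gamma> * 1 = u * x \<gamma> + v"
        by (intro bexI[of _ 1] bexI[of _ 0] A) simp
      then show "1 \<in> {y. ?P y}"
        using A(1) by blast
    next
      fix y z
      assume "y \<in> {y. ?P y}" "z \<in> {y. ?P y}"
      then obtain u v u' v' where yz: "y \<in> ?A" "z \<in> ?A" and uv: "u \<in> ?A" "v \<in> ?A" "u' \<in> ?A" "v' \<in> ?A"
        and y: "x \<gamma> * y = u * x \<gamma> + v" and z: "x \<gamma> * z = u' * x \<gamma> + v'"
        by blast
      have "x \<gamma> * (y + z) = (u + u') * x \<gamma> + (v + v')"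
        by (simp add: distrib_left distrib_right y z)
      then show "y + z \<in> {y. ?P y}"
        using A(2) uv yz by blast
      have "x \<gamma> * (y * z) = u * (x \<gamma> * z) + v * z"
        by (simp add: y distrib_right flip: mult.assoc)
      also have "\<dots> = (u * u') * x \<gamma> + (u * v' + v * z)"
        by (simp add: z distrib_left mult.assoc)
      finally show "y * z \<in> {y. ?P y}"
        using A(2,3) uv yz by blast
    next
      fix c y
      assume "y \<in> {y. ?P y}"
      then obtain u v where y: "y \<in> ?A" and uv: "u \<in> ?A" "v \<in> ?A" "x \<gamma> * y = u * x \<gamma> + v"
        by blast
      have "x \<gamma> * (c *\<^sub>Q y) = (c *\<^sub>Q u) * x \<gamma> + c *\<^sub>Q v"
        by (simp add: scaleQ_mult_left scaleQ_mult_right uv scaleQ_right_distrib)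
      then show "c *\<^sub>Q y \<in> {y. ?P y}"
        using A(4) uv y by blast
    qed
  qed
  then show ?thesis by blast
qed

text \<open>Closure under products comes down to \<open>x \<gamma> ^ k * v\<close> with \<open>v\<close> in the algebra of the roots above \<open>\<gamma>\<close>; there the
  factors \<open>x \<gamma>\<close> are moved past \<open>v\<close> one after the other.\<close>

lemma subalgebra_span_powers:
  "subalgebra (cq.span {u * x \<gamma> ^ k | u k. u \<in> subalgebra hull (x ` roots_above \<gamma>)})"
  (is "subalgebra (cq.span ?G)")
proof -
  let ?A = "subalgebra hull (x ` roots_above \<gamma>)"
  note A = subalgebraD[OF subalgebra_hull[of "x ` roots_above \<gamma>"]]
  have gen: "u * x \<gamma> ^ k \<in> cq.span ?G" if "u \<in> ?A" for u k
    using that by (intro cq.span_base) blast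
  have right: "y * x \<gamma> ^ m \<in> cq.span ?G" if "y \<in> cq.span ?G" for y m
    using that
  proof (induction rule: cq.span_induct_alt)
    case (step c g y)
    then obtain u k where "u \<in> ?A" "g = u * x \<gamma> ^ k" by blast
    then have "g * x \<gamma> ^ m \<in> cq.span ?G"
      using gen[of u "k + m"] by (simp add: power_add mult.assoc)
    with step show ?case
      by (simp add: distrib_right scaleQ_mult_left cq.span_add cq.span_scale)
  qed (simp add: cq.span_zero)
  have left: "v * y \<in> cq.span ?G" if "y \<in> cq.span ?G" "v \<in> ?A" for y v
    using that(1)
  proof (induction rule: cq.span_induct_alt)
    case (step c g y)
    then obtain u k where "u \<in> ?A" "g = u * x \<gamma> ^ k" by blast
    then have "v * g \<in> cq.span ?G"
      using gen[of "v * u" k] A(3)[OF that(2)] by (simp add: mult.assoc)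
    with step show ?case
      by (simp add: distrib_left scaleQ_mult_right cq.span_add cq.span_scale)
  qed (simp add: cq.span_zero)
  have powers: "x \<gamma> ^ k * v \<in> cq.span ?G" if "v \<in> ?A" for k v
    using that
  proof (induction k arbitrary: v)
    case 0
    then show ?case
      using gen[of v 0] by simp
  next
    case (Suc k)
    obtain u w where "u \<in> ?A" "w \<in> ?A" "x \<gamma> * v = u * x \<gamma> + w"
      using straighten_subalgebra[OF Suc.prems] by blast
    moreover have "x \<gamma> ^ Suc k * v = x \<gamma> ^ k * (x \<gamma> * v)"
      by (simp only: power_Suc2 mult.assoc)
    ultimately have "x \<gamma> ^ Suc k * v = (x \<gamma> ^ k * u) * x \<gamma> ^ 1 + x \<gamma> ^ k * w"
      by (simp add: distrib_left mult.assoc)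
    then show ?case
      using Suc.IH[OF \<open>w \<in> ?A\<close>] right[OF Suc.IH[OF \<open>u \<in> ?A\<close>], of 1] by (simp only: cq.span_add)
  qed
  have gen_mult: "g * y \<in> cq.span ?G" if "y \<in> cq.span ?G" and g: "g \<in> ?G" for g y
    using that(1)
  proof (induction rule: cq.span_induct_alt)
    case (step c h y)
    obtain u k v m where "u \<in> ?A" "g = u * x \<gamma> ^ k" "v \<in> ?A" "h = v * x \<gamma> ^ m"
      using step(1) g by blast
    then have "g * h \<in> cq.span ?G"
      using left[OF right[OF powers[of v k], of m], of u] by (simp add: mult.assoc)
    with step show ?case
      by (simp add: distrib_left scaleQ_mult_right cq.span_add cq.span_scale)
  qed (simp add: cq.span_zero)
  have mult: "y * z \<in> cq.span ?G" if "y \<in> cq.span ?G" "z \<in> cq.span ?G" for y z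
    using that(1)
  proof (induction rule: cq.span_induct_alt)
    case (step c g y)
    then show ?case
      using gen_mult[OF that(2), of g]
      by (simp add: distrib_right scaleQ_mult_left cq.span_add cq.span_scale)
  qed (simp add: cq.span_zero)
  show ?thesis
    using gen[OF A(1), of 0] by (intro subalgebraI mult cq.span_add cq.span_scale) simp_all
qed

text \<open>Induction along the list: by the preceding lemma the algebra of the roots from \<open>\<gamma>\<close> on is the span of
  the \<open>u * x \<gamma> ^ k\<close> with \<open>u\<close> in the algebra of the roots above \<open>\<gamma>\<close>, where the induction hypothesis applies.  Exponents
  beyond \<open>1\<close> of odd roots drop out because odd root vectors square to zero.\<close>

theorem ordered_monomials_span:
  assumes "sorted_wrt (<) rs" "\<And>\<gamma>. \<gamma> \<in> set rs \<Longrightarrow> fst \<gamma> < snd \<gamma> \<and> roots_above \<gamma> \<subseteq> set rs"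
  shows "subalgebra hull (x ` set rs) \<subseteq> cq.span (monomial x rs ` exponents rs)"
  using assms
proof (induction rs)
  case Nil
  have "\<exists>c. y = c *\<^sub>Q 1" if "y \<in> subalgebra hull {}" for y :: 'a
    using that
  proof (rule hull_induct)
    show "subalgebra {y :: 'a. \<exists>c. y = c *\<^sub>Q 1}"
      by (rule subalgebraI) (auto simp: scaleQ_mult_left simp flip: scaleQ_left_distrib intro: exI[of _ 1])
  qed simp
  moreover have "(\<lambda>_. 0) \<in> exponents ([] :: ('n \<times> 'n) list)"
    by (simp add: exponents_def)
  ultimately show ?case
    by (fastforce intro: cq.span_scale cq.span_base)
next
  case (Cons \<gamma> rs)
  have set: "set rs = roots_above \<gamma>"
  proof (intro equalityI subsetI)
    fix \<delta>
    assume "\<delta> \<in> set rs"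
    then show "\<delta> \<in> roots_above \<gamma>"
      using Cons.prems(1) Cons.prems(2)[of \<delta>] by (simp add: roots_above_def)
  next
    fix \<delta>
    assume "\<delta> \<in> roots_above \<gamma>"
    moreover from this have "\<delta> \<noteq> \<gamma>"
      by (auto simp: roots_above_def)
    ultimately show "\<delta> \<in> set rs"
      using Cons.prems(2)[of \<gamma>] by auto
  qed
  have up: "fst \<delta> < snd \<delta> \<and> roots_above \<delta> \<subseteq> set rs" if "\<delta> \<in> set rs" for \<delta>
    using that unfolding set by (auto simp: roots_above_def)
  have IH: "subalgebra hull (x ` set rs) \<subseteq> cq.span (monomial x rs ` exponents rs)"
    using Cons.prems(1) by (intro Cons.IH up) auto
  let ?M = "cq.span (monomial x (\<gamma> # rs) ` exponents (\<gamma> # rs))"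
  let ?G = "{u * x \<gamma> ^ k | u k. u \<in> subalgebra hull (x ` roots_above \<gamma>)}"
  have notin: "\<gamma> \<notin> set rs"
    by (simp add: set roots_above_def)
  have mono: "monomial x rs \<kappa> * x \<gamma> ^ k \<in> ?M" if \<kappa>: "\<kappa> \<in> exponents rs" for \<kappa> k
  proof (cases "par (fst \<gamma>) (snd \<gamma>) \<and> 2 \<le> k")
    case True
    then obtain m where "k = 2 + m"
      using le_Suc_ex by blast
    moreover have "x \<gamma> * x \<gamma> = 0"
      using True x unfolding straightening_def by (metis prod.collapse)
    ultimately show ?thesis
      by (simp add: power_add power2_eq_square cq.span_zero flip: mult.assoc)
  next
    case False
    have "monomial x (\<gamma> # rs) (\<kappa>(\<gamma> := k)) = monomial x rs \<kappa> * x \<gamma> ^ k"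
      using notin by (simp, intro arg_cong2[where f = "(*)"] refl monomial_cong) auto
    moreover have "\<kappa>(\<gamma> := k) \<in> exponents (\<gamma> # rs)"
      using \<kappa> False by (auto simp: exponents_def)
    ultimately show ?thesis
      by (metis cq.span_base imageI)
  qed
  have "?G \<subseteq> ?M"
  proof safe
    fix u k
    assume "u \<in> subalgebra hull (x ` roots_above \<gamma>)"
    then have "u \<in> cq.span (monomial x rs ` exponents rs)"
      using IH set by auto
    then show "u * x \<gamma> ^ k \<in> ?M"
    proof (induction rule: cq.span_induct_alt)
      case (step c g y)
      then show ?case
        using mono by (auto simp: distrib_right scaleQ_mult_left cq.span_add cq.span_scale)
    qed (simp add: cq.span_zero)
  qed
  then have "cq.span ?G \<subseteq> ?M"
    by (rule cq.span_minimal) (rule cq.subspace_span)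
  moreover have "subalgebra hull (x ` set (\<gamma> # rs)) \<subseteq> cq.span ?G"
  proof (rule hull_minimal)
    show "subalgebra (cq.span ?G)"
      by (rule subalgebra_span_powers)
    show "x ` set (\<gamma> # rs) \<subseteq> cq.span ?G"
    proof (rule image_subsetI)
      fix \<delta>
      assume \<delta>: "\<delta> \<in> set (\<gamma> # rs)"
      show "x \<delta> \<in> cq.span ?G"
      proof (cases "\<delta> = \<gamma>")
        case True
        have "1 * x \<gamma> ^ 1 \<in> ?G"
          using subalgebraD(1)[OF subalgebra_hull] by blast
        then show ?thesis
          using True by (simp add: cq.span_base)
      next
        case False
        then have "x \<delta> \<in> subalgebra hull (x ` roots_above \<gamma>)"
          using \<delta> by (intro hull_inc imageI) (simp add: set)
        then have "x \<delta> * x \<gamma> ^ 0 \<in> ?G"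
          by blast
        then show ?thesis
          by (simp add: cq.span_base)
      qed
    qed
  qed
  ultimately show ?case by blast
qed

end

section \<open>The weight decomposition\<close>

lemma root_add: "root i j + root j k = root i k"
  by (simp add: root_def)

lemma root_self [simp]: "root i i = 0"
  by (simp add: root_def)

lemma word_weight_plus: "word_weight (u + v) = word_weight u + word_weight v"
  by (simp add: word_weight_def plus_word_def)

lemma word_weight_zero: "word_weight 0 = 0"
  by (simp add: word_weight_def zero_word_def)

definition free_component :: "'n weight \<Rightarrow> 'n free set"
  where "free_component \<nu> = {x. \<forall>w\<in>Poly_Mapping.keys (Rep_free x). word_weight w = \<nu>}"

lemma free_component_closed:
  "(0 :: 'n::super_index free) \<in> free_component \<nu>"
  "x \<in> free_component \<nu> \<Longrightarrow> y \<in> free_component \<nu> \<Longrightarrow> x + y \<in> free_component \<nu>"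
  "x \<in> free_component \<nu> \<Longrightarrow> y \<in> free_component \<nu> \<Longrightarrow> x - y \<in> free_component \<nu>"
  "x \<in> free_component \<nu> \<Longrightarrow> c *\<^sub>Q x \<in> free_component \<nu>"
  "x \<in> free_component \<nu> \<Longrightarrow> hcomp s x \<in> free_component \<nu>"
  "x \<in> free_component \<mu> \<Longrightarrow> y \<in> free_component \<nu> \<Longrightarrow> x * y \<in> free_component (\<mu> + \<nu>)"
  "(1 :: 'n free) \<in> free_component 0"
  "free_gen g \<in> free_component (gen_weight g)"
  for x y :: "'n::super_index free"
proof -
  show "(0 :: 'n free) \<in> free_component \<nu>"
    by (simp add: free_component_def zero_free.rep_eq)
  show "x \<in> free_component \<nu> \<Longrightarrow> y \<in> free_component \<nu> \<Longrightarrow> x + y \<in> free_component \<nu>"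
    using Poly_Mapping.keys_add[of "Rep_free x" "Rep_free y"]
    by (auto simp: free_component_def plus_free.rep_eq)
  show "x \<in> free_component \<nu> \<Longrightarrow> y \<in> free_component \<nu> \<Longrightarrow> x - y \<in> free_component \<nu>"
    using keys_diff[of "Rep_free x" "Rep_free y"]
    by (auto simp: free_component_def minus_free.rep_eq)
  show "x \<in> free_component \<nu> \<Longrightarrow> c *\<^sub>Q x \<in> free_component \<nu>"
    by (simp add: free_component_def scaleQ_free.rep_eq in_keys_iff)
  show "x \<in> free_component \<nu> \<Longrightarrow> hcomp s x \<in> free_component \<nu>"
    by (auto simp: free_component_def hcomp_free.rep_eq in_keys_iff split: if_splits)
  show "x \<in> free_component \<mu> \<Longrightarrow> y \<in> free_component \<nu> \<Longrightarrow> x * y \<in> free_component (\<mu> + \<nu>)"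
  proof -
    assume x: "x \<in> free_component \<mu>" and y: "y \<in> free_component \<nu>"
    have "word_weight w = \<mu> + \<nu>" if w: "w \<in> Poly_Mapping.keys (Rep_free x * Rep_free y)" for w
    proof -
      obtain u v where "w = u + v" "u \<in> Poly_Mapping.keys (Rep_free x)" "v \<in> Poly_Mapping.keys (Rep_free y)"
        using w keys_mult[of "Rep_free x" "Rep_free y"] by blast
      with x y show ?thesis
        by (simp add: free_component_def word_weight_plus)
    qed
    then show ?thesis
      by (simp add: free_component_def times_free.rep_eq)
  qed
  show "(1 :: 'n free) \<in> free_component 0"
    by (simp add: free_component_def one_free.rep_eq word_weight_zero)
  show "free_gen g \<in> free_component (gen_weight g)"
    by (simp add: free_component_def free_gen.rep_eq word_weight_def)
qed

lemma free_component_sum: "(\<And>i. i \<in> A \<Longrightarrow> f i \<in> free_component \<nu>) \<Longrightarrow> (\<Sum>i\<in>A. f i) \<in> free_component \<nu>"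
  for f :: "'i \<Rightarrow> 'n::super_index free"
  by (induction A rule: infinite_finite_induct) (simp_all add: free_component_closed)

text \<open>Matrices over the free algebra that are homogeneous of weight \<open>0\<close> when \<open>E\<^sub>i\<^sub>j\<close> is given the weight
  \<open>\<epsilon>\<^sub>j - \<epsilon>\<^sub>i\<close>.\<close>

definition graded_mat2 :: "('n::super_index, 'n free) mat2 \<Rightarrow> bool"
  where "graded_mat2 X \<longleftrightarrow> (\<forall>i j k l. X i j k l \<in> free_component (root i j + root k l))"

lemma graded_mat2_mult:
  assumes "graded_mat2 X" "graded_mat2 Y"
  shows "graded_mat2 (X \<odot> Y)"
  unfolding graded_mat2_def mat2_mult_def
proof (intro allI free_component_sum free_component_closed(4))
  fix i j k l a c :: 'a and s
  have "X i a k c * hcomp s (Y a j c l) \<in>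
      free_component ((root i a + root k c) + (root a j + root c l))"
    using assms by (intro free_component_closed(5,6)) (simp_all add: graded_mat2_def)
  also have "(root i a + root k c) + (root a j + root c l) = root i j + root k l"
    by (simp add: root_def)
  finally show "X i a k c * hcomp s (Y a j c l) \<in> free_component (root i j + root k l)" .
qed

text \<open>The R-matrix has weight \<open>0\<close>: a nonzero entry at \<open>E\<^sub>i\<^sub>j \<otimes> E\<^sub>k\<^sub>l\<close> has \<open>{i, k} = {j, l}\<close> as multisets.\<close>

lemma rll_relators_graded: "r \<in> rll_relators \<Longrightarrow> \<exists>\<nu>. r \<in> free_component \<nu>"
proof (induction rule: rll_relators.induct)
  case (rll A B i j k l)
  have "A i j \<in> free_component (root i j)" "B i j \<in> free_component (root i j)" for i j
    using rll free_component_closed(8)[of "Lp i j"] free_component_closed(8)[of "Lm i j"] by auto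
  then have legs: "graded_mat2 (leg1 A)" "graded_mat2 (leg2 B)"
    by (auto simp: graded_mat2_def leg1_def leg2_def free_component_closed)
  have "graded_mat2 (mat2_const Rmat :: ('a, 'a free) mat2)"
    unfolding graded_mat2_def
  proof (intro allI)
    fix i j k l :: 'a
    have "Rmat i j k l = 0" if "root i j + root k l \<noteq> 0"
    proof (rule Rmat_other; rule notI)
      assume "i = j \<and> k = l"
      then have "i = j" "k = l" by blast+
      with that show False by simp
    next
      assume "i < j \<and> k = j \<and> l = i"
      then have "k = j" "l = i" by blast+
      with that show False by (simp add: root_add)
    qed
    then consider "root i j + root k l = 0" | "Rmat i j k l = 0"
      by blast
    then show "mat2_const Rmat i j k l \<in> free_component (root i j + root k l)"
      unfolding mat2_const_def
      by cases (simp_all only: free_component_closed(1,4,7) cq.scale_zero_left)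
  qed
  with legs have "graded_mat2 (mat2_const Rmat \<odot> leg1 A \<odot> leg2 B)"
      "graded_mat2 (leg2 B \<odot> leg1 A \<odot> mat2_const Rmat)"
    by (simp_all add: graded_mat2_mult)
  then show ?case
    unfolding graded_mat2_def by (blast intro: free_component_closed(3))
next
  case (inv_pm i)
  have "freeLp i i * freeLm i i \<in> free_component (gen_weight (Lp i i) + gen_weight (Lm i i))"
    by (intro free_component_closed)
  then have "freeLp i i * freeLm i i \<in> free_component 0"
    by simp
  then show ?case
    by (intro exI[of _ 0] free_component_closed(3,7))
next
  case (inv_mp i)
  have "freeLm i i * freeLp i i \<in> free_component (gen_weight (Lm i i) + gen_weight (Lp i i))"
    by (intro free_component_closed)
  then have "freeLm i i * freeLp i i \<in> free_component 0"
    by simp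
  then show ?case
    by (intro exI[of _ 0] free_component_closed(3,7))
qed (use free_component_closed(8) in blast)+

lift_definition free_proj :: "'n weight \<Rightarrow> 'n free \<Rightarrow> 'n free"
  is "\<lambda>\<nu>. pm_restrict (\<lambda>w. word_weight w = \<nu>)" .

lemma free_proj_linear:
  fixes x y :: "'n::super_index free"
  shows "free_proj \<nu> (x + y) = free_proj \<nu> x + free_proj \<nu> y" "free_proj \<nu> (c *\<^sub>Q x) = c *\<^sub>Q free_proj \<nu> x"
    "free_proj \<nu> (0 :: 'n free) = 0"
  by (transfer, simp add: pm_restrict_linear)+

lemma free_proj_diff:
  fixes x y :: "'n::super_index free"
  shows "free_proj \<nu> (x - y) = free_proj \<nu> x - free_proj \<nu> y"
  using free_proj_linear(1)[of \<nu> "x - y" y] by (simp add: algebra_simps)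

lemma free_proj_component: "x \<in> free_component \<mu> \<Longrightarrow> free_proj \<nu> x = (if \<nu> = \<mu> then x else 0)"
  for x :: "'n::super_index free"
proof -
  assume x: "x \<in> free_component \<mu>"
  have "Rep_free (free_proj \<nu> x) = Rep_free (if \<nu> = \<mu> then x else 0)"
  proof (rule poly_mapping_eqI)
    fix w
    show "Poly_Mapping.lookup (Rep_free (free_proj \<nu> x)) w
        = Poly_Mapping.lookup (Rep_free (if \<nu> = \<mu> then x else 0)) w"
      using x by (cases "Poly_Mapping.lookup (Rep_free x) w = 0")
        (simp_all add: free_proj.rep_eq zero_free.rep_eq free_component_def in_keys_iff)
  qed
  then show ?thesis
    by (simp only: Rep_free_inject)
qed

text \<open>Multiples of single words are homogeneous and add up to everything.\<close>

lemma free_monomial_induct [case_names zero add_monomial]: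
  fixes x :: "'n::super_index free"
  assumes "P 0" "\<And>m \<nu> x. m \<in> free_component \<nu> \<Longrightarrow> P x \<Longrightarrow> P (m + x)"
  shows "P x"
proof -
  have "P (Abs_free p)" for p :: "'n word \<Rightarrow>\<^sub>0 cq"
  proof (induction p rule: pm_induct)
    case zero
    have "Abs_free 0 = (0 :: 'n free)"
      by (simp add: zero_free.rep_eq Abs_free_inverse flip: Rep_free_inject)
    then show ?case
      using assms(1) by simp
  next
    case (add_single k c p)
    have "Abs_free (Poly_Mapping.single k c) \<in> free_component (word_weight k)"
      by (simp add: free_component_def Abs_free_inverse)
    moreover have "Abs_free (Poly_Mapping.single k c + p) = Abs_free (Poly_Mapping.single k c) + Abs_free p"
      by (simp add: plus_free.rep_eq Abs_free_inverse flip: Rep_free_inject)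
    ultimately show ?case
      using assms(2) add_single by (simp only:)
  qed
  from this[of "Rep_free x"] show ?thesis
    by (simp add: Rep_free_inverse)
qed

text \<open>The relators are homogeneous, so the ideal contains the weight components of its elements and the
  projections descend to \<open>U(R)\<close>.\<close>

lemma rll_ideal_proj: "x \<in> rll_ideal \<Longrightarrow> free_proj \<nu> x \<in> rll_ideal"
proof (induction rule: rll_ideal.induct)
  case (relator r a b)
  obtain \<rho> where r: "r \<in> free_component \<rho>"
    using rll_relators_graded[OF relator] by blast
  have *: "free_proj \<nu> (m * r * b) \<in> rll_ideal" if m: "m \<in> free_component \<mu>" for m \<mu>
  proof (induction b rule: free_monomial_induct)
    case (add_monomial m' \<mu>' b)
    have "m * r * m' \<in> free_component (\<mu> + \<rho> + \<mu>')"
      by (intro free_component_closed m r add_monomial)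
    then have "free_proj \<nu> (m * r * m') \<in> rll_ideal"
      using rll_ideal.relator[OF relator, of m m'] by (auto simp: free_proj_component rll_ideal.zero)
    then show ?case
      using add_monomial by (simp add: distrib_left free_proj_linear rll_ideal.add)
  qed (simp add: free_proj_linear rll_ideal.zero)
  show ?case
    by (induction a rule: free_monomial_induct)
      (simp_all add: distrib_right free_proj_linear rll_ideal.zero rll_ideal.add *)
qed (simp_all add: free_proj_linear rll_ideal.zero rll_ideal.add)

lift_definition weight_proj :: "'n weight \<Rightarrow> 'n::super_index rll \<Rightarrow> 'n rll" is free_proj
  unfolding rll_eq_def by (simp add: rll_ideal_proj flip: free_proj_diff)

lemma rll_component_eq: "rll_component \<nu> = abs_rll ` free_component \<nu>"
  by (simp add: rll_component_def free_component_def)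

lemma weight_proj_linear:
  "weight_proj \<nu> (x + y) = weight_proj \<nu> x + weight_proj \<nu> y" "weight_proj \<nu> (c *\<^sub>Q x) = c *\<^sub>Q weight_proj \<nu> x"
  "weight_proj \<nu> 0 = 0"
  by (transfer, rule rll_eq_refl, rule free_proj_linear)+

lemma weight_proj_component: "x \<in> rll_component \<mu> \<Longrightarrow> weight_proj \<nu> x = (if \<nu> = \<mu> then x else 0)"
  by (auto simp: rll_component_eq weight_proj.abs_eq free_proj_component zero_rll.abs_eq)

lemma rll_component_closed:
  "(0 :: 'n::super_index rll) \<in> rll_component \<nu>"
  "x \<in> rll_component \<mu> \<Longrightarrow> y \<in> rll_component \<nu> \<Longrightarrow> x * y \<in> rll_component (\<mu> + \<nu>)"
  "x \<in> rll_component \<nu> \<Longrightarrow> c *\<^sub>Q x \<in> rll_component \<nu>"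
  "(1 :: 'n rll) \<in> rll_component 0"
  "lp i j \<in> rll_component (root i j)" "lm i j \<in> rll_component (root i j)"
  for x y :: "'n::super_index rll"
proof -
  show "x \<in> rll_component \<mu> \<Longrightarrow> y \<in> rll_component \<nu> \<Longrightarrow> x * y \<in> rll_component (\<mu> + \<nu>)"
    unfolding rll_component_eq by (auto simp: times_rll.abs_eq intro!: imageI free_component_closed)
  show "x \<in> rll_component \<nu> \<Longrightarrow> c *\<^sub>Q x \<in> rll_component \<nu>"
    unfolding rll_component_eq by (auto simp: scaleQ_rll.abs_eq intro!: imageI free_component_closed)
  show "(1 :: 'n rll) \<in> rll_component 0" "(0 :: 'n::super_index rll) \<in> rll_component \<nu>"
    unfolding rll_component_eq one_rll.abs_eq zero_rll.abs_eq by (intro imageI free_component_closed)+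
  show "lp i j \<in> rll_component (root i j)" "lm i j \<in> rll_component (root i j)"
    using free_component_closed(8)[of "Lp i j"] free_component_closed(8)[of "Lm i j"]
    by (auto simp: rll_component_eq lp.abs_eq lm.abs_eq)
qed

section \<open>Contraction of the coproduct\<close>

lemma hcomp_times:
  "hcomp s (x * y) = hcomp False x * hcomp s y + hcomp True x * hcomp (\<not> s) y"
proof -
  have *: "hcomp s (hcomp a x * hcomp b y) = (if s = (a \<noteq> b) then hcomp a x * hcomp b y else 0)" for a b
    by (rule hcomp_homogeneous, rule hcomp_mult)
  have "x * y = (hcomp False x + hcomp True x) * (hcomp False y + hcomp True y)"
    by (simp only: hcomp_sum)
  then have "hcomp s (x * y) = hcomp s (hcomp False x * hcomp False y) + hcomp s (hcomp False x * hcomp True y)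
      + (hcomp s (hcomp True x * hcomp False y) + hcomp s (hcomp True x * hcomp True y))"
    by (simp only: distrib_left distrib_right hcomp_add add_ac)
  then show ?thesis
    unfolding * by (cases s) simp_all
qed

lemma hull_hcomp:
  assumes "\<And>g. g \<in> G \<Longrightarrow> \<exists>s. homogeneous s g" and "x \<in> subalgebra hull G"
  shows "hcomp s x \<in> subalgebra hull G"
proof -
  note A = subalgebraD[OF subalgebra_hull[of G]]
  let ?P = "\<lambda>x. \<forall>s. hcomp s x \<in> subalgebra hull G"
  from assms(2) have "?P x"
  proof (rule hull_induct[where P = ?P])
    fix g
    assume "g \<in> G"
    then obtain t where "homogeneous t g" "g \<in> subalgebra hull G"
      using assms(1) by (metis hull_inc)
    then show "?P g"
      using hcomp_homogeneous[of t g] A(5) by simp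
  next
    show "subalgebra {x. ?P x}"
    proof (rule subalgebraI)
      have "hcomp s (1 :: 'a) = (if s = False then 1 else 0)" for s
        by (rule hcomp_homogeneous, rule hcomp_one)
      then show "1 \<in> {x. ?P x}"
        using A(1,5) by simp
    qed (auto simp: hcomp_add hcomp_scaleQ hcomp_times intro: A)
  qed
  then show ?thesis by blast
qed

text \<open>For odd \<open>\<beta>\<close> this is the parity automorphism: the sign from moving an element of parity \<open>\<beta>\<close> past \<open>x\<close>.\<close>

definition twist :: "bool \<Rightarrow> 'a::cq_superalgebra \<Rightarrow> 'a"
  where "twist \<beta> x = hcomp False x + sign \<beta> *\<^sub>Q hcomp True x"

lemma twist_linear:
  "twist \<beta> (x + y) = twist \<beta> x + twist \<beta> y" "twist \<beta> (c *\<^sub>Q x) = c *\<^sub>Q twist \<beta> x" "twist \<beta> 0 = 0"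
  by (simp add: twist_def hcomp_add hcomp_scaleQ scaleQ_right_distrib)
    (simp add: twist_def hcomp_add hcomp_scaleQ scaleQ_right_distrib mult.commute, simp add: twist_def)

lemma twist_False [simp]: "twist False x = x"
  by (simp add: twist_def hcomp_sum)

lemma twist_homogeneous:
  assumes "homogeneous s x"
  shows "twist \<beta> x = sign (\<beta> \<and> s) *\<^sub>Q x"
proof (cases s)
  case True
  then show ?thesis
    using assms hcomp_other_parity(1)[of x] by (simp add: twist_def)
next
  case False
  then show ?thesis
    using assms hcomp_other_parity(2)[of x] by (simp add: twist_def)
qed

text \<open>The functional \<open>b \<mapsto> (a, b)\<close> is only given on \<open>U\<^sup>\<ge>\<close>.  Extending it to all of \<open>U(R)\<close> makes the
  contraction of a tensor a genuine linear map, and the choice of the extension does not affect tensors in \<open>U\<^sup>\<ge> \<otimes> U\<^sup>\<ge>\<close>.\<close>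

lemma extend_functional:
  fixes f :: "'a::cq_space \<Rightarrow> cq"
  assumes C: "cq.subspace C"
    and f: "\<And>x y. x \<in> C \<Longrightarrow> y \<in> C \<Longrightarrow> f (x + y) = f x + f y" "\<And>c x. x \<in> C \<Longrightarrow> f (c *\<^sub>Q x) = c * f x"
  shows "\<exists>g. (\<forall>x y. g (x + y) = g x + g y) \<and> (\<forall>c x. g (c *\<^sub>Q x) = c * g x) \<and> (\<forall>x\<in>C. g x = f x)"
proof -
  have "vector_space ((*) :: cq \<Rightarrow> cq \<Rightarrow> cq)"
    by (rule vector_space.intro) (rule distrib_left distrib_right mult.assoc[symmetric] mult_1)+
  with cq.vector_space_axioms have pair: "vector_space_pair (scaleQ :: cq \<Rightarrow> 'a \<Rightarrow> 'a) ((*) :: cq \<Rightarrow> cq \<Rightarrow> cq)"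
    by (rule vector_space_pair.intro)
  obtain S where S: "S \<subseteq> C" "cq.independent S" "C \<subseteq> cq.span S"
    by (rule cq.basis_exists)
  obtain g where g: "Vector_Spaces.linear scaleQ (*) g" "\<forall>x\<in>S. g x = f x"
    using vector_space_pair.linear_independent_extend[OF pair S(2), of f] by blast
  have lin: "g (x + y) = g x + g y" "g (c *\<^sub>Q x) = c * g x" for x y c
    by (rule vector_space_pair.linear_add[OF pair g(1)], rule vector_space_pair.linear_scale[OF pair g(1)])
  have f0: "f 0 = 0"
    using f(2)[OF cq.subspace_0[OF C], of 0] by simp
  have "x \<in> C \<and> g x = f x" if "x \<in> cq.span S" for x
    using that
  proof (induction rule: cq.span_induct_alt)
    case base
    then show ?case
      using lin(2)[of 0 0] f0 by (simp add: cq.subspace_0[OF C])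
  next
    case (step c x y)
    then have "x \<in> C" "y \<in> C" "g x = f x" "g y = f y"
      using S(1) g(2) by auto
    then show ?case
      by (simp add: lin f cq.subspace_add[OF C] cq.subspace_scale[OF C])
  qed
  then show ?thesis
    using lin S(3) by blast
qed

text \<open>The image of \<open>C \<otimes> C\<close>.  Homogeneous generators suffice when \<open>C\<close> is graded and are what sign
  computations need.\<close>

definition tensor_square :: "'a::cq_superalgebra set \<Rightarrow> ('a, 'a) tensor set"
  where "tensor_square C = cq.span {x \<otimes> y | x y. x \<in> C \<and> y \<in> C \<and> (\<exists>s. homogeneous s x) \<and> (\<exists>t. homogeneous t y)}"

lemma tensor_square_induct [consumes 1, case_names zero step]:
  assumes "t \<in> tensor_square C" "P 0"
    and "\<And>c x y r s u. x \<in> C \<Longrightarrow> y \<in> C \<Longrightarrow> homogeneous r x \<Longrightarrow> homogeneous s y \<Longrightarrow> u \<in> tensor_square C \<Longrightarrow> P u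
      \<Longrightarrow> P (c *\<^sub>Q (x \<otimes> y) + u)"
  shows "P t"
proof -
  from assms(1) have "P t \<and> t \<in> tensor_square C"
    unfolding tensor_square_def
  proof (induction rule: cq.span_induct_alt)
    case (step c g u)
    then show ?case
      using assms(3) unfolding tensor_square_def by (blast intro: cq.span_add cq.span_scale cq.span_base)
  qed (simp add: assms(2) cq.span_zero)
  then show ?thesis ..
qed

lemma tensor_square_subspace: "cq.subspace (tensor_square C)"
  by (simp add: tensor_square_def cq.subspace_span)

context
  fixes C :: "'a::cq_superalgebra set"
  assumes sub: "subalgebra C" and hom: "\<And>s x. x \<in> C \<Longrightarrow> hcomp s x \<in> C"
begin

lemma tens_in_tensor_square:
  assumes "x \<in> C" "y \<in> C"
  shows "x \<otimes> y \<in> tensor_square C"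
proof -
  have "hcomp s x \<otimes> hcomp t y \<in> tensor_square C" for s t
    unfolding tensor_square_def using assms hom homogeneous_hcomp by (intro cq.span_base) blast
  then show ?thesis
    unfolding tens_decompose[of x y] by (intro cq.subspace_sum tensor_square_subspace)
qed

lemma tensor_square_subalgebra: "subalgebra (tensor_square C)"
proof (rule subalgebraI)
  show "1 \<in> tensor_square C"
    unfolding one_tensor_def by (intro tens_in_tensor_square subalgebraD[OF sub])
  fix t u
  assume t: "t \<in> tensor_square C" and u: "u \<in> tensor_square C"
  have pure: "(x \<otimes> y) * (x' \<otimes> y') \<in> tensor_square C"
    if "x \<in> C" "y \<in> C" "x' \<in> C" "y' \<in> C" for x y x' y'
    unfolding tensor_mult_tens tensor_mult_tens_def
    by (intro cq.subspace_sum cq.subspace_scale tensor_square_subspace tens_in_tensor_square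
        subalgebraD[OF sub] hom that)
  have left: "(x \<otimes> y) * u \<in> tensor_square C" if xy: "x \<in> C" "y \<in> C" for x y
    using u
  proof (induction rule: tensor_square_induct)
    case (step c x' y' r s u)
    show ?case
      unfolding distrib_left scaleQ_mult_right
      by (intro cq.subspace_add cq.subspace_scale tensor_square_subspace pure xy step)
  qed (simp add: cq.subspace_0 tensor_square_subspace)
  show "t * u \<in> tensor_square C"
    using t
  proof (induction rule: tensor_square_induct)
    case (step c x y r s t)
    show ?case
      unfolding distrib_right scaleQ_mult_left
      by (intro cq.subspace_add cq.subspace_scale tensor_square_subspace left step)
  qed (simp add: cq.subspace_0 tensor_square_subspace)
next
  fix t u c
  assume "t \<in> tensor_square C" "u \<in> tensor_square C"
  then show "t + u \<in> tensor_square C"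
    by (rule cq.subspace_add[OF tensor_square_subspace])
next
  fix t c
  assume "t \<in> tensor_square C"
  then show "c *\<^sub>Q t \<in> tensor_square C"
    by (rule cq.subspace_scale[OF tensor_square_subspace])
qed

lemma tensor_square_presentation:
  assumes "t \<in> tensor_square C"
  obtains ys where "set ys \<subseteq> C \<times> C" "t = tensor_sum ys"
proof -
  from assms have "\<exists>ys. set ys \<subseteq> C \<times> C \<and> t = tensor_sum ys"
  proof (induction rule: tensor_square_induct)
    case zero
    show ?case by (rule exI[of _ "[]"]) (simp add: tensor_sum_def)
  next
    case (step c x y r s u)
    then obtain ys where "set ys \<subseteq> C \<times> C" "u = tensor_sum ys" by blast
    with step show ?case
      by (intro exI[of _ "(c *\<^sub>Q x, y) # ys"]) (simp add: tensor_sum_def tens_scale_left subalgebraD[OF sub])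
  qed
  then show ?thesis using that by blast
qed

end

lemma rll_coproduct_lm_diag: "rll_coproduct (lm k k) = lm k k \<otimes> lm k k"
  and rll_coproduct_lp_diag: "rll_coproduct (lp k k) = lp k k \<otimes> lp k k"
proof -
  have eq: "(\<Sum>p\<in>UNIV. sign (par k p \<and> par p k) *\<^sub>Q (L k p \<otimes> L p k)) = L k k \<otimes> L k k"
    if "\<And>p. p \<noteq> k \<Longrightarrow> L k p \<otimes> L p k = 0" for L :: "'n::super_index \<Rightarrow> 'n \<Rightarrow> 'n rll" and k
  proof -
    have "(\<Sum>p\<in>UNIV. sign (par k p \<and> par p k) *\<^sub>Q (L k p \<otimes> L p k))
        = (\<Sum>p\<in>{k}. sign (par k p \<and> par p k) *\<^sub>Q (L k p \<otimes> L p k))"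
      by (rule sum.mono_neutral_right) (use that in auto)
    then show ?thesis by simp
  qed
  show "rll_coproduct (lm k k) = lm k k \<otimes> lm k k"
    unfolding rll_coproduct_gen by (rule eq) (erule neqE; simp add: rll_generators)
  show "rll_coproduct (lp k k) = lp k k \<otimes> lp k k"
    unfolding rll_coproduct_gen by (rule eq) (erule neqE; simp add: rll_generators)
qed

lemma U_ge_le_subalgebra: "subalgebra U_ge" "subalgebra U_le"
  by (simp_all only: U_ge_def U_le_def subalgebra_hull)

lemma U_ge_gens: "lp i j \<in> U_ge" "lm k k \<in> U_ge" and U_le_gens: "lm i j \<in> U_le" "lp k k \<in> U_le"
  unfolding U_ge_def U_le_def by (rule hull_inc, blast)+

lemma homogeneous_gens: "homogeneous (par i j) (lp i j)" "homogeneous (par i j) (lm i j)"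
  using even_rll unfolding even_mat_def by blast+

lemma U_ge_hcomp: "x \<in> U_ge \<Longrightarrow> hcomp s x \<in> U_ge"
  unfolding U_ge_def by (erule hull_hcomp[rotated]) (use homogeneous_gens in blast)

lemma coproduct_U_ge:
  assumes "x \<in> U_ge"
  shows "rll_coproduct x \<in> tensor_square (U_ge :: 'n::super_index rll set)"
proof -
  note T = subalgebraD[OF tensor_square_subalgebra[OF U_ge_le_subalgebra(1) U_ge_hcomp]]
  note tens = tens_in_tensor_square[OF U_ge_le_subalgebra(1) U_ge_hcomp]
  let ?P = "\<lambda>x. rll_coproduct x \<in> tensor_square (U_ge :: 'n rll set)"
  from assms[unfolded U_ge_def] have "?P x"
  proof (rule hull_induct[where P = ?P])
    show "subalgebra {x. ?P x}"
      by (rule subalgebraI) (simp_all add: rll_coproduct_hom T)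
    fix x :: "'n rll"
    assume "x \<in> {lp i j | i j. True} \<union> {lm k k | k. True}"
    then show "?P x"
    proof (elim UnE CollectE exE conjE)
      fix i j
      assume "x = lp i j"
      then show "?P x"
        unfolding rll_coproduct_gen
        by (simp only: rll_coproduct_gen) (intro cq.subspace_sum cq.subspace_scale tensor_square_subspace tens U_ge_gens)
    next
      fix k
      assume "x = lm k k"
      then show "?P x"
        by (simp only: rll_coproduct_lm_diag tens U_ge_gens)
    qed
  qed
  then show ?thesis .
qed

section \<open>Adjoints of right multiplication\<close>

lemma bilinear_flip:
  "bilinearQ (\<lambda>a b. \<Sum>s\<in>UNIV. \<Sum>t\<in>UNIV. sign (s \<and> t) *\<^sub>Q (hcomp t b \<otimes> hcomp s a))"
  by (simp add: bilinearQ_def hcomp_add hcomp_scaleQ tens_add_left tens_add_right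
      tens_scale_left tens_scale_right scaleQ_right_distrib sum.distrib cq.scale_sum_right mult.commute)

lemma tensor_flip_linear:
  "tensor_flip (x + y) = tensor_flip x + tensor_flip y" "tensor_flip (c *\<^sub>Q x) = c *\<^sub>Q tensor_flip x"
  "tensor_flip 0 = 0"
  unfolding tensor_flip_def
  by (rule tensor_lift_add[OF bilinear_flip] tensor_lift_scale[OF bilinear_flip]
      tensor_lift_zero[OF bilinear_flip])+

lemma tensor_flip_sum: "tensor_flip (\<Sum>i\<in>A. f i) = (\<Sum>i\<in>A. tensor_flip (f i))"
  by (induction A rule: infinite_finite_induct) (simp_all add: tensor_flip_linear)

lemma tensor_flip_homogeneous:
  assumes "homogeneous s a" "homogeneous t b"
  shows "tensor_flip (a \<otimes> b) = sign (s \<and> t) *\<^sub>Q (b \<otimes> a)"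
  unfolding tensor_flip_def tensor_lift_tens[OF bilinear_flip]
  using assms by (cases s; cases t) (simp_all add: UNIV_bool hcomp_other_parity)

lemma sum_bool: "(\<Sum>s\<in>UNIV. f s) = f False + f True"
  by (simp add: UNIV_bool)

lemma sum_bool_sign:
  "(\<Sum>s\<in>UNIV. \<Sum>t\<in>UNIV. sign (s \<and> t) * (p t * (if s = \<alpha> then c else 0)))
    = c * (p False + sign \<alpha> * p True)"
  unfolding sum_bool
  by (cases \<alpha>) (simp_all only: simp_thms if_True if_False mult_zero_right add_0_left add_0_right
      sign_simps(1) mult_1_left mult_zero_left distrib_left ac_simps)

definition functional :: "('n::super_index rll \<Rightarrow> 'n rll \<Rightarrow> cq) \<Rightarrow> 'n rll \<Rightarrow> 'n rll \<Rightarrow> cq"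
  where "functional B a = (SOME g. (\<forall>x y. g (x + y) = g x + g y) \<and> (\<forall>c x. g (c *\<^sub>Q x) = c * g x) \<and>
    (\<forall>x\<in>U_ge. g x = B a x))"

text \<open>The map \<open>x \<otimes> y \<mapsto> \<plusminus> (a, y) x\<close>, where \<open>\<alpha>\<close> is the parity of \<open>a\<close> and the sign comes from moving \<open>a\<close> past \<open>x\<close>.\<close>

definition contract ::
    "('n::super_index rll \<Rightarrow> 'n rll \<Rightarrow> cq) \<Rightarrow> bool \<Rightarrow> 'n rll \<Rightarrow> ('n rll, 'n rll) tensor \<Rightarrow> 'n rll"
  where "contract B \<alpha> a = tensor_lift (\<lambda>x y. functional B a y *\<^sub>Q twist \<alpha> x)"

definition deriv :: "('n::super_index rll \<Rightarrow> 'n rll \<Rightarrow> cq) \<Rightarrow> bool \<Rightarrow> 'n rll \<Rightarrow> 'n rll \<Rightarrow> 'n rll"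
  where "deriv B \<alpha> a x = contract B \<alpha> a (rll_coproduct x)"

locale rll_paired =
  fixes B :: "'n::super_index rll \<Rightarrow> 'n rll \<Rightarrow> cq"
  assumes pairing: "rll_pairing B"
begin

lemmas skew = pairing[unfolded rll_pairing_def skew_pairing_def, THEN conjunct1]

lemma B_add_left: "\<lbrakk>a \<in> U_le; a' \<in> U_le; b \<in> U_ge\<rbrakk> \<Longrightarrow> B (a + a') b = B a b + B a' b"
  using skew[THEN conjunct1] by blast

lemma B_add_right: "\<lbrakk>a \<in> U_le; b \<in> U_ge; b' \<in> U_ge\<rbrakk> \<Longrightarrow> B a (b + b') = B a b + B a b'"
  using skew[THEN conjunct2, THEN conjunct1] by blast

lemma B_scale_left: "\<lbrakk>a \<in> U_le; b \<in> U_ge\<rbrakk> \<Longrightarrow> B (c *\<^sub>Q a) b = c * B a b"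
  using skew[THEN conjunct2, THEN conjunct2, THEN conjunct1] by blast

lemma B_scale_right: "\<lbrakk>a \<in> U_le; b \<in> U_ge\<rbrakk> \<Longrightarrow> B a (c *\<^sub>Q b) = c * B a b"
  using skew[THEN conjunct2, THEN conjunct2, THEN conjunct1] by blast

lemma B_parity: "\<lbrakk>a \<in> U_le; b \<in> U_ge; homogeneous s a; homogeneous t b; s \<noteq> t\<rbrakk> \<Longrightarrow> B a b = 0"
  using skew[THEN conjunct2, THEN conjunct2, THEN conjunct2, THEN conjunct1] by blast

lemma B_one_left: "b \<in> U_ge \<Longrightarrow> B 1 b = rll_counit b"
  using skew[THEN conjunct2, THEN conjunct2, THEN conjunct2, THEN conjunct2, THEN conjunct1] by blast

lemma B_one_right: "a \<in> U_le \<Longrightarrow> B a 1 = rll_counit a"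
  using skew[THEN conjunct2, THEN conjunct2, THEN conjunct2, THEN conjunct2, THEN conjunct2, THEN conjunct1] by blast

lemma B_mult_left: "\<lbrakk>a \<in> U_le; a' \<in> U_le; b \<in> U_ge; set ys \<subseteq> U_ge \<times> U_ge; rll_coproduct b = tensor_sum ys\<rbrakk>
    \<Longrightarrow> B (a * a') b = pair_sums B [(a, a')] ys"
  using skew[THEN conjunct2, THEN conjunct2, THEN conjunct2, THEN conjunct2, THEN conjunct2, THEN conjunct2, THEN conjunct1] by blast

lemma B_mult_right: "\<lbrakk>a \<in> U_le; b \<in> U_ge; b' \<in> U_ge; set xs \<subseteq> U_le \<times> U_le;
      tensor_flip (rll_coproduct a) = tensor_sum xs\<rbrakk> \<Longrightarrow> B a (b * b') = pair_sums B xs [(b, b')]"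
  using skew[THEN conjunct2, THEN conjunct2, THEN conjunct2, THEN conjunct2, THEN conjunct2, THEN conjunct2, THEN conjunct2] by blast

lemmas ge_closed = subalgebraD[OF U_ge_le_subalgebra(1)]
lemmas le_closed = subalgebraD[OF U_ge_le_subalgebra(2)]

lemma B_zero: "b \<in> U_ge \<Longrightarrow> B 0 b = 0" "a \<in> U_le \<Longrightarrow> B a 0 = 0"
  using B_scale_left[of 0 b 0] B_scale_right[of a 0 0] by (simp_all add: ge_closed le_closed)

lemma B_lm_lp: "B (lm a b) (lp k l) = Rmat_inv k l a b"
proof -
  have "sign (par a b \<and> par k l) * B (lm a b) (lp k l) = sign (par a b \<and> par k l) * Rmat_inv k l a b"
    using pairing by (simp only: rll_pairing_def mat2_flip_def)
  then show ?thesis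
    by (simp only: mult_cancel_left sign_nonzero simp_thms)
qed

lemma functional:
  assumes "a \<in> U_le"
  shows "functional B a (x + y) = functional B a x + functional B a y"
    "functional B a (c *\<^sub>Q x) = c * functional B a x" "x \<in> U_ge \<Longrightarrow> functional B a x = B a x"
proof -
  have "\<exists>g. (\<forall>x y. g (x + y) = g x + g y) \<and> (\<forall>c x. g (c *\<^sub>Q x) = c * g x) \<and> (\<forall>x\<in>U_ge. g x = B a x)"
    by (rule extend_functional[OF subalgebra_subspace[OF U_ge_le_subalgebra(1)]])
      (simp_all only: B_add_right B_scale_right assms)
  from someI_ex[OF this] show "functional B a (x + y) = functional B a x + functional B a y"
    "functional B a (c *\<^sub>Q x) = c * functional B a x" "x \<in> U_ge \<Longrightarrow> functional B a x = B a x"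
    unfolding functional_def by blast+
qed

context
  fixes a :: "'n rll"
  assumes a: "a \<in> U_le"
begin

lemma bilinear_contract: "bilinearQ (\<lambda>x y. functional B a y *\<^sub>Q twist \<alpha> x)"
  by (simp add: bilinearQ_def functional[OF a] twist_linear scaleQ_right_distrib scaleQ_left_distrib mult.commute)

lemma contract_linear:
  "contract B \<alpha> a (t + u) = contract B \<alpha> a t + contract B \<alpha> a u" "contract B \<alpha> a (c *\<^sub>Q t) = c *\<^sub>Q contract B \<alpha> a t"
  "contract B \<alpha> a 0 = 0"
  unfolding contract_def
  by (rule tensor_lift_add[OF bilinear_contract] tensor_lift_scale[OF bilinear_contract]
      tensor_lift_zero[OF bilinear_contract])+

lemma contract_tens: "y \<in> U_ge \<Longrightarrow> contract B \<alpha> a (x \<otimes> y) = B a y *\<^sub>Q twist \<alpha> x"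
  by (simp add: contract_def tensor_lift_tens[OF bilinear_contract] functional(3)[OF a])

lemma twist_U_ge: "x \<in> U_ge \<Longrightarrow> twist \<alpha> x \<in> U_ge"
  unfolding twist_def by (intro ge_closed U_ge_hcomp)

lemma contract_U_ge: "t \<in> tensor_square U_ge \<Longrightarrow> contract B \<alpha> a t \<in> U_ge"
  by (induction rule: tensor_square_induct)
    (simp_all add: contract_linear contract_tens ge_closed twist_U_ge)

lemma deriv_linear:
  "deriv B \<alpha> a (x + y) = deriv B \<alpha> a x + deriv B \<alpha> a y" "deriv B \<alpha> a (c *\<^sub>Q x) = c *\<^sub>Q deriv B \<alpha> a x"
  by (simp_all add: deriv_def rll_coproduct_hom contract_linear)

lemma deriv_zero: "deriv B \<alpha> a 0 = 0"
  using deriv_linear(2)[of \<alpha> 0 0] by simp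

lemma deriv_U_ge: "x \<in> U_ge \<Longrightarrow> deriv B \<alpha> a x \<in> U_ge"
  by (simp add: deriv_def contract_U_ge coproduct_U_ge)

lemma deriv_one: "deriv B \<alpha> a 1 = rll_counit a *\<^sub>Q 1"
  using twist_homogeneous[OF hcomp_one, of \<alpha>, where ?'a = "'n rll"]
  by (simp add: deriv_def rll_coproduct_hom one_tensor_def contract_tens B_one_right[OF a] ge_closed)

text \<open>This is the axiom for \<open>(F a, x)\<close>, read as the adjointness of \<open>deriv\<close> to right multiplication
  by \<open>a\<close>.\<close>

lemma pairing_deriv:
  assumes hom: "homogeneous \<alpha> a" and x: "x \<in> U_ge" and F: "F \<in> U_le"
  shows "B (F * a) x = B F (deriv B \<alpha> a x)"
proof -
  obtain ys where ys: "set ys \<subseteq> U_ge \<times> U_ge" "rll_coproduct x = tensor_sum ys"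
    by (rule tensor_square_presentation[OF U_ge_le_subalgebra(1) U_ge_hcomp coproduct_U_ge[OF x]])
  have "B F (contract B \<alpha> a (tensor_sum ys)) = pair_sums B [(F, a)] ys \<and> contract B \<alpha> a (tensor_sum ys) \<in> U_ge"
    using ys(1)
  proof (induction ys)
    case Nil
    show ?case
      by (simp add: tensor_sum_def pair_sums_def contract_linear B_zero F ge_closed)
  next
    case (Cons p ys)
    obtain y z where p: "p = (y, z)" by fastforce
    then have yz: "y \<in> U_ge" "z \<in> U_ge" using Cons.prems by auto
    have hy: "hcomp s y \<in> U_ge" for s by (rule U_ge_hcomp[OF yz(1)])
    have "(\<Sum>s\<in>UNIV. \<Sum>t\<in>UNIV. sign (s \<and> t) * (B F (hcomp t y) * B (hcomp s a) z))
        = B a z * B F (twist \<alpha> y)"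
    proof -
      have "B F (twist \<alpha> y) = B F (hcomp False y) + sign \<alpha> * B F (hcomp True y)"
        unfolding twist_def by (simp add: B_add_right B_scale_right F hy ge_closed)
      moreover have "B (hcomp s a) z = (if s = \<alpha> then B a z else 0)" for s
        using hcomp_homogeneous[OF hom, of s] B_zero(1)[OF yz(2)] by (cases "s = \<alpha>") (simp_all only: if_True if_False simp_thms)
      ultimately show ?thesis
        by (simp only: sum_bool_sign)
    qed
    moreover have "contract B \<alpha> a (tensor_sum (p # ys)) = B a z *\<^sub>Q twist \<alpha> y + contract B \<alpha> a (tensor_sum ys)"
      by (simp add: p tensor_sum_def contract_linear contract_tens yz)
    ultimately show ?case
      using Cons by (simp add: p pair_sums_def B_add_right B_scale_right F ge_closed twist_U_ge yz)
  qed
  then show ?thesis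
    using B_mult_left[OF F a x ys] ys(2) by (simp add: deriv_def)
qed

end

end

lemma Rmat_inv_entries:
  shows Rmat_inv_diag: "Rmat_inv i i k k = qq powi eps_form i k"
    and Rmat_inv_swap: "i < k \<Longrightarrow> Rmat_inv i k k i = qdiff * sign (odd_index k)"
    and Rmat_inv_other: "\<lbrakk>\<not> (i = j \<and> k = l); \<not> (i < j \<and> k = j \<and> l = i)\<rbrakk> \<Longrightarrow> Rmat_inv i j k l = 0"
proof -
  show "Rmat_inv i i k k = qq powi eps_form i k"
    by (simp only: Rmat_inv_def order.irrefl simp_thms if_True if_False mult_zero_right add_0_right)
  show "Rmat_inv i j k l = 0" if "\<not> (i = j \<and> k = l)" "\<not> (i < j \<and> k = j \<and> l = i)"
    by (simp only: Rmat_inv_def that if_False mult_zero_right add_0_right)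
  assume "i < k"
  then have "i \<noteq> k" by (rule less_imp_neq)
  with \<open>i < k\<close> show "Rmat_inv i k k i = qdiff * sign (odd_index k)"
    by (simp only: Rmat_inv_def simp_thms if_True if_False add_0_left qdiff_def)
qed

context rll_paired
begin

text \<open>The pairing preserves parity, so only the component of \<open>y\<close> of the parity of \<open>a\<close> counts.\<close>

lemma B_hcomp:
  assumes "a \<in> U_le" "homogeneous \<alpha> a" "y \<in> U_ge"
  shows "B a (hcomp t y) = (if t = \<alpha> then B a y else 0)"
proof (cases "t = \<alpha>")
  case False
  have "B a (hcomp t y) = 0"
    by (rule B_parity[OF assms(1) U_ge_hcomp[OF assms(3)] assms(2) homogeneous_hcomp]) (use False in simp)
  with False show ?thesis by simp
next
  case True
  have 0: "B a (hcomp (\<not> \<alpha>) y) = 0"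
    by (rule B_parity[OF assms(1) U_ge_hcomp[OF assms(3)] assms(2) homogeneous_hcomp]) simp
  have "B a y = B a (hcomp False y + hcomp True y)"
    by (simp only: hcomp_sum)
  also have "\<dots> = B a (hcomp False y) + B a (hcomp True y)"
    by (intro B_add_right assms U_ge_hcomp)
  finally show ?thesis
    using 0 True by (cases \<alpha>) simp_all
qed

lemma sum_bool_point:
  "c * ((if False = \<alpha> then b else 0) + sign \<beta> * (if True = \<alpha> then b else 0)) = sign (\<alpha> \<and> \<beta>) * (b * (c :: cq))"
  by (cases \<alpha>) (simp_all only: simp_thms if_True if_False mult_zero_right mult_zero_left add_0_left add_0_right sign_simps mult_1_left ac_simps)

context
  fixes a :: "'n rll" and S :: "'i set" and u v :: "'i \<Rightarrow> 'n rll" and \<alpha> \<beta> :: "'i \<Rightarrow> bool" and \<tau> :: bool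
  assumes a: "a \<in> U_le" and fin: "finite S"
    and flip: "tensor_flip (rll_coproduct a) = (\<Sum>p\<in>S. u p \<otimes> v p)"
    and uv: "\<And>p. u p \<in> U_le" "\<And>p. v p \<in> U_le"
    and hom: "\<And>p. homogeneous (\<alpha> p) (u p)" "\<And>p. homogeneous (\<beta> p) (v p)"
    and \<tau>: "\<And>p. (\<alpha> p \<noteq> \<beta> p) = \<tau>"
begin

lemma B_mult_right_sum:
  assumes y: "y \<in> U_ge" "y' \<in> U_ge"
  shows "B a (y * y') = (\<Sum>p\<in>S. sign (\<alpha> p \<and> \<beta> p) * (B (u p) y * B (v p) y'))"
proof -
  obtain ps where ps: "set ps = S" "distinct ps"
    using finite_distinct_list[OF fin] by blast
  have *: "(\<Sum>s\<in>UNIV. \<Sum>t\<in>UNIV. sign (s \<and> t) * (B (u p) (hcomp t y) * B (hcomp s (v p)) y'))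
      = sign (\<alpha> p \<and> \<beta> p) * (B (u p) y * B (v p) y')" for p
  proof -
    have "B (hcomp s (v p)) y' = (if s = \<beta> p then B (v p) y' else 0)" for s
      using hcomp_homogeneous[OF hom(2)[of p], of s] B_zero(1)[OF y(2)]
      by (cases "s = \<beta> p") (simp_all only: if_True if_False simp_thms)
    then show ?thesis
      by (simp only: sum_bool_sign B_hcomp[OF uv(1) hom(1) y(1)] sum_bool_point)
  qed
  let ?xs = "map (\<lambda>p. (u p, v p)) ps"
  have "tensor_flip (rll_coproduct a) = tensor_sum ?xs"
    by (simp add: flip tensor_sum_def o_def sum_list_distinct_conv_sum_set[OF ps(2)] ps(1))
  then have "B a (y * y') = pair_sums B ?xs [(y, y')]"
    using uv by (intro B_mult_right a y) auto
  also have "\<dots> = (\<Sum>p\<leftarrow>ps. sign (\<alpha> p \<and> \<beta> p) * (B (u p) y * B (v p) y'))"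
    by (simp only: pair_sums_def map_map o_def case_prod_conv list.map sum_list.Cons sum_list.Nil add_0_right *)
  also have "\<dots> = (\<Sum>p\<in>S. sign (\<alpha> p \<and> \<beta> p) * (B (u p) y * B (v p) y'))"
    by (simp only: sum_list_distinct_conv_sum_set[OF ps(2)] ps(1))
  finally show ?thesis .
qed

text \<open>The signs agree term by term: \<open>(u\<^sub>p, y)\<close> vanishes unless \<open>y\<close> has the parity of \<open>u\<^sub>p\<close>, and for that
  parity both sides carry the same product of signs.\<close>

lemma contract_pure_mult:
  assumes "homogeneous r x" "homogeneous s y" "homogeneous r' x'" "y \<in> U_ge" "y' \<in> U_ge"
  shows "contract B \<tau> a ((x \<otimes> y) * (x' \<otimes> y'))
    = (\<Sum>p\<in>S. sign (\<alpha> p \<and> \<beta> p) *\<^sub>Q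
        (twist (\<beta> p) (contract B (\<alpha> p) (u p) (x \<otimes> y)) * contract B (\<beta> p) (v p) (x' \<otimes> y')))"
proof -
  have yy: "y * y' \<in> U_ge"
    by (intro ge_closed assms)
  have "contract B \<tau> a ((x \<otimes> y) * (x' \<otimes> y'))
      = (sign (s \<and> r') * (B a (y * y') * sign (\<tau> \<and> (r \<noteq> r')))) *\<^sub>Q (x * x')"
    by (simp only: tensor_mult_homogeneous[OF assms(2,3)] contract_linear[OF a] contract_tens[OF a yy]
        twist_homogeneous[OF homogeneous_mult[OF assms(1,3)]] scaleQ_scaleQ)
  also have "sign (s \<and> r') * (B a (y * y') * sign (\<tau> \<and> (r \<noteq> r')))
      = (\<Sum>p\<in>S. sign (s \<and> r') * (sign (\<alpha> p \<and> \<beta> p) * (B (u p) y * B (v p) y') * sign (\<tau> \<and> (r \<noteq> r'))))"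
    by (simp only: B_mult_right_sum[OF assms(4,5)] sum_distrib_left sum_distrib_right)
  also have "\<dots> = (\<Sum>p\<in>S. sign (\<alpha> p \<and> \<beta> p) * (sign (\<beta> p \<and> r) * (B (u p) y * sign (\<alpha> p \<and> r)) *
      (B (v p) y' * sign (\<beta> p \<and> r'))))"
  proof (rule sum.cong[OF refl])
    fix p
    show "sign (s \<and> r') * (sign (\<alpha> p \<and> \<beta> p) * (B (u p) y * B (v p) y') * sign (\<tau> \<and> (r \<noteq> r')))
      = sign (\<alpha> p \<and> \<beta> p) * (sign (\<beta> p \<and> r) * (B (u p) y * sign (\<alpha> p \<and> r)) * (B (v p) y' * sign (\<beta> p \<and> r')))"
    proof (cases "s = \<alpha> p")
      case True
      have "sign (s \<and> r') * sign (\<tau> \<and> (r \<noteq> r')) = sign (\<beta> p \<and> r) * sign (\<alpha> p \<and> r) * sign (\<beta> p \<and> r')"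
        using \<tau>[of p] True by (cases "\<alpha> p"; cases "\<beta> p"; cases r; cases r'; cases \<tau>) (simp_all add: sign_def)
      then have "sign (\<alpha> p \<and> \<beta> p) * (B (u p) y * B (v p) y') * (sign (s \<and> r') * sign (\<tau> \<and> (r \<noteq> r')))
          = sign (\<alpha> p \<and> \<beta> p) * (B (u p) y * B (v p) y') * (sign (\<beta> p \<and> r) * sign (\<alpha> p \<and> r) * sign (\<beta> p \<and> r'))"
        by (rule arg_cong)
      then show ?thesis
        by (simp only: ac_simps)
    next
      case False
      have "B (u p) y = 0"
        by (rule B_parity[OF uv(1) assms(4) hom(1) assms(2)]) (use False in simp)
      then show ?thesis
        by (simp only: mult_zero_left mult_zero_right)
    qed
  qed
  also have "\<dots> *\<^sub>Q (x * x') = (\<Sum>p\<in>S. sign (\<alpha> p \<and> \<beta> p) *\<^sub>Q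
        (twist (\<beta> p) (contract B (\<alpha> p) (u p) (x \<otimes> y)) * contract B (\<beta> p) (v p) (x' \<otimes> y')))"
    unfolding cq.scale_sum_left
  proof (rule sum.cong[OF refl])
    fix p
    show "(sign (\<alpha> p \<and> \<beta> p) * (sign (\<beta> p \<and> r) * (B (u p) y * sign (\<alpha> p \<and> r)) * (B (v p) y' * sign (\<beta> p \<and> r')))) *\<^sub>Q (x * x')
      = sign (\<alpha> p \<and> \<beta> p) *\<^sub>Q
        (twist (\<beta> p) (contract B (\<alpha> p) (u p) (x \<otimes> y)) * contract B (\<beta> p) (v p) (x' \<otimes> y'))"
      by (simp only: contract_tens[OF uv(1) assms(4)] contract_tens[OF uv(2) assms(5)] twist_linear
          twist_homogeneous[OF assms(1)] twist_homogeneous[OF assms(3)] scaleQ_mult_left scaleQ_mult_right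
          scaleQ_scaleQ ac_simps)
  qed
  finally show ?thesis .
qed

lemma contract_mult:
  assumes t: "t \<in> tensor_square U_ge" and t': "t' \<in> tensor_square U_ge"
  shows "contract B \<tau> a (t * t')
    = (\<Sum>p\<in>S. sign (\<alpha> p \<and> \<beta> p) *\<^sub>Q (twist (\<beta> p) (contract B (\<alpha> p) (u p) t) * contract B (\<beta> p) (v p) t'))"
proof -
  have left: "contract B \<tau> a ((x \<otimes> y) * t')
    = (\<Sum>p\<in>S. sign (\<alpha> p \<and> \<beta> p) *\<^sub>Q
        (twist (\<beta> p) (contract B (\<alpha> p) (u p) (x \<otimes> y)) * contract B (\<beta> p) (v p) t'))"
    if xy: "homogeneous r x" "homogeneous s y" "y \<in> U_ge" for x y r s
    using t'
  proof (induction rule: tensor_square_induct)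
    case zero
    then show ?case
      by (simp only: mult_zero_right contract_linear[OF a] contract_linear[OF uv(2)] cq.scale_zero_right sum.neutral_const)
  next
    case (step c x' y' r' s' t)
    show ?case
      by (simp only: distrib_left scaleQ_mult_right contract_linear[OF a] contract_linear[OF uv(2)]
          scaleQ_right_distrib sum.distrib step(6) contract_pure_mult[OF xy(1,2) step(3) xy(3) step(2)]
          cq.scale_sum_right scaleQ_scaleQ mult.commute)
  qed
  show ?thesis
    using t
  proof (induction rule: tensor_square_induct)
    case zero
    then show ?case
      by (simp only: mult_zero_left contract_linear[OF a] contract_linear[OF uv(1)] twist_linear cq.scale_zero_right sum.neutral_const)
  next
    case (step c x y r s t)
    show ?case
      by (simp only: distrib_right scaleQ_mult_left contract_linear[OF a] contract_linear[OF uv(1)] twist_linear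
          scaleQ_right_distrib sum.distrib step(6) left[OF step(3,4,2)]
          cq.scale_sum_right scaleQ_scaleQ mult.commute)
  qed
qed

text \<open>The Leibniz rule: if the opposite coproduct of \<open>a\<close> is \<open>\<Sum>\<^sub>p u\<^sub>p \<otimes> v\<^sub>p\<close>, then \<open>u\<^sub>p\<close> acts on the first factor
  and \<open>v\<^sub>p\<close> on the second.\<close>

lemma deriv_mult:
  assumes "x \<in> U_ge" "y \<in> U_ge"
  shows "deriv B \<tau> a (x * y)
    = (\<Sum>p\<in>S. sign (\<alpha> p \<and> \<beta> p) *\<^sub>Q (twist (\<beta> p) (deriv B (\<alpha> p) (u p) x) * deriv B (\<beta> p) (v p) y))"
  by (simp only: deriv_def rll_coproduct_hom contract_mult coproduct_U_ge assms)

end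

end

section \<open>The adjoints of the generators\<close>

lemma qq_powi_add: "qq powi m * qq powi n = qq powi (m + n)"
  by (rule power_int_add[symmetric]) simp

lemma qq_powi_cancel: "qq powi (- n) * qq powi n = 1" "qq powi n * qq powi (- n) = 1"
  by (simp_all only: qq_powi_add add.left_inverse add.right_inverse power_int_0_right)

lemma tensor_flip_coproduct_lm:
  "tensor_flip (rll_coproduct (lm a b)) = (\<Sum>p\<in>UNIV. lm p b \<otimes> lm a p)"
  unfolding rll_coproduct_gen tensor_flip_sum tensor_flip_linear
  by (simp only: tensor_flip_homogeneous[OF homogeneous_gens(2) homogeneous_gens(2)] scaleQ_scaleQ
      sign_simps scaleQ_one)

lemma homogeneous_diag: "homogeneous False (lp k k)" "homogeneous False (lm k k)"
  using homogeneous_gens[of k k] by (simp_all only: simp_thms)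

lemma tensor_flip_coproduct_lp_diag:
  "tensor_flip (rll_coproduct (lp k k)) = (\<Sum>p\<in>{()}. lp k k \<otimes> lp k k)"
  by (simp add: rll_coproduct_lp_diag tensor_flip_homogeneous[OF homogeneous_diag(1) homogeneous_diag(1)])

lemma ebar_in: "ebar p \<in> U_ge" and fbar_in: "fbar p \<in> U_le"
  unfolding ebar_def fbar_def case_prod_unfold
  by (intro subalgebraD(3)[OF U_ge_le_subalgebra(1)] subalgebraD(3)[OF U_ge_le_subalgebra(2)] U_ge_gens U_le_gens)+

lemma homogeneous_bar: "homogeneous (par i j) (ebar (i, j))" "homogeneous (par i j) (fbar (i, j))"
proof -
  have "homogeneous (False \<noteq> par i j) (lm i i * lp i j)" "homogeneous (par j i \<noteq> False) (lm j i * lp i i)"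
    by (intro homogeneous_mult homogeneous_diag homogeneous_gens)+
  moreover have "(False \<noteq> par i j) = par i j" "(par j i \<noteq> False) = par i j"
    by auto
  ultimately show "homogeneous (par i j) (ebar (i, j))" "homogeneous (par i j) (fbar (i, j))"
    by (simp_all only: ebar_def fbar_def case_prod_conv)
qed

lemma sum_UNIV_single:
  fixes f :: "'i::finite \<Rightarrow> 'a::comm_monoid_add"
  assumes "\<And>p. p \<noteq> q \<Longrightarrow> f p = 0"
  shows "(\<Sum>p\<in>UNIV. f p) = f q"
proof -
  have "(\<Sum>p\<in>UNIV. f p) = (\<Sum>p\<in>{q}. f p)"
    by (rule sum.mono_neutral_right) (use assms in auto)
  then show ?thesis by simp
qed

context rll_paired
begin

text \<open>The adjoint of right multiplication by \<open>l\<^sup>-\<^sub>a\<^sub>b\<close>.\<close>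

definition D :: "'n \<Rightarrow> 'n \<Rightarrow> 'n rll \<Rightarrow> 'n rll"
  where "D a b = deriv B (par a b) (lm a b)"

text \<open>The adjoint of right multiplication by \<open>l\<^sup>+\<^sub>k\<^sub>k\<close>, an algebra endomorphism because \<open>l\<^sup>+\<^sub>k\<^sub>k\<close> is group-like.\<close>

definition X :: "'n \<Rightarrow> 'n rll \<Rightarrow> 'n rll"
  where "X k = deriv B False (lp k k)"

lemma D_linear: "D a b (x + y) = D a b x + D a b y" "D a b (c *\<^sub>Q x) = c *\<^sub>Q D a b x"
  and X_linear: "X k (x + y) = X k x + X k y" "X k (c *\<^sub>Q x) = c *\<^sub>Q X k x"
  by (simp_all only: D_def X_def deriv_linear U_le_gens)

lemma D_U_ge: "x \<in> U_ge \<Longrightarrow> D a b x \<in> U_ge" and X_U_ge: "x \<in> U_ge \<Longrightarrow> X k x \<in> U_ge"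
  by (simp_all only: D_def X_def deriv_U_ge U_le_gens)

lemma D_one: "D a b 1 = (if a = b then 1 else 0)" and X_one: "X k 1 = 1"
  by (simp_all add: D_def X_def deriv_one U_le_gens rll_counit_gen)

lemma D_mult:
  assumes "x \<in> U_ge" "y \<in> U_ge"
  shows "D a b (x * y) = (\<Sum>p\<in>UNIV. sign (par p b \<and> par a p) *\<^sub>Q (twist (par a p) (D p b x) * D a p y))"
  unfolding D_def
  by (rule deriv_mult[OF U_le_gens(1) finite_UNIV tensor_flip_coproduct_lm U_le_gens(1) U_le_gens(1)
        homogeneous_gens(2) homogeneous_gens(2) _ assms]) blast

lemma X_mult:
  assumes "x \<in> U_ge" "y \<in> U_ge"
  shows "X k (x * y) = X k x * X k y"
  unfolding X_def
  using deriv_mult[OF U_le_gens(2) _ tensor_flip_coproduct_lp_diag U_le_gens(2) U_le_gens(2)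
        homogeneous_diag(1) homogeneous_diag(1) _ assms, of False] by simp

lemma pairing_D: "x \<in> U_ge \<Longrightarrow> F \<in> U_le \<Longrightarrow> B (F * lm a b) x = B F (D a b x)"
  unfolding D_def by (rule pairing_deriv[OF U_le_gens(1) homogeneous_gens(2)])

lemma pairing_X: "x \<in> U_ge \<Longrightarrow> F \<in> U_le \<Longrightarrow> B (F * lp k k) x = B F (X k x)"
  unfolding X_def by (rule pairing_deriv[OF U_le_gens(2) homogeneous_diag(1)])

lemma D_upper:
  assumes "a < b" "x \<in> U_ge"
  shows "D a b x = 0"
proof -
  have a: "0 \<in> U_le" by (rule le_closed)
  have "contract B \<alpha> 0 t = 0" if "t \<in> tensor_square U_ge" for \<alpha> t
    using that
    by (induction rule: tensor_square_induct)
      (simp_all add: contract_linear[OF a] contract_tens[OF a] B_zero)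
  then show ?thesis
    using coproduct_U_ge[OF assms(2)] by (simp add: D_def deriv_def rll_generators(2)[OF assms(1)])
qed

lemma deriv_lp:
  assumes "a \<in> U_le"
  shows "deriv B \<alpha> a (lp k l) = (\<Sum>r\<in>UNIV. (sign (par k r \<and> par r l) * (B a (lp r l) * sign (\<alpha> \<and> par k r))) *\<^sub>Q lp k r)"
proof -
  have *: "contract B \<alpha> a (\<Sum>r\<in>A. f r) = (\<Sum>r\<in>A. contract B \<alpha> a (f r))" for A :: "'n set" and f
    by (induction A rule: infinite_finite_induct) (simp_all add: contract_linear[OF assms])
  show ?thesis
    by (simp only: deriv_def rll_coproduct_gen * contract_linear[OF assms] contract_tens[OF assms U_ge_gens(1)]
        twist_homogeneous[OF homogeneous_gens(1)] scaleQ_scaleQ)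
qed

text \<open>Contracting the coproduct of \<open>l\<^sup>+\<^sub>k\<^sub>l\<close> with the entries of \<open>\<tau>(R\<^sup>-\<^sup>1)\<close>: the diagonal entries rescale, and
  an off-diagonal entry replaces the column \<open>l = a\<close> by \<open>b\<close>.\<close>

lemma D_diag_lp: "D a a (lp k l) = qq powi eps_form l a *\<^sub>Q lp k l"
proof -
  have "D a a (lp k l) = (\<Sum>r\<in>UNIV. (sign (par k r \<and> par r l) * (Rmat_inv r l a a * sign (par a a \<and> par k r))) *\<^sub>Q lp k r)"
    by (simp only: D_def deriv_lp[OF U_le_gens(1)] B_lm_lp)
  also have "\<dots> = (sign (par k l \<and> par l l) * (Rmat_inv l l a a * sign (par a a \<and> par k l))) *\<^sub>Q lp k l"
  proof (rule sum_UNIV_single)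
    fix r
    assume "r \<noteq> l"
    then have "Rmat_inv r l a a = 0"
      by (intro Rmat_inv_other) blast+
    then show "(sign (par k r \<and> par r l) * (Rmat_inv r l a a * sign (par a a \<and> par k r))) *\<^sub>Q lp k r = 0"
      by (simp only: mult_zero_left mult_zero_right cq.scale_zero_left)
  qed
  finally show ?thesis
    by (simp only: Rmat_inv_diag simp_thms sign_simps mult_1_left mult_1_right)
qed

lemma D_lower_lp:
  assumes "b < a"
  shows "D a b (lp k l) = (if l = a then (qdiff * sign (odd_index a)) *\<^sub>Q lp k b else 0)"
proof -
  have neq: "a \<noteq> b"
    using assms by (rule less_imp_neq[THEN not_sym])
  have "D a b (lp k l) = (\<Sum>r\<in>UNIV. (sign (par k r \<and> par r l) * (Rmat_inv r l a b * sign (par a b \<and> par k r))) *\<^sub>Q lp k r)"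
    by (simp only: D_def deriv_lp[OF U_le_gens(1)] B_lm_lp)
  also have "\<dots> = (sign (par k b \<and> par b l) * (Rmat_inv b l a b * sign (par a b \<and> par k b))) *\<^sub>Q lp k b"
  proof (rule sum_UNIV_single)
    fix r
    assume "r \<noteq> b"
    then have "Rmat_inv r l a b = 0"
      using neq by (intro Rmat_inv_other) blast+
    then show "(sign (par k r \<and> par r l) * (Rmat_inv r l a b * sign (par a b \<and> par k r))) *\<^sub>Q lp k r = 0"
      by (simp only: mult_zero_left mult_zero_right cq.scale_zero_left)
  qed
  finally have D: "D a b (lp k l) = \<dots>" .
  show ?thesis
  proof (cases "l = a")
    case True
    have "(par k b \<and> par b a) = (par a b \<and> par k b)"
      by blast
    then have "sign (par k b \<and> par b a) * (qdiff * sign (odd_index a) * sign (par a b \<and> par k b)) = qdiff * sign (odd_index a)"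
      by (simp only: sign_simps mult_1_left mult_1_right ac_simps)
    then show ?thesis
      unfolding D using True Rmat_inv_swap[OF assms] by (simp only: if_True simp_thms)
  next
    case False
    then have "Rmat_inv b l a b = 0"
      using neq by (intro Rmat_inv_other) blast+
    then show ?thesis
      unfolding D using False by (simp only: if_False mult_zero_left mult_zero_right cq.scale_zero_left)
  qed
qed

text \<open>The pairing with \<open>l\<^sup>+\<^sub>k\<^sub>k\<close> is given; that with its inverse follows from
  \<open>(l\<^sup>-\<^sub>a\<^sub>b, l\<^sup>+\<^sub>k\<^sub>k l\<^sup>-\<^sub>k\<^sub>k) = (l\<^sup>-\<^sub>a\<^sub>b, 1)\<close>, since the matrix of the \<open>(l\<^sup>-\<^sub>a\<^sub>b, l\<^sup>+\<^sub>k\<^sub>k)\<close> is diagonal.\<close>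

lemma B_lm_lm_diag: "B (lm a b) (lm k k) = (if a = b then qq powi (- eps_form k a) else 0)"
proof -
  have "B (lm a b) (lp k k * lm k k)
      = (\<Sum>p\<in>UNIV. sign (par p b \<and> par a p) * (B (lm p b) (lp k k) * B (lm a p) (lm k k)))"
    by (rule B_mult_right_sum[OF U_le_gens(1) finite_UNIV tensor_flip_coproduct_lm U_le_gens(1) U_le_gens(1)
        homogeneous_gens(2) homogeneous_gens(2), where \<tau> = "par a b"]) (blast, rule U_ge_gens, rule U_ge_gens)
  also have "\<dots> = sign (par b b \<and> par a b) * (B (lm b b) (lp k k) * B (lm a b) (lm k k))"
  proof (rule sum_UNIV_single)
    fix p
    assume "p \<noteq> b"
    then have "Rmat_inv k k p b = 0"
      by (intro Rmat_inv_other) blast+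
    then show "sign (par p b \<and> par a p) * (B (lm p b) (lp k k) * B (lm a p) (lm k k)) = 0"
      by (simp only: B_lm_lp mult_zero_left mult_zero_right)
  qed
  also have "\<dots> = qq powi eps_form k b * B (lm a b) (lm k k)"
    by (simp only: B_lm_lp Rmat_inv_diag simp_thms sign_simps mult_1_left)
  finally have "qq powi eps_form k b * B (lm a b) (lm k k) = (if a = b then 1 else 0)"
    by (simp only: rll_generators(3) B_one_right[OF U_le_gens(1)] rll_counit_gen)
  then have "qq powi (- eps_form k b) * (qq powi eps_form k b * B (lm a b) (lm k k))
      = qq powi (- eps_form k b) * (if a = b then 1 else 0)"
    by (rule arg_cong)
  moreover have "qq powi (- eps_form k b) * qq powi eps_form k b = 1"
    by (rule qq_powi_cancel)
  ultimately have "B (lm a b) (lm k k) = qq powi (- eps_form k b) * (if a = b then 1 else 0)"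
    by (simp only: mult.assoc[symmetric] mult_1_left)
  then show ?thesis
    by (cases "a = b") (simp_all only: if_True if_False simp_thms mult_1_right mult_zero_right)
qed

lemma deriv_lm_diag: "a \<in> U_le \<Longrightarrow> deriv B \<alpha> a (lm k k) = B a (lm k k) *\<^sub>Q lm k k"
  by (simp only: deriv_def rll_coproduct_lm_diag contract_tens U_ge_gens(2) twist_homogeneous[OF homogeneous_diag(2)])
    simp

lemma D_lm_diag: "D a b (lm k k) = (if a = b then qq powi (- eps_form k a) else 0) *\<^sub>Q lm k k"
  by (simp only: D_def deriv_lm_diag[OF U_le_gens(1)] B_lm_lm_diag)

lemma D_ebar: "D a b (ebar (k, l)) = qq powi (- eps_form k b) *\<^sub>Q (lm k k * D a b (lp k l))"
proof -
  have "D a b (ebar (k, l))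
      = (\<Sum>p\<in>UNIV. sign (par p b \<and> par a p) *\<^sub>Q (twist (par a p) (D p b (lm k k)) * D a p (lp k l)))"
    by (simp only: ebar_def case_prod_conv D_mult U_ge_gens)
  also have "\<dots> = sign (par b b \<and> par a b) *\<^sub>Q (twist (par a b) (D b b (lm k k)) * D a b (lp k l))"
    by (rule sum_UNIV_single) (simp add: D_lm_diag twist_linear)
  also have "\<dots> = qq powi (- eps_form k b) *\<^sub>Q (lm k k * D a b (lp k l))"
    by (simp only: D_lm_diag twist_linear twist_homogeneous[OF homogeneous_diag(2)] simp_thms if_True
        sign_simps scaleQ_one scaleQ_mult_left)
  finally show ?thesis .
qed

lemma D_diag_ebar: "D a a (ebar (k, l)) = qq powi (eps_form l a - eps_form k a) *\<^sub>Q ebar (k, l)"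
proof -
  have "D a a (ebar (k, l)) = (qq powi (- eps_form k a) * qq powi eps_form l a) *\<^sub>Q ebar (k, l)"
    by (simp only: D_ebar D_diag_lp scaleQ_mult_right scaleQ_scaleQ) (simp only: ebar_def case_prod_conv)
  also have "qq powi (- eps_form k a) * qq powi eps_form l a = qq powi (eps_form l a - eps_form k a)"
    by (simp only: qq_powi_add uminus_add_conv_diff)
  finally show ?thesis .
qed

lemma D_lower_ebar:
  assumes "b < a"
  shows "D a b (ebar (k, l)) = (if l = a then (qq powi (- eps_form k b) * (qdiff * sign (odd_index a))) *\<^sub>Q ebar (k, b) else 0)"
proof (cases "l = a")
  case True
  then show ?thesis
    by (simp only: D_ebar D_lower_lp[OF assms] if_True simp_thms scaleQ_mult_right scaleQ_scaleQ)
      (simp only: ebar_def case_prod_conv)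
qed (simp only: D_ebar D_lower_lp[OF assms] if_False mult_zero_right cq.scale_zero_right)

text \<open>Likewise, from \<open>(l\<^sup>+\<^sub>i\<^sub>i l\<^sup>-\<^sub>i\<^sub>i, y) = (1, y)\<close>.\<close>

lemma B_lp_diag:
  "B (lp i i) (lp k l) = (if k = l then qq powi (- eps_form l i) else 0)"
  "B (lp i i) (lm k k) = qq powi eps_form k i"
proof -
  have "B (lp i i) (D i i (lp k l)) = B (lp i i * lm i i) (lp k l)"
    by (rule pairing_D[symmetric]) (rule U_ge_gens U_le_gens)+
  also have "\<dots> = (if k = l then 1 else 0)"
    by (simp only: rll_generators(3) B_one_left[OF U_ge_gens(1)] rll_counit_gen)
  finally have "qq powi eps_form l i * B (lp i i) (lp k l) = (if k = l then 1 else 0)"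
    by (simp only: D_diag_lp B_scale_right U_ge_gens U_le_gens)
  then have "qq powi (- eps_form l i) * (qq powi eps_form l i * B (lp i i) (lp k l))
      = qq powi (- eps_form l i) * (if k = l then 1 else 0)"
    by (rule arg_cong)
  moreover have "qq powi (- eps_form l i) * qq powi eps_form l i = 1"
    by (rule qq_powi_cancel)
  ultimately have "B (lp i i) (lp k l) = qq powi (- eps_form l i) * (if k = l then 1 else 0)"
    by (simp only: mult.assoc[symmetric] mult_1_left)
  then show "B (lp i i) (lp k l) = (if k = l then qq powi (- eps_form l i) else 0)"
    by (cases "k = l") (simp_all only: if_True if_False simp_thms mult_1_right mult_zero_right)
  have "B (lp i i) (D i i (lm k k)) = B (lp i i * lm i i) (lm k k)"
    by (rule pairing_D[symmetric]) (rule U_ge_gens U_le_gens)+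
  also have "\<dots> = 1"
    by (simp add: rll_generators(3) B_one_left[OF U_ge_gens(2)] rll_counit_gen)
  finally have "qq powi (- eps_form k i) * B (lp i i) (lm k k) = 1"
    by (simp only: D_lm_diag if_True simp_thms B_scale_right U_ge_gens U_le_gens)
  then have "qq powi eps_form k i * (qq powi (- eps_form k i) * B (lp i i) (lm k k)) = qq powi eps_form k i"
    by (simp only: mult_1_right)
  moreover have "qq powi eps_form k i * qq powi (- eps_form k i) = 1"
    by (rule qq_powi_cancel)
  ultimately show "B (lp i i) (lm k k) = qq powi eps_form k i"
    by (simp only: mult.assoc[symmetric] mult_1_left)
qed

lemma X_ebar: "X i (ebar (k, l)) = qq powi (eps_form k i - eps_form l i) *\<^sub>Q ebar (k, l)"
proof -
  have "X i (lp k l) = (\<Sum>r\<in>UNIV. (sign (par k r \<and> par r l) * (B (lp i i) (lp r l) * sign (False \<and> par k r))) *\<^sub>Q lp k r)"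
    by (simp only: X_def deriv_lp[OF U_le_gens(2)])
  also have "\<dots> = (sign (par k l \<and> par l l) * (B (lp i i) (lp l l) * sign (False \<and> par k l))) *\<^sub>Q lp k l"
    by (rule sum_UNIV_single) (simp only: B_lp_diag if_False mult_zero_left mult_zero_right cq.scale_zero_left)
  also have "\<dots> = qq powi (- eps_form l i) *\<^sub>Q lp k l"
    by (simp only: B_lp_diag if_True simp_thms sign_simps mult_1_left mult_1_right)
  finally have lp: "X i (lp k l) = \<dots>" .
  have lm: "X i (lm k k) = qq powi eps_form k i *\<^sub>Q lm k k"
    by (simp only: X_def deriv_lm_diag[OF U_le_gens(2)] B_lp_diag)
  have "X i (ebar (k, l)) = X i (lm k k) * X i (lp k l)"
    by (simp only: ebar_def case_prod_conv X_mult U_ge_gens)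
  also have "\<dots> = (qq powi (- eps_form l i) * qq powi eps_form k i) *\<^sub>Q ebar (k, l)"
    by (simp only: lp lm scaleQ_mult_left scaleQ_mult_right scaleQ_scaleQ) (simp only: ebar_def case_prod_conv)
  also have "qq powi (- eps_form l i) * qq powi eps_form k i = qq powi (eps_form k i - eps_form l i)"
    by (simp only: qq_powi_add uminus_add_conv_diff)
  finally show ?thesis .
qed

end

section \<open>The skew derivation of a root\<close>

lemma roots_above_fst: "(k, l) \<in> roots_above (i, j) \<Longrightarrow> i < k \<or> k = i \<and> j < l" and
  roots_above_lt: "(k, l) \<in> roots_above (i, j) \<Longrightarrow> k < l"
  by (auto simp: roots_above_iff)

text \<open>The sum is \<open>(t\<^bsup>k+1\<^esup> - 1) / (t - 1)\<close> with \<open>t = q\<^sup>n\<close>, and \<open>q\<close> is not a root of unity.\<close>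

lemma geometric_nonzero:
  assumes "n \<noteq> 0"
  shows "(\<Sum>r\<le>k. (qq powi n) ^ r) \<noteq> 0"
proof
  assume "(\<Sum>r\<le>k. (qq powi n) ^ r) = 0"
  then have "(qq powi n - 1) * (\<Sum>r<Suc k. (qq powi n) ^ r) = 0"
    by (simp only: lessThan_Suc_atMost mult_zero_right)
  then have "(qq powi n) ^ Suc k - 1 = 0"
    by (simp only: power_diff_1_eq)
  then have "qq powi (n * int (Suc k)) = 1"
    by (simp only: power_int_mult power_int_of_nat right_minus_eq)
  moreover have "n * int (Suc k) \<noteq> 0"
    using assms by simp
  ultimately show False
    using qq_powi_neq_1 by blast
qed

lemma homogeneous_power:
  assumes "homogeneous s x"
  shows "homogeneous (s \<and> odd k) (x ^ k)"
proof (induction k)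
  case 0
  show ?case by (simp add: hcomp_one)
next
  case (Suc k)
  have "homogeneous (s \<noteq> (s \<and> odd k)) (x * x ^ k)"
    by (rule homogeneous_mult[OF assms Suc])
  moreover have "(s \<noteq> (s \<and> odd k)) = (s \<and> odd (Suc k))"
    by auto
  ultimately show ?case
    by (simp only: power_Suc)
qed

context rll_paired
begin

lemma hull_ebar_U_ge: "x \<in> subalgebra hull (ebar ` S) \<Longrightarrow> x \<in> U_ge"
proof -
  have "ebar ` S \<subseteq> U_ge"
    using ebar_in by blast
  from hull_minimal[of _ _ subalgebra, OF this U_ge_le_subalgebra(1)] show "x \<in> subalgebra hull (ebar ` S) \<Longrightarrow> x \<in> U_ge"
    by blast
qed

lemma hull_fbar_U_le: "x \<in> subalgebra hull (fbar ` S) \<Longrightarrow> x \<in> U_le"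
proof -
  have "fbar ` S \<subseteq> U_le"
    using fbar_in by blast
  from hull_minimal[of _ _ subalgebra, OF this U_ge_le_subalgebra(2)] show "x \<in> subalgebra hull (fbar ` S) \<Longrightarrow> x \<in> U_le"
    by blast
qed

lemma hull_ebar_induct [consumes 1, case_names one add mult scale gen]:
  assumes "x \<in> subalgebra hull (ebar ` S)"
    and "P 1"
    and "\<And>x y. x \<in> subalgebra hull (ebar ` S) \<Longrightarrow> y \<in> subalgebra hull (ebar ` S) \<Longrightarrow> P x \<Longrightarrow> P y \<Longrightarrow> P (x + y)"
    and "\<And>x y. x \<in> subalgebra hull (ebar ` S) \<Longrightarrow> y \<in> subalgebra hull (ebar ` S) \<Longrightarrow> P x \<Longrightarrow> P y \<Longrightarrow> P (x * y)"
    and "\<And>c x. x \<in> subalgebra hull (ebar ` S) \<Longrightarrow> P x \<Longrightarrow> P (c *\<^sub>Q x)"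
    and "\<And>k l. (k, l) \<in> S \<Longrightarrow> P (ebar (k, l))"
  shows "P x"
proof -
  let ?A = "subalgebra hull (ebar ` S)"
  let ?P = "\<lambda>x. x \<in> ?A \<and> P x"
  note A = subalgebraD[OF subalgebra_hull[of "ebar ` S"]]
  have "?P x"
    using assms(1)
  proof (rule hull_induct[where P = ?P])
    fix x
    assume "x \<in> ebar ` S"
    then show "?P x"
      using assms(6) by (auto intro: hull_inc)
  next
    show "subalgebra {x. ?P x}"
    proof (rule subalgebraI)
      show "1 \<in> {x. ?P x}"
        using A(1) assms(2) by blast
    next
      fix x y
      assume "x \<in> {x. ?P x}" "y \<in> {x. ?P x}"
      then show "x + y \<in> {x. ?P x}" "x * y \<in> {x. ?P x}"
        using A(2,3) assms(3,4) by blast+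
    next
      fix c x
      assume "x \<in> {x. ?P x}"
      then show "c *\<^sub>Q x \<in> {x. ?P x}"
        using A(4) assms(5) by blast
    qed
  qed
  then show ?thesis ..
qed

text \<open>In the Leibniz rule every term but \<open>p = a\<close> contains an \<open>l\<^sup>-\<close> above the diagonal, which is zero.\<close>

lemma D_diag_mult:
  assumes "x \<in> U_ge" "y \<in> U_ge"
  shows "D a a (x * y) = D a a x * D a a y"
proof -
  have "D a a (x * y) = sign (par a a \<and> par a a) *\<^sub>Q (twist (par a a) (D a a x) * D a a y)"
    unfolding D_mult[OF assms]
  proof (rule sum_UNIV_single)
    fix p
    assume "p \<noteq> a"
    then show "sign (par p a \<and> par a p) *\<^sub>Q (twist (par a p) (D p a x) * D a p y) = 0"
      by (cases p a rule: linorder_cases)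
        (simp_all only: D_upper assms twist_linear mult_zero_left mult_zero_right cq.scale_zero_right)
  qed
  then show ?thesis
    by (simp only: simp_thms sign_simps twist_False scaleQ_one)
qed

text \<open>On root vectors both operators are diagonal with inverse eigenvalues, as \<open>l\<^sup>+\<^sub>k\<^sub>k\<close> and \<open>l\<^sup>-\<^sub>k\<^sub>k\<close> are
  inverse to each other.\<close>

lemma X_hull:
  assumes "x \<in> subalgebra hull (ebar ` S)"
  shows "X k x \<in> subalgebra hull (ebar ` S)" "D k k (X k x) = x"
proof -
  note A = subalgebraD[OF subalgebra_hull[of "ebar ` S"]]
  have "X k x \<in> subalgebra hull (ebar ` S) \<and> D k k (X k x) = x"
    using assms
  proof (induction rule: hull_ebar_induct)
    case one
    show ?case
      using A(1) by (simp add: X_one D_one)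
  next
    case (add x y)
    then show ?case
      by (simp only: X_linear D_linear A simp_thms)
  next
    case (mult x y)
    have "x \<in> U_ge" "y \<in> U_ge"
      by (rule hull_ebar_U_ge, fact)+
    then have "X k (x * y) = X k x * X k y" "D k k (X k x * X k y) = D k k (X k x) * D k k (X k y)"
      by (rule X_mult, intro D_diag_mult X_U_ge)
    with mult show ?case
      by (simp only: A simp_thms)
  next
    case (scale c x)
    then show ?case
      by (simp only: X_linear D_linear A simp_thms)
  next
    case (gen i j)
    have "(eps_form i k - eps_form j k) + (eps_form j k - eps_form i k) = 0"
      by simp
    then have "D k k (X k (ebar (i, j))) = ebar (i, j)"
      by (simp only: X_ebar D_linear D_diag_ebar scaleQ_scaleQ qq_powi_add power_int_0_right scaleQ_one)
    moreover have "ebar (i, j) \<in> subalgebra hull (ebar ` S)"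
      using gen by (intro hull_inc imageI)
    ultimately show ?case
      by (simp only: X_ebar A simp_thms)
  qed
  then show "X k x \<in> subalgebra hull (ebar ` S)" "D k k (X k x) = x"
    by blast+
qed

text \<open>The adjoint of right multiplication by \<open>fbar (i, j) = l\<^sup>-\<^sub>j\<^sub>i l\<^sup>+\<^sub>i\<^sub>i\<close>.\<close>

definition root_deriv :: "'n \<Rightarrow> 'n \<Rightarrow> 'n rll \<Rightarrow> 'n rll"
  where "root_deriv i j x = D j i (X i x)"

lemma pairing_root_deriv:
  assumes "x \<in> U_ge" "F \<in> U_le"
  shows "B (F * fbar (i, j)) x = B F (root_deriv i j x)"
proof -
  have "B (F * fbar (i, j)) x = B (F * lm j i * lp i i) x"
    by (simp only: fbar_def case_prod_conv mult.assoc)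
  also have "\<dots> = B (F * lm j i) (X i x)"
    by (intro pairing_X le_closed assms U_le_gens)
  also have "\<dots> = B F (root_deriv i j x)"
    unfolding root_deriv_def by (intro pairing_D X_U_ge assms)
  finally show ?thesis .
qed

context
  fixes i j :: 'n
  assumes ij: "i < j"
begin

abbreviation "A_ge \<equiv> subalgebra hull (ebar ` insert (i, j) (roots_above (i, j)))"
abbreviation "A_gt \<equiv> subalgebra hull (ebar ` roots_above (i, j))"

lemma A_gt_ge: "x \<in> A_gt \<Longrightarrow> x \<in> A_ge"
  using hull_mono[of "ebar ` roots_above (i, j)" "ebar ` insert (i, j) (roots_above (i, j))" subalgebra] by blast

text \<open>On a generator \<open>ebar (k, l)\<close> the operator \<open>D p i\<close> is zero unless \<open>l = p\<close> and \<open>k \<le> i\<close>.  For roots from \<open>(i, j)\<close>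
  on this forces \<open>k = i\<close> and \<open>p = l \<ge> j\<close>.  The Leibniz rule for \<open>D p i\<close> involves all \<open>D r i\<close> with \<open>i < r < p\<close>, so they are
  treated together.\<close>

lemma D_intermediate:
  assumes "x \<in> A_ge" "i < p" "p < j"
  shows "D p i x = 0"
proof -
  have "\<forall>p. i < p \<and> p < j \<longrightarrow> D p i x = 0"
    using assms(1)
  proof (induction rule: hull_ebar_induct)
    case one
    show ?case
      by (auto simp: D_one)
  next
    case (mult x y)
    have xy: "x \<in> U_ge" "y \<in> U_ge"
      by (rule hull_ebar_U_ge, fact)+
    have "D p i (x * y) = 0" if p: "i < p" "p < j" for p
      unfolding D_mult[OF xy]
    proof (rule sum.neutral, rule ballI)
      fix r
      consider "r < i" | "r = i" | "i < r" "r < j" | "p < r"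
        using p by (metis linorder_less_linear order.strict_trans)
      then have "D r i x = 0 \<or> D p r y = 0"
      proof cases
        case 1
        then show ?thesis using D_upper xy by blast
      next
        case 2
        then show ?thesis using mult p by blast
      next
        case 3
        then show ?thesis using mult by blast
      next
        case 4
        then show ?thesis using D_upper xy by blast
      qed
      then show "sign (par r i \<and> par p r) *\<^sub>Q (twist (par p r) (D r i x) * D p r y) = 0"
        by (elim disjE) (simp_all only: twist_linear mult_zero_left mult_zero_right cq.scale_zero_right)
    qed
    then show ?case by blast
  next
    case (gen k l)
    have "D p i (ebar (k, l)) = 0" if p: "i < p" "p < j" for p
    proof (cases "l = p")
      case True
      have "(k, l) \<noteq> (i, j)"
        using p True by blast
      with gen have "i < k"
        using p True roots_above_fst by fastforce
      then show ?thesis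
        by (simp only: D_lower_ebar[OF p(1)] bar_triangular cq.scale_zero_right) simp
    qed (simp add: D_lower_ebar[OF p(1)])
    then show ?case by blast
  qed (auto simp: D_linear)
  then show ?thesis
    using assms by blast
qed

text \<open>Only the terms \<open>p = i\<close> and \<open>p = j\<close> of the Leibniz rule survive, by triangularity and the previous lemma.
  In the first, \<open>D i i\<close> cancels \<open>X i\<close>; in the second, \<open>D j j\<close> and \<open>X i\<close> form the twisting automorphism.\<close>

lemma root_deriv_mult:
  assumes x: "x \<in> A_ge" and y: "y \<in> U_ge"
  shows "root_deriv i j (x * y) = twist (par i j) x * root_deriv i j y + root_deriv i j x * D j j (X i y)"
proof -
  have xU: "x \<in> U_ge" by (rule hull_ebar_U_ge[OF x])
  have XX: "X i x \<in> U_ge" "X i y \<in> U_ge"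
    by (intro X_U_ge xU y)+
  let ?f = "\<lambda>p. sign (par p i \<and> par j p) *\<^sub>Q (twist (par j p) (D p i (X i x)) * D j p (X i y))"
  have "root_deriv i j (x * y) = (\<Sum>p\<in>UNIV. ?f p)"
    by (simp only: root_deriv_def X_mult[OF xU y] D_mult[OF XX])
  also have "\<dots> = (\<Sum>p\<in>{i, j}. ?f p)"
  proof (rule sum.mono_neutral_right)
    show "\<forall>p\<in>UNIV - {i, j}. ?f p = 0"
    proof
      fix p
      assume "p \<in> UNIV - {i, j}"
      then consider "p < i" | "i < p" "p < j" | "j < p"
        by (metis DiffD2 insertCI linorder_less_linear)
      then have "D p i (X i x) = 0 \<or> D j p (X i y) = 0"
      proof cases
        case 1
        then show ?thesis using D_upper XX by blast
      next
        case 2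
        then show ?thesis using D_intermediate[OF X_hull(1)[OF x]] by blast
      next
        case 3
        then show ?thesis using D_upper XX by blast
      qed
      then show "?f p = 0"
        by (elim disjE) (simp_all only: twist_linear mult_zero_left mult_zero_right cq.scale_zero_right)
    qed
  qed simp_all
  also have "\<dots> = ?f i + ?f j"
    using less_imp_neq[OF ij] by simp
  also have "?f i = twist (par i j) x * root_deriv i j y"
  proof -
    have "par j i = par i j" by blast
    then show ?thesis
      by (simp only: simp_thms sign_simps scaleQ_one X_hull(2)[OF x] root_deriv_def)
  qed
  also have "?f j = root_deriv i j x * D j j (X i y)"
    by (simp only: simp_thms sign_simps scaleQ_one twist_False root_deriv_def)
  finally show ?thesis .
qed

lemma root_deriv_linear:
  "root_deriv i j (x + y) = root_deriv i j x + root_deriv i j y" "root_deriv i j (c *\<^sub>Q x) = c *\<^sub>Q root_deriv i j x"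
  by (simp_all only: root_deriv_def X_linear D_linear)

lemma root_deriv_one: "root_deriv i j 1 = 0"
  using less_imp_neq[OF ij] by (simp add: root_deriv_def X_one D_one)

text \<open>A root \<open>(k, j)\<close> above \<open>(i, j)\<close> has \<open>i < k\<close>, so replacing its column \<open>j\<close> by \<open>i\<close> gives zero.\<close>

lemma root_deriv_above:
  assumes "x \<in> A_gt"
  shows "root_deriv i j x = 0"
  using assms
proof (induction rule: hull_ebar_induct)
  case (mult x y)
  have "y \<in> U_ge"
    by (rule hull_ebar_U_ge, fact)
  with mult show ?case
    by (simp only: root_deriv_mult[OF A_gt_ge] mult_zero_left mult_zero_right add_0_left)
next
  case (gen k l)
  have "D j i (ebar (k, l)) = 0"
  proof (cases "l = j")
    case True
    have "i < k"
      using roots_above_fst[OF gen] True by simp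
    then show ?thesis
      by (simp only: D_lower_ebar[OF ij] bar_triangular cq.scale_zero_right) simp
  qed (simp add: D_lower_ebar[OF ij])
  then show ?case
    by (simp only: root_deriv_def X_ebar D_linear cq.scale_zero_right)
qed (simp_all add: root_deriv_one root_deriv_linear)

abbreviation "e \<equiv> ebar (i, j)"
abbreviation "f \<equiv> fbar (i, j)"

lemma e_in: "e \<in> A_ge" "e ^ k \<in> A_ge" "e ^ k \<in> U_ge" "f ^ k \<in> U_le"
proof -
  show "e \<in> A_ge"
    by (intro hull_inc imageI) simp
  then show "e ^ k \<in> A_ge"
    by (rule subalgebraD[OF subalgebra_hull])
  show "e ^ k \<in> U_ge" "f ^ k \<in> U_le"
    by (intro ge_closed le_closed ebar_in fbar_in)+
qed

lemma root_deriv_e: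
  obtains c where "c \<noteq> 0" "root_deriv i j e = c *\<^sub>Q 1"
proof
  let ?c = "qq powi (eps_form i i - eps_form j i) * (qq powi (- eps_form i i) * (qdiff * sign (odd_index j)))"
  show "?c \<noteq> 0"
    by (simp only: mult_eq_0_iff power_int_eq_0_iff qq_nonzero qdiff_nonzero sign_nonzero simp_thms)
  show "root_deriv i j e = ?c *\<^sub>Q 1"
    by (simp only: root_deriv_def X_ebar D_linear D_lower_ebar[OF ij] if_True simp_thms bar_triangular scaleQ_scaleQ)
qed

text \<open>The twisting automorphism multiplies \<open>e\<close> by \<open>q\<close> to the power \<open>(\<epsilon>\<^sub>i, \<epsilon>\<^sub>i) + (\<epsilon>\<^sub>j, \<epsilon>\<^sub>j)\<close>, which is
  \<open>\<plusminus>2\<close> for even roots; iterating the skew Leibniz rule produces a geometric sum.\<close>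

lemma root_deriv_powers:
  obtains \<kappa> where "\<And>k. root_deriv i j (e ^ Suc k) = \<kappa> k *\<^sub>Q e ^ k"
    and "\<And>k. \<not> par i j \<or> k = 0 \<Longrightarrow> \<kappa> k \<noteq> 0"
proof -
  obtain c where c: "c \<noteq> 0" "root_deriv i j e = c *\<^sub>Q 1"
    using root_deriv_e by blast
  let ?n = "(eps_form i i - eps_form j i) + (eps_form j j - eps_form i j)"
  let ?t = "qq powi ?n"
  have Ye: "D j j (X i e) = ?t *\<^sub>Q e"
    by (simp only: X_ebar D_linear D_diag_ebar scaleQ_scaleQ qq_powi_add)
  have Y: "D j j (X i (e ^ k)) = ?t ^ k *\<^sub>Q e ^ k" for k
  proof (induction k)
    case 0
    show ?case by (simp add: X_one D_one)
  next
    case (Suc k)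
    have "D j j (X i (e ^ Suc k)) = D j j (X i e * X i (e ^ k))"
      by (simp only: power_Suc X_mult[OF ebar_in e_in(3)])
    also have "\<dots> = D j j (X i e) * D j j (X i (e ^ k))"
      by (rule D_diag_mult) (intro X_U_ge ebar_in e_in(3))+
    finally show ?case
      by (simp only: Suc Ye power_Suc scaleQ_mult_left scaleQ_mult_right scaleQ_scaleQ mult.commute)
  qed
  \<comment> \<open>For odd roots only the scalar for \<open>k = 0\<close> matters, since their higher powers vanish.\<close>
  have "\<exists>\<kappa>. root_deriv i j (e ^ Suc k) = \<kappa> *\<^sub>Q e ^ k \<and> (\<not> par i j \<longrightarrow> \<kappa> = c * (\<Sum>r\<le>k. ?t ^ r)) \<and> (k = 0 \<longrightarrow> \<kappa> = c)" for k
  proof (induction k)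
    case 0
    show ?case
      using c by (intro exI[of _ c]) simp
  next
    case (Suc k)
    then obtain \<kappa> where \<kappa>: "root_deriv i j (e ^ Suc k) = \<kappa> *\<^sub>Q e ^ k"
      "\<not> par i j \<longrightarrow> \<kappa> = c * (\<Sum>r\<le>k. ?t ^ r)" by blast
    have tw: "twist (par i j) e = sign (par i j) *\<^sub>Q e"
      by (simp only: twist_homogeneous[OF homogeneous_bar(1)] simp_thms)
    have "root_deriv i j (e ^ Suc (Suc k)) = root_deriv i j (e * e ^ Suc k)"
      by (simp only: power_Suc)
    also have "\<dots> = twist (par i j) e * root_deriv i j (e ^ Suc k) + root_deriv i j e * D j j (X i (e ^ Suc k))"
      by (rule root_deriv_mult[OF e_in(1) e_in(3)])
    also have "\<dots> = (sign (par i j) * \<kappa> + c * ?t ^ Suc k) *\<^sub>Q e ^ Suc k"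
      unfolding tw \<kappa>(1) c(2) Y
      by (simp only: scaleQ_mult_left scaleQ_mult_right scaleQ_scaleQ mult_1_left scaleQ_left_distrib power_Suc mult.commute)
    finally have *: "root_deriv i j (e ^ Suc (Suc k)) = (sign (par i j) * \<kappa> + c * ?t ^ Suc k) *\<^sub>Q e ^ Suc k" .
    have "sign (par i j) * \<kappa> + c * ?t ^ Suc k = c * (\<Sum>r\<le>Suc k. ?t ^ r)" if "\<not> par i j"
    proof -
      have "sign (par i j) * \<kappa> = c * (\<Sum>r\<le>k. ?t ^ r)"
        using \<kappa>(2) that by (simp only: simp_thms sign_simps mult_1_left)
      then show ?thesis
        by (simp only: sum.atMost_Suc distrib_left)
    qed
    with * show ?case by blast
  qed
  then obtain \<kappa> where \<kappa>: "\<And>k. root_deriv i j (e ^ Suc k) = \<kappa> k *\<^sub>Q e ^ k"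
    "\<And>k. \<not> par i j \<Longrightarrow> \<kappa> k = c * (\<Sum>r\<le>k. ?t ^ r)" "\<And>k. k = 0 \<Longrightarrow> \<kappa> k = c"
    by metis
  have "\<kappa> k \<noteq> 0" if "\<not> par i j \<or> k = 0" for k
  proof (cases "k = 0")
    case True
    then show ?thesis using \<kappa>(3) c(1) by blast
  next
    case False
    with that have even: "\<not> par i j" by blast
    then have "?n \<noteq> 0"
      using less_imp_neq[OF ij] by (auto simp: eps_form_def)
    from geometric_nonzero[OF this, of k] show ?thesis
      unfolding \<kappa>(2)[OF even] using c(1) by (simp only: mult_eq_0_iff simp_thms)
  qed
  with \<kappa>(1) show ?thesis using that by blast
qed

text \<open>A left ideal of \<open>U\<^sup>\<ge>\<close> that contains \<open>e\<close> and, unlike the one generated by \<open>e\<close> alone, is stable under the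
  adjoints of all higher root vectors: the Leibniz rule for
  \<open>D l k\<close> can turn a right factor \<open>ebar (i, l)\<close> into \<open>ebar (i, r)\<close> with \<open>k \<le> r < l\<close>.\<close>

definition left_ideal :: "'n rll set"
  where "left_ideal = cq.span {x * ebar (i, p) | x p. x \<in> U_ge \<and> i < p \<and> p \<le> j}"

lemma left_ideal_base: "x \<in> U_ge \<Longrightarrow> i < p \<Longrightarrow> p \<le> j \<Longrightarrow> x * ebar (i, p) \<in> left_ideal"
  unfolding left_ideal_def by (intro cq.span_base) blast

lemma left_ideal_map:
  assumes lin: "\<And>x y. L (x + y) = L x + L y" "\<And>c x. L (c *\<^sub>Q x) = c *\<^sub>Q L x"
    and gen: "\<And>x p. x \<in> U_ge \<Longrightarrow> i < p \<Longrightarrow> p \<le> j \<Longrightarrow> L (x * ebar (i, p)) \<in> left_ideal"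
    and "y \<in> left_ideal"
  shows "L y \<in> left_ideal"
  using assms(4) unfolding left_ideal_def
proof (induction rule: cq.span_induct_alt)
  case base
  have "L 0 = 0"
    using lin(2)[of 0 0] by simp
  then show ?case by (simp add: cq.span_zero)
next
  case (step c g y)
  then have "L g \<in> left_ideal"
    using gen by blast
  then show ?case
    using step unfolding lin left_ideal_def by (intro cq.span_add cq.span_scale)
qed

lemma left_ideal_U_ge: "y \<in> left_ideal \<Longrightarrow> y \<in> U_ge"
proof -
  have "left_ideal \<subseteq> U_ge"
    unfolding left_ideal_def
    by (rule cq.span_minimal) (auto intro: ge_closed ebar_in subalgebra_subspace U_ge_le_subalgebra)
  then show "y \<in> left_ideal \<Longrightarrow> y \<in> U_ge" by blast
qed

lemma left_ideal_X: "y \<in> left_ideal \<Longrightarrow> X k y \<in> left_ideal"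
proof (rule left_ideal_map[where L = "X k"])
  fix x :: "'n rll" and p
  assume *: "x \<in> U_ge" "i < p" "p \<le> j"
  show "X k (x * ebar (i, p)) \<in> left_ideal"
    unfolding X_mult[OF *(1) ebar_in] X_ebar scaleQ_mult_right scaleQ_mult_left[symmetric]
    by (intro left_ideal_base ge_closed X_U_ge *)
qed (simp_all only: X_linear)

text \<open>The factor \<open>ebar (i, p)\<close> is either kept or becomes \<open>ebar (i, r)\<close> with \<open>k \<le> r < l = p\<close>.  The latter requires
  \<open>l \<le> j\<close>, hence \<open>i < k\<close> for a root \<open>(k, l)\<close> above \<open>(i, j)\<close>, and so \<open>i < r\<close>.\<close>

lemma left_ideal_D:
  assumes "(k, l) \<in> roots_above (i, j)"
  shows "y \<in> left_ideal \<Longrightarrow> D l k y \<in> left_ideal"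
proof (rule left_ideal_map[where L = "D l k"])
  fix x :: "'n rll" and p
  assume x: "x \<in> U_ge" and p: "i < p" "p \<le> j"
  have sub: "cq.subspace left_ideal"
    by (simp add: left_ideal_def cq.subspace_span)
  show "D l k (x * ebar (i, p)) \<in> left_ideal"
    unfolding D_mult[OF x ebar_in]
  proof (rule cq.subspace_sum[OF sub], rule cq.subspace_scale[OF sub])
    fix r
    have tw: "twist s (D r k x) \<in> U_ge" for s
      by (intro twist_U_ge[OF le_closed(1)] D_U_ge x)
    consider "l < r" | "r = l" | "r < l"
      by (metis linorder_less_linear)
    then show "twist (par l r) (D r k x) * D l r (ebar (i, p)) \<in> left_ideal"
    proof cases
      case 1
      then show ?thesis
        by (simp only: D_upper ebar_in mult_zero_right cq.subspace_0[OF sub])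
    next
      case 2
      then show ?thesis
        unfolding 2 D_diag_ebar scaleQ_mult_right scaleQ_mult_left[symmetric]
        using tw 2 by (intro left_ideal_base ge_closed p) blast
    next
      case 3
      consider "r < k" | "p \<noteq> l" | "k \<le> r" "p = l"
        by (metis not_less)
      then show ?thesis
      proof cases
        case 1
        then show ?thesis
          by (simp only: D_upper x twist_linear mult_zero_left cq.subspace_0[OF sub])
      next
        case 2
        then show ?thesis
          by (simp only: D_lower_ebar[OF 3] if_False mult_zero_right cq.subspace_0[OF sub])
      next
        case kr: 3
        have "i < r"
          using roots_above_fst[OF assms] kr p by auto
        moreover have "r \<le> j"
          using 3 kr p by simp
        ultimately show ?thesis
          unfolding D_lower_ebar[OF 3] if_P[OF kr(2)] scaleQ_mult_right scaleQ_mult_left[symmetric]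
          by (intro left_ideal_base ge_closed tw)
      qed
    qed
  qed
qed (simp_all only: D_linear)

text \<open>Moving the factors of \<open>F\<close> over one at a time turns \<open>(F, y)\<close> into \<open>(1, y')\<close> with \<open>y'\<close> in the left
  ideal, and the counit vanishes there.\<close>

lemma pairing_left_ideal:
  assumes F: "F \<in> subalgebra hull (fbar ` roots_above (i, j))" and y: "y \<in> left_ideal"
  shows "B F y = 0"
proof -
  \<comment> \<open>Keeping an arbitrary left factor \<open>G\<close> makes the property stable under products, so that it defines a subalgebra.\<close>
  let ?P = "\<lambda>F. F \<in> U_le \<and> (\<forall>y\<in>left_ideal. \<exists>y'\<in>left_ideal. \<forall>G\<in>U_le. B (G * F) y = B G y')"
  have sub: "cq.subspace left_ideal"
    by (simp add: left_ideal_def cq.subspace_span)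
  have "?P F"
    using F
  proof (rule hull_induct[where P = ?P])
    fix F
    assume "F \<in> fbar ` roots_above (i, j)"
    then obtain k l where kl: "F = fbar (k, l)" "(k, l) \<in> roots_above (i, j)"
      by auto
    have "B (G * F) y = B G (root_deriv k l y)" if "y \<in> left_ideal" "G \<in> U_le" for G y
      unfolding kl(1) by (rule pairing_root_deriv[OF left_ideal_U_ge[OF that(1)] that(2)])
    moreover have "root_deriv k l y \<in> left_ideal" if "y \<in> left_ideal" for y
      unfolding root_deriv_def by (rule left_ideal_D[OF kl(2) left_ideal_X[OF that]])
    moreover have "F \<in> U_le"
      unfolding kl(1) by (rule fbar_in)
    ultimately show "?P F" by blast
  next
    show "subalgebra {F. ?P F}"
    proof (rule subalgebraI)
      show "1 \<in> {F. ?P F}"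
        using le_closed(1) by auto
    next
      fix F F'
      assume F: "F \<in> {F. ?P F}" and F': "F' \<in> {F. ?P F}"
      then have U: "F \<in> U_le" "F' \<in> U_le" by blast+
      have "\<exists>y'\<in>left_ideal. \<forall>G\<in>U_le. B (G * (F + F')) y = B G y'" if y: "y \<in> left_ideal" for y
      proof -
        obtain z z' where z: "z \<in> left_ideal" "\<forall>G\<in>U_le. B (G * F) y = B G z"
          "z' \<in> left_ideal" "\<forall>G\<in>U_le. B (G * F') y = B G z'"
          using F F' y by blast
        have "B (G * (F + F')) y = B G (z + z')" if G: "G \<in> U_le" for G
        proof -
          have "B (G * (F + F')) y = B (G * F) y + B (G * F') y"
            unfolding distrib_left by (intro B_add_left le_closed U G left_ideal_U_ge y)
          also have "\<dots> = B G z + B G z'"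
            using z G by simp
          also have "\<dots> = B G (z + z')"
            by (intro B_add_right[symmetric] G left_ideal_U_ge z)
          finally show ?thesis .
        qed
        then show ?thesis
          using cq.subspace_add[OF sub z(1,3)] by blast
      qed
      with le_closed(2)[OF U] show "F + F' \<in> {F. ?P F}" by blast
      have "\<exists>y'\<in>left_ideal. \<forall>G\<in>U_le. B (G * (F * F')) y = B G y'" if y: "y \<in> left_ideal" for y
      proof -
        obtain z' where z': "z' \<in> left_ideal" "\<forall>G\<in>U_le. B (G * F') y = B G z'"
          using F' y by blast
        obtain z where z: "z \<in> left_ideal" "\<forall>G\<in>U_le. B (G * F) z' = B G z"
          using F z' by blast
        have "B (G * (F * F')) y = B G z" if G: "G \<in> U_le" for G
          using z z' G le_closed(3)[OF G U(1)] by (simp flip: mult.assoc)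
        with z(1) show ?thesis by blast
      qed
      with le_closed(3)[OF U] show "F * F' \<in> {F. ?P F}" by blast
    next
      fix c F
      assume F: "F \<in> {F. ?P F}"
      then have U: "F \<in> U_le" by blast
      have "\<exists>y'\<in>left_ideal. \<forall>G\<in>U_le. B (G * (c *\<^sub>Q F)) y = B G y'" if y: "y \<in> left_ideal" for y
      proof -
        obtain z where z: "z \<in> left_ideal" "\<forall>G\<in>U_le. B (G * F) y = B G z"
          using F y by blast
        have "B (G * (c *\<^sub>Q F)) y = B G (c *\<^sub>Q z)" if G: "G \<in> U_le" for G
          using z G by (simp only: scaleQ_mult_right B_scale_left[OF le_closed(3)[OF G U] left_ideal_U_ge[OF y]]
              B_scale_right[OF G left_ideal_U_ge[OF z(1)]])
        then show ?thesis
          using cq.subspace_scale[OF sub z(1)] by blast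
      qed
      with le_closed(4)[OF U] show "c *\<^sub>Q F \<in> {F. ?P F}" by blast
    qed
  qed
  then obtain y' where y': "y' \<in> left_ideal" "B (1 * F) y = B 1 y'"
    using y le_closed(1) by blast
  have "rll_counit y' = 0"
    using y'(1) unfolding left_ideal_def
  proof (induction rule: cq.span_induct_alt)
    case base
    show ?case
      using rll_counit_hom(3)[of 0 0] by simp
  next
    case (step c g y)
    then obtain x p where "g = x * ebar (i, p)" "i < p" by blast
    then have "rll_counit g = 0"
      using less_imp_neq[OF \<open>i < p\<close>] by (simp add: rll_counit_hom ebar_def rll_counit_gen)
    with step show ?case
      by (simp add: rll_counit_hom)
  qed
  then show ?thesis
    using y' by (simp add: B_one_left left_ideal_U_ge)
qed

text \<open>Each application of the skew derivation removes one \<open>f\<close> and one \<open>e\<close> and produces the same scalar as in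
  the pairing of the pure powers; the sign counts how often \<open>f\<close> passes \<open>E\<close>.\<close>

lemma pairing_peel:
  assumes F: "F \<in> subalgebra hull (fbar ` roots_above (i, j))" and E: "E \<in> A_gt" and s: "homogeneous s E"
  shows "B (F * f ^ m) (E * e ^ k)
    = (if m = k then sign ((par i j \<and> odd m) \<and> s) * B (f ^ m) (e ^ m) * B F E else 0)"
proof -
  obtain \<kappa> where \<kappa>: "\<And>k. root_deriv i j (e ^ Suc k) = \<kappa> k *\<^sub>Q e ^ k"
    using root_deriv_powers by metis
  \<comment> \<open>The second term of the skew Leibniz rule vanishes as the derivation kills \<open>E\<close>; only the sign of passing \<open>E\<close> remains.\<close>
  have step: "B (G * f ^ Suc m) (E * e ^ Suc k) = (sign (par i j \<and> s) * \<kappa> k) * B (G * f ^ m) (E * e ^ k)"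
    if G: "G \<in> U_le" and E: "E \<in> A_gt" "homogeneous s E" for G E s m k
  proof -
    note EU = hull_ebar_U_ge[OF E(1)]
    have "B (G * f ^ Suc m) (E * e ^ Suc k) = B ((G * f ^ m) * f) (E * e ^ Suc k)"
      by (simp only: power_Suc2 mult.assoc)
    also have "\<dots> = B (G * f ^ m) (root_deriv i j (E * e ^ Suc k))"
      by (intro pairing_root_deriv ge_closed le_closed G EU ebar_in fbar_in)
    also have "root_deriv i j (E * e ^ Suc k) = twist (par i j) E * root_deriv i j (e ^ Suc k)"
      by (simp only: root_deriv_mult[OF A_gt_ge[OF E(1)] e_in(3)] root_deriv_above[OF E(1)]
          mult_zero_left add_0_right)
    also have "\<dots> = (sign (par i j \<and> s) * \<kappa> k) *\<^sub>Q (E * e ^ k)"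
      by (simp only: \<kappa> twist_homogeneous[OF E(2)] scaleQ_mult_left scaleQ_mult_right scaleQ_scaleQ mult.commute)
    also have "B (G * f ^ m) \<dots> = (sign (par i j \<and> s) * \<kappa> k) * B (G * f ^ m) (E * e ^ k)"
      by (intro B_scale_right ge_closed le_closed G EU ebar_in fbar_in)
    finally show ?thesis .
  qed
  have FU: "F \<in> U_le"
    by (rule hull_fbar_U_le[OF F])
  have EU: "E \<in> U_ge"
    by (rule hull_ebar_U_ge[OF E])
  show ?thesis
  proof (induction m arbitrary: k)
    case 0
    show ?case
    proof (cases k)
      case 0
      have "B 1 1 = 1"
        by (simp add: B_one_left[OF ge_closed(1)] rll_counit_hom)
      then show ?thesis
        using 0 by simp
    next
      case (Suc k')
      \<comment> \<open>A surplus \<open>e\<close>: the right argument lies in the left ideal.\<close>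
      have "E * e ^ k = (E * e ^ k') * e"
        by (simp only: Suc power_Suc2 mult.assoc)
      moreover have "B F ((E * e ^ k') * e) = 0"
        using ij by (intro pairing_left_ideal[OF F] left_ideal_base ge_closed EU ebar_in) auto
      ultimately show ?thesis
        using Suc by simp
    qed
  next
    case (Suc m)
    show ?case
    proof (cases k)
      case 0
      \<comment> \<open>A surplus \<open>f\<close>: its adjoint kills \<open>E\<close>.\<close>
      have "B (F * f ^ Suc m) E = B ((F * f ^ m) * f) E"
        by (simp only: power_Suc2 mult.assoc)
      also have "\<dots> = B (F * f ^ m) (root_deriv i j E)"
        by (intro pairing_root_deriv le_closed FU EU fbar_in)
      also have "\<dots> = 0"
        unfolding root_deriv_above[OF E] by (intro B_zero le_closed FU fbar_in)
      finally show ?thesis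
        using 0 by simp
    next
      case (Suc k')
      \<comment> \<open>The scalar is identified by applying the same step to the pure powers, where \<open>F\<close> and \<open>E\<close> are \<open>1\<close>.\<close>
      have "B (1 * f ^ Suc m) (1 * e ^ Suc m) = (sign (par i j \<and> False) * \<kappa> m) * B (1 * f ^ m) (1 * e ^ m)"
        by (rule step[OF le_closed(1) subalgebraD(1)[OF subalgebra_hull] hcomp_one])
      then have fe: "B (f ^ Suc m) (e ^ Suc m) = \<kappa> m * B (f ^ m) (e ^ m)"
        by (simp only: mult_1_left simp_thms sign_simps)
      have sg: "sign (par i j \<and> s) * sign ((par i j \<and> odd m) \<and> s) = sign ((par i j \<and> odd (Suc m)) \<and> s)"
        by (cases "par i j"; cases s; cases "odd m") (simp_all add: sign_def)
      show ?thesis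
      proof (cases "m = k'")
        case True
        have "B (F * f ^ Suc m) (E * e ^ k) = (sign (par i j \<and> s) * \<kappa> m) *
            (sign ((par i j \<and> odd m) \<and> s) * B (f ^ m) (e ^ m) * B F E)"
          by (simp only: Suc True[symmetric] step[OF FU E s] Suc.IH if_True simp_thms)
        also have "\<dots> = (sign (par i j \<and> s) * sign ((par i j \<and> odd m) \<and> s)) * (\<kappa> m * B (f ^ m) (e ^ m)) * B F E"
          by (simp only: ac_simps)
        finally show ?thesis
          unfolding sg fe[symmetric] using Suc True by (simp only: if_True simp_thms)
      next
        case False
        then have "B (F * f ^ Suc m) (E * e ^ k) = 0"
          by (simp only: Suc step[OF FU E s] Suc.IH if_False mult_zero_right)
        with Suc False show ?thesis by simp
      qed
    qed
  qed
qed

lemma pairing_powers_nonzero: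
  assumes "par i j \<longrightarrow> m \<le> 1"
  shows "B (f ^ m) (e ^ m) \<noteq> 0"
proof -
  obtain \<kappa> where \<kappa>: "\<And>k. root_deriv i j (e ^ Suc k) = \<kappa> k *\<^sub>Q e ^ k"
    "\<And>k. \<not> par i j \<or> k = 0 \<Longrightarrow> \<kappa> k \<noteq> 0"
    using root_deriv_powers by metis
  show ?thesis
    using assms
  proof (induction m)
    case 0
    then show ?case
      by (simp add: B_one_left[OF ge_closed(1)] rll_counit_hom)
  next
    case (Suc m)
    have "B (f ^ Suc m) (e ^ Suc m) = B (f ^ m * f) (e ^ Suc m)"
      by (simp only: power_Suc2)
    also have "\<dots> = B (f ^ m) (root_deriv i j (e ^ Suc m))"
      by (intro pairing_root_deriv e_in)
    also have "\<dots> = \<kappa> m * B (f ^ m) (e ^ m)"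
      unfolding \<kappa>(1) by (intro B_scale_right e_in)
    finally have "B (f ^ Suc m) (e ^ Suc m) = \<kappa> m * B (f ^ m) (e ^ m)" .
    moreover have "\<kappa> m \<noteq> 0"
      by (rule \<kappa>(2)) (use Suc.prems in auto)
    moreover have "B (f ^ m) (e ^ m) \<noteq> 0"
      by (rule Suc.IH) (use Suc.prems in auto)
    ultimately show ?case
      by (simp only: mult_eq_0_iff simp_thms)
  qed
qed

end

end

section \<open>Orthogonality of ordered monomials\<close>

lemma positive_roots:
  "sorted_wrt (<) (positive_roots :: ('n::super_index \<times> 'n) list)"
  "set (positive_roots :: ('n \<times> 'n) list) = {(i, j). i < j}"
  "distinct (positive_roots :: ('n \<times> 'n) list)"
  by (simp_all add: positive_roots_def strict_sorted_iff)

lemma monomial_hull: "monomial x rs \<kappa> \<in> subalgebra hull (x ` set rs)"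
proof (induction rs)
  case Nil
  show ?case
    using subalgebraD(1)[OF subalgebra_hull] by simp
next
  case (Cons \<gamma> rs)
  note A = subalgebraD[OF subalgebra_hull[of "x ` set (\<gamma> # rs)"]]
  have "monomial x rs \<kappa> \<in> subalgebra hull (x ` set (\<gamma> # rs))"
    using Cons hull_mono[of "x ` set rs" "x ` set (\<gamma> # rs)" subalgebra] by auto
  moreover have "x \<gamma> \<in> subalgebra hull (x ` set (\<gamma> # rs))"
    by (intro hull_inc imageI) simp
  ultimately show ?case
    unfolding monomial_simps by (intro A)
qed

lemma hull_image_mono:
  assumes "S \<subseteq> T" "y \<in> subalgebra hull (x ` S)"
  shows "y \<in> subalgebra hull (x ` T)"
  using hull_mono[OF image_mono[OF assms(1), of x], of subalgebra] assms(2) by blast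

text \<open>The parities of \<open>e\<^sub>\<gamma>\<close> and \<open>f\<^sub>\<gamma>\<close> agree, so a common parity can be used for both monomials when comparing
  signs.\<close>

lemma homogeneous_monomials: "\<exists>s. homogeneous s (monomial ebar rs \<kappa>) \<and> homogeneous s (monomial fbar rs \<kappa>)"
proof (induction rs)
  case Nil
  show ?case
    by (intro exI[of _ False]) (simp add: hcomp_one)
next
  case (Cons \<gamma> rs)
  then obtain s where s: "homogeneous s (monomial ebar rs \<kappa>)" "homogeneous s (monomial fbar rs \<kappa>)"
    by blast
  obtain i j where "\<gamma> = (i, j)" by fastforce
  then show ?case
    using homogeneous_mult[OF s(1) homogeneous_power[OF homogeneous_bar(1)[of i j], of "\<kappa> \<gamma>"]]
      homogeneous_mult[OF s(2) homogeneous_power[OF homogeneous_bar(2)[of i j], of "\<kappa> \<gamma>"]]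
    unfolding monomial_simps by blast
qed

text \<open>The \<open>k\<close>-th summand of the factor of the root \<open>\<gamma>\<close>, for the rescaled root vectors.\<close>

definition pure_factor ::
    "('n::super_index rll \<Rightarrow> 'n rll \<Rightarrow> cq) \<Rightarrow> 'n \<times> 'n \<Rightarrow> nat \<Rightarrow> ('n rll, 'n rll) tensor"
  where "pure_factor B \<gamma> k = inverse (B (fbar \<gamma> ^ k) (ebar \<gamma> ^ k)) *\<^sub>Q ((ebar \<gamma> ^ k) \<otimes> (fbar \<gamma> ^ k))"

lemma power_scaleQ: "(c *\<^sub>Q x) ^ k = c ^ k *\<^sub>Q (x :: 'a::cq_superalgebra) ^ k"
  by (induction k) (simp_all add: scaleQ_mult_left scaleQ_mult_right mult.commute)

lemma root_vectors_bar:
  fixes i j :: "'n::super_index"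
  obtains a b where "a \<noteq> 0" "root_e i j = a *\<^sub>Q ebar (i, j)" "b \<noteq> 0" "root_f j i = b *\<^sub>Q fbar (i, j)"
proof
  let ?a = "sign (odd_index i \<and> odd_index j) * qq powi (- eps_form i i) * (qq - inverse qq)"
  let ?b = "- (\<Prod>k\<in>{i..<j}. sign (odd_index k)) * sign (odd_index i \<and> odd_index j)
        * qq powi (eps_form i i) * (qq - inverse qq)"
  have "(\<Prod>k\<in>{i..<j}. sign (odd_index k)) \<noteq> 0"
    by simp
  then have "?a \<noteq> 0" "?b \<noteq> 0"
    by (simp_all only: qdiff_def[symmetric] mult_eq_0_iff neg_equal_0_iff_equal power_int_eq_0_iff qq_nonzero
        qdiff_nonzero sign_nonzero simp_thms)
  then show "inverse ?a \<noteq> 0" "inverse ?b \<noteq> 0"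
    by (simp_all only: inverse_nonzero_iff_nonzero not_False_eq_True)
  show "root_e i j = inverse ?a *\<^sub>Q ebar (i, j)" "root_f j i = inverse ?b *\<^sub>Q fbar (i, j)"
    by (simp_all only: root_e_def root_f_def ebar_def fbar_def case_prod_conv)
qed

lemma
  shows U_gt_bar: "(U_gt :: 'n::super_index rll set) = subalgebra hull (ebar ` set positive_roots)"
    and U_lt_bar: "(U_lt :: 'n rll set) = subalgebra hull (fbar ` set positive_roots)"
proof -
  have scaled: "subalgebra hull {y i j | i j. i < j} = subalgebra hull (x ` set positive_roots)"
    if scaled: "\<And>i j. \<exists>c. c \<noteq> 0 \<and> y i j = c *\<^sub>Q x (i, j)"
    for x :: "'n \<times> 'n \<Rightarrow> 'n rll" and y
  proof (rule antisym; rule hull_minimal[where S = subalgebra])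
    show "subalgebra (subalgebra hull (x ` set positive_roots))" "subalgebra (subalgebra hull {y i j | i j. i < j})"
      by (rule subalgebra_hull)+
    show "{y i j | i j. i < j} \<subseteq> subalgebra hull (x ` set positive_roots)"
    proof safe
      fix i j :: 'n
      assume "i < j"
      then have "x (i, j) \<in> subalgebra hull (x ` set positive_roots)"
        by (intro hull_inc imageI) (simp add: positive_roots)
      moreover obtain c where "y i j = c *\<^sub>Q x (i, j)"
        using scaled by blast
      ultimately show "y i j \<in> subalgebra hull (x ` set positive_roots)"
        by (simp only: subalgebraD(4)[OF subalgebra_hull])
    qed
    show "x ` set positive_roots \<subseteq> subalgebra hull {y i j | i j. i < j}"
    proof (rule image_subsetI)
      fix \<gamma> :: "'n \<times> 'n"
      assume "\<gamma> \<in> set positive_roots"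
      then obtain i j where ij: "\<gamma> = (i, j)" "i < j"
        by (auto simp: positive_roots)
      obtain c where c: "c \<noteq> 0" "y i j = c *\<^sub>Q x (i, j)"
        using scaled by blast
      have "y i j \<in> subalgebra hull {y i j | i j. i < j}"
        using ij(2) by (intro hull_inc) blast
      then have "inverse c *\<^sub>Q y i j \<in> subalgebra hull {y i j | i j. i < j}"
        by (rule subalgebraD(4)[OF subalgebra_hull])
      moreover have "inverse c *\<^sub>Q y i j = x \<gamma>"
        by (simp only: c(2) ij(1) scaleQ_scaleQ left_inverse[OF c(1)] scaleQ_one)
      ultimately show "x \<gamma> \<in> subalgebra hull {y i j | i j. i < j}"
        by simp
    qed
  qed
  have "\<exists>c. c \<noteq> 0 \<and> root_e i j = c *\<^sub>Q ebar (i, j)" "\<exists>c. c \<noteq> 0 \<and> root_f j i = c *\<^sub>Q fbar (i, j)"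
    for i j :: 'n
    by (rule root_vectors_bar[of i j], blast)+
  then show "U_gt = subalgebra hull (ebar ` set (positive_roots :: ('n \<times> 'n) list))"
    "U_lt = subalgebra hull (fbar ` set (positive_roots :: ('n \<times> 'n) list))"
    unfolding U_gt_def U_lt_def by (intro scaled; blast)+
qed

lemma monomials_span:
  assumes "straightening x"
  shows "cq.span (monomial x positive_roots ` exponents positive_roots) = subalgebra hull (x ` set positive_roots)"
proof (rule antisym)
  show "cq.span (monomial x positive_roots ` exponents positive_roots) \<subseteq> subalgebra hull (x ` set positive_roots)"
    by (rule cq.span_minimal) (auto simp: monomial_hull subalgebra_subspace subalgebra_hull)
  show "subalgebra hull (x ` set positive_roots) \<subseteq> cq.span (monomial x positive_roots ` exponents positive_roots)"
    by (rule ordered_monomials_span[OF assms positive_roots(1)]) (auto simp: positive_roots roots_above_def)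
qed

context rll_paired
begin

lemma pairing_monomials_peel:
  assumes rs: "sorted_wrt (<) ((i, j) # rs)" "set ((i, j) # rs) \<subseteq> set positive_roots"
    and s: "homogeneous s (monomial ebar rs \<kappa>')"
  shows "B (monomial fbar ((i, j) # rs) \<kappa>) (monomial ebar ((i, j) # rs) \<kappa>')
    = (if \<kappa> (i, j) = \<kappa>' (i, j) then sign ((par i j \<and> odd (\<kappa> (i, j))) \<and> s)
        * B (fbar (i, j) ^ \<kappa> (i, j)) (ebar (i, j) ^ \<kappa> (i, j))
        * B (monomial fbar rs \<kappa>) (monomial ebar rs \<kappa>') else 0)"
proof -
  have ij: "i < j"
    using rs(2) by (simp add: positive_roots)
  have above: "set rs \<subseteq> roots_above (i, j)"
  proof
    fix \<delta>
    assume "\<delta> \<in> set rs"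
    then have "(i, j) < \<delta>" "\<delta> \<in> set positive_roots"
      using rs by auto
    then show "\<delta> \<in> roots_above (i, j)"
      by (simp add: roots_above_def positive_roots case_prod_unfold)
  qed
  show ?thesis
    unfolding monomial_simps by (rule pairing_peel[OF ij hull_image_mono[OF above monomial_hull] hull_image_mono[OF above monomial_hull] s])
qed

lemma pairing_monomials_distinct:
  assumes "sorted_wrt (<) rs" "set rs \<subseteq> set positive_roots" "\<gamma> \<in> set rs" "\<kappa> \<gamma> \<noteq> \<kappa>' \<gamma>"
  shows "B (monomial fbar rs \<kappa>) (monomial ebar rs \<kappa>') = 0"
  using assms
proof (induction rs)
  case (Cons \<delta> rs)
  obtain i j where ij: "\<delta> = (i, j)" by fastforce
  obtain s where s: "homogeneous s (monomial ebar rs \<kappa>')"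
    using homogeneous_monomials by blast
  note peel = pairing_monomials_peel[OF Cons.prems(1,2)[unfolded ij] s, of \<kappa>, folded ij]
  show ?case
  proof (cases "\<gamma> = \<delta>")
    case True
    then show ?thesis
      using Cons.prems(4) by (simp only: peel if_False)
  next
    case False
    then have "B (monomial fbar rs \<kappa>) (monomial ebar rs \<kappa>') = 0"
      using Cons.prems by (intro Cons.IH) auto
    then show ?thesis
      by (simp only: peel mult_zero_right if_cancel)
  qed
qed simp

lemma pairing_monomials_nonzero:
  assumes "sorted_wrt (<) rs" "set rs \<subseteq> set positive_roots" "\<And>i j. par i j \<Longrightarrow> \<kappa> (i, j) \<le> 1"
  shows "B (monomial fbar rs \<kappa>) (monomial ebar rs \<kappa>) \<noteq> 0"
  using assms(1,2)
proof (induction rs)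
  case Nil
  show ?case
    by (simp add: B_one_left[OF ge_closed(1)] rll_counit_hom)
next
  case (Cons \<delta> rs)
  obtain i j where ij: "\<delta> = (i, j)" by fastforce
  obtain s where s: "homogeneous s (monomial ebar rs \<kappa>)"
    using homogeneous_monomials by blast
  have "i < j"
    using Cons.prems(2) by (simp add: ij positive_roots)
  then have "B (fbar (i, j) ^ \<kappa> (i, j)) (ebar (i, j) ^ \<kappa> (i, j)) \<noteq> 0"
    using assms(3) by (intro pairing_powers_nonzero) blast+
  moreover have "B (monomial fbar rs \<kappa>) (monomial ebar rs \<kappa>) \<noteq> 0"
    using Cons.prems by (intro Cons.IH) auto
  ultimately show ?case
    unfolding ij
    by (simp only: pairing_monomials_peel[OF Cons.prems[unfolded ij] s] if_True mult_eq_0_iff sign_nonzero simp_thms)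
qed

text \<open>The sign from \<open>(E \<otimes> F) (e\<^sup>k \<otimes> f\<^sup>k) = \<plusminus> E e\<^sup>k \<otimes> F f\<^sup>k\<close> is the sign in \<open>pairing_monomials_peel\<close>, as \<open>E\<close> and \<open>F\<close> have
  the same parity.\<close>

lemma prod_pure_factors:
  assumes "sorted_wrt (<) rs" "set rs \<subseteq> set positive_roots"
  shows "prod_list (map (\<lambda>\<gamma>. pure_factor B \<gamma> (\<kappa> \<gamma>)) (rev rs))
      = inverse (B (monomial fbar rs \<kappa>) (monomial ebar rs \<kappa>)) *\<^sub>Q (monomial ebar rs \<kappa> \<otimes> monomial fbar rs \<kappa>)"
  using assms
proof (induction rs)
  case Nil
  show ?case
    by (simp add: B_one_left[OF ge_closed(1)] rll_counit_hom one_tensor_def)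
next
  case (Cons \<delta> rs)
  obtain i j where ij: "\<delta> = (i, j)" by fastforce
  obtain s where s: "homogeneous s (monomial ebar rs \<kappa>)" "homogeneous s (monomial fbar rs \<kappa>)"
    using homogeneous_monomials by blast
  let ?n = "B (monomial fbar rs \<kappa>) (monomial ebar rs \<kappa>)"
  let ?b = "B (fbar (i, j) ^ \<kappa> (i, j)) (ebar (i, j) ^ \<kappa> (i, j))"
  have IH: "prod_list (map (\<lambda>\<gamma>. pure_factor B \<gamma> (\<kappa> \<gamma>)) (rev rs))
      = inverse ?n *\<^sub>Q (monomial ebar rs \<kappa> \<otimes> monomial fbar rs \<kappa>)"
    using Cons.prems by (intro Cons.IH) auto
  have "prod_list (map (\<lambda>\<gamma>. pure_factor B \<gamma> (\<kappa> \<gamma>)) (rev (\<delta> # rs)))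
      = prod_list (map (\<lambda>\<gamma>. pure_factor B \<gamma> (\<kappa> \<gamma>)) (rev rs)) * pure_factor B (i, j) (\<kappa> (i, j))"
    by (simp add: ij)
  also have "\<dots> = (inverse ?n *\<^sub>Q (monomial ebar rs \<kappa> \<otimes> monomial fbar rs \<kappa>))
      * (inverse ?b *\<^sub>Q ((ebar (i, j) ^ \<kappa> (i, j)) \<otimes> (fbar (i, j) ^ \<kappa> (i, j))))"
    by (simp only: IH) (simp only: pure_factor_def)
  also have "\<dots> = (inverse ?b * (inverse ?n * sign (s \<and> (par i j \<and> odd (\<kappa> (i, j)))))) *\<^sub>Q
      (monomial ebar (\<delta> # rs) \<kappa> \<otimes> monomial fbar (\<delta> # rs) \<kappa>)"
    unfolding scaleQ_mult_left scaleQ_mult_right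
      tensor_mult_homogeneous[OF s(2) homogeneous_power[OF homogeneous_bar(1)]]
    by (simp only: scaleQ_scaleQ monomial_simps ij mult.assoc)
  also have "inverse ?b * (inverse ?n * sign (s \<and> (par i j \<and> odd (\<kappa> (i, j)))))
      = inverse (B (monomial fbar (\<delta> # rs) \<kappa>) (monomial ebar (\<delta> # rs) \<kappa>))"
  proof -
    have "(s \<and> (par i j \<and> odd (\<kappa> (i, j)))) = ((par i j \<and> odd (\<kappa> (i, j))) \<and> s)"
      by blast
    then show ?thesis
      unfolding ij
      by (simp only: pairing_monomials_peel[OF Cons.prems[unfolded ij] s(1)] if_True simp_thms
          inverse_mult_distrib inverse_sign ac_simps)
  qed
  finally show ?case .
qed

end

section \<open>Products of completed series\<close>

text \<open>Sorting the pairs of summands by the weight of the first member recovers the convolution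
  over weights.\<close>

lemma completed_mult_families:
  fixes x :: "'i \<Rightarrow> ('n::super_index rll, 'n rll) tensor" and y :: "'j \<Rightarrow> ('n rll, 'n rll) tensor"
  assumes fin: "finite {(a, b). a \<in> I \<and> b \<in> J \<and> u a + v b = \<nu>}" (is "finite ?S")
  shows "completed_mult (\<lambda>\<mu>. \<Sum>a | a \<in> I \<and> u a = \<mu>. x a) (\<lambda>\<mu>. \<Sum>b | b \<in> J \<and> v b = \<mu>. y b) \<nu>
    = (\<Sum>(a, b) | a \<in> I \<and> b \<in> J \<and> u a + v b = \<nu>. x a * y b)"
proof -
  let ?X = "\<lambda>\<mu>. \<Sum>a | a \<in> I \<and> u a = \<mu>. x a" and ?Y = "\<lambda>\<mu>. \<Sum>b | b \<in> J \<and> v b = \<mu>. y b"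
  let ?M = "(\<lambda>p. u (fst p)) ` ?S"
  have part: "?X \<mu> * ?Y (\<nu> - \<mu>) = (\<Sum>p | p \<in> ?S \<and> u (fst p) = \<mu>. x (fst p) * y (snd p))" for \<mu>
  proof -
    have "?X \<mu> * ?Y (\<nu> - \<mu>) = (\<Sum>p\<in>{a \<in> I. u a = \<mu>} \<times> {b \<in> J. v b = \<nu> - \<mu>}. x (fst p) * y (snd p))"
      by (simp add: sum_product sum.cartesian_product case_prod_unfold)
    also have "{a \<in> I. u a = \<mu>} \<times> {b \<in> J. v b = \<nu> - \<mu>} = {p. p \<in> ?S \<and> u (fst p) = \<mu>}"
      by (auto simp: algebra_simps)
    finally show ?thesis .
  qed
  have "completed_mult ?X ?Y \<nu> = (\<Sum>\<mu>\<in>?M. ?X \<mu> * ?Y (\<nu> - \<mu>))"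
    unfolding completed_mult_def
  proof (rule Sum_any.expand_superset)
    show "finite ?M" using fin by simp
    show "{\<mu>. ?X \<mu> * ?Y (\<nu> - \<mu>) \<noteq> 0} \<subseteq> ?M"
    proof
      fix \<mu>
      assume "\<mu> \<in> {\<mu>. ?X \<mu> * ?Y (\<nu> - \<mu>) \<noteq> 0}"
      then have "{p. p \<in> ?S \<and> u (fst p) = \<mu>} \<noteq> {}"
        unfolding part by (metis (mono_tags, lifting) mem_Collect_eq sum.empty)
      then show "\<mu> \<in> ?M" by blast
    qed
  qed
  also have "\<dots> = (\<Sum>\<mu>\<in>?M. \<Sum>p | p \<in> ?S \<and> u (fst p) = \<mu>. x (fst p) * y (snd p))"
    by (simp only: part)
  also have "\<dots> = (\<Sum>p\<in>?S. x (fst p) * y (snd p))"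
    by (rule sum.group) (use fin in auto)
  finally show ?thesis
    by (simp only: case_prod_unfold)
qed

text \<open>Minus the number of indices below \<open>i\<close>, extended linearly from \<open>\<epsilon>\<^sub>i\<close>: any additive function that is
  positive on positive roots shows that a weight has only finitely many expressions.\<close>

definition height :: "'n::super_index weight \<Rightarrow> int"
  where "height \<nu> = (\<Sum>i\<in>UNIV. Poly_Mapping.lookup \<nu> i * - int (card {..<i}))"

lemma height_add: "height (\<mu> + \<nu>) = height \<mu> + height \<nu>"
  by (simp only: height_def lookup_add distrib_right sum.distrib)

lemma height_cmul: "height (frag_cmul c \<nu>) = c * height \<nu>"
  by (simp add: height_def sum_distrib_left mult.assoc)

lemma height_root: "height (root i j) = int (card {..<j}) - int (card {..<i})"
proof -
  have "height (root i j) = (\<Sum>k\<in>UNIV. (if k = i then - int (card {..<k}) else 0) + (if k = j then int (card {..<k}) else 0))"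
    unfolding height_def root_def by (rule sum.cong) (auto simp: lookup_minus)
  then show ?thesis
    by (simp add: sum.distrib)
qed

lemma height_root_pos:
  fixes i j :: "'n::super_index"
  assumes "i < j"
  shows "1 \<le> height (root i j)"
proof -
  have "card {..<i} < card {..<j}"
    by (rule psubset_card_mono) (use assms in auto)
  then show ?thesis
    by (simp add: height_root)
qed

definition weight :: "('n::super_index \<times> 'n) list \<Rightarrow> ('n \<times> 'n \<Rightarrow> nat) \<Rightarrow> 'n weight"
  where "weight ds \<kappa> = (\<Sum>\<gamma>\<leftarrow>ds. frag_cmul (int (\<kappa> \<gamma>)) (root (fst \<gamma>) (snd \<gamma>)))"

lemma height_weight_bound:
  assumes "\<gamma> \<in> set ds" "set ds \<subseteq> {(i, j). i < j}"
  shows "int (\<kappa> \<gamma>) \<le> height (weight ds \<kappa>)"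
proof -
  have pos: "0 \<le> height (frag_cmul (int (\<kappa> \<delta>)) (root (fst \<delta>) (snd \<delta>)))"
    "int (\<kappa> \<delta>) \<le> height (frag_cmul (int (\<kappa> \<delta>)) (root (fst \<delta>) (snd \<delta>)))"
    if "fst \<delta> < snd \<delta>" for \<delta> :: "'a \<times> 'a"
  proof -
    have h: "1 \<le> height (root (fst \<delta>) (snd \<delta>))"
      by (rule height_root_pos[OF that])
    show "int (\<kappa> \<delta>) \<le> height (frag_cmul (int (\<kappa> \<delta>)) (root (fst \<delta>) (snd \<delta>)))"
      using mult_left_mono[OF h, of "int (\<kappa> \<delta>)"] by (simp add: height_cmul)
    then show "0 \<le> height (frag_cmul (int (\<kappa> \<delta>)) (root (fst \<delta>) (snd \<delta>)))"
      by linarith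
  qed
  have nonneg: "0 \<le> height (weight ds \<kappa>)" if "set ds \<subseteq> {(i, j). i < j}" for ds
    using that
  proof (induction ds)
    case Nil
    show ?case by (simp add: weight_def height_def)
  next
    case (Cons \<delta> ds)
    then show ?case
      using pos(1)[of \<delta>] by (auto simp: weight_def height_add)
  qed
  show ?thesis
    using assms
  proof (induction ds)
    case (Cons \<delta> ds)
    have d: "fst \<delta> < snd \<delta>" "set ds \<subseteq> {(i, j). i < j}"
      using Cons.prems(2) by auto
    have w: "height (weight (\<delta> # ds) \<kappa>)
        = height (frag_cmul (int (\<kappa> \<delta>)) (root (fst \<delta>) (snd \<delta>))) + height (weight ds \<kappa>)"
      by (simp add: weight_def height_add)
    show ?case
    proof (cases "\<gamma> = \<delta>")
      case True
      then show ?thesis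
        unfolding w True using pos(2)[OF d(1)] nonneg[OF d(2)] by linarith
    next
      case False
      then have "int (\<kappa> \<gamma>) \<le> height (weight ds \<kappa>)"
        using Cons.prems(1) d(2) by (intro Cons.IH) auto
      then show ?thesis
        unfolding w using pos(1)[OF d(1)] by linarith
    qed
  qed simp
qed

lemma finite_weight_fibre:
  assumes "set ds \<subseteq> {(i, j). i < j}"
  shows "finite {\<kappa> \<in> exponents ds. weight ds \<kappa> = \<nu>}"
proof (rule finite_subset)
  show "finite {\<kappa>. \<forall>\<gamma>. (\<gamma> \<in> set ds \<longrightarrow> \<kappa> \<gamma> \<in> {..nat (height \<nu>)}) \<and> (\<gamma> \<notin> set ds \<longrightarrow> \<kappa> \<gamma> = 0)}"
    by (rule finite_set_of_finite_funs) simp_all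
  show "{\<kappa> \<in> exponents ds. weight ds \<kappa> = \<nu>}
      \<subseteq> {\<kappa>. \<forall>\<gamma>. (\<gamma> \<in> set ds \<longrightarrow> \<kappa> \<gamma> \<in> {..nat (height \<nu>)}) \<and> (\<gamma> \<notin> set ds \<longrightarrow> \<kappa> \<gamma> = 0)}"
  proof
    fix \<kappa>
    assume \<kappa>: "\<kappa> \<in> {\<kappa> \<in> exponents ds. weight ds \<kappa> = \<nu>}"
    have "\<kappa> \<gamma> \<le> nat (height \<nu>)" if "\<gamma> \<in> set ds" for \<gamma>
      using height_weight_bound[OF that assms, of \<kappa>] \<kappa> by simp
    moreover have "\<kappa> \<gamma> = 0" if "\<gamma> \<notin> set ds" for \<gamma>
      using \<kappa> that unfolding exponents_def by blast
    ultimately show "\<kappa> \<in> {\<kappa>. \<forall>\<gamma>. (\<gamma> \<in> set ds \<longrightarrow> \<kappa> \<gamma> \<in> {..nat (height \<nu>)}) \<and> (\<gamma> \<notin> set ds \<longrightarrow> \<kappa> \<gamma> = 0)}"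
      by simp
  qed
qed

text \<open>Distributivity for the completed product.  The exponent of the first root of the list is split
  off, and the finiteness of the fibres of the weight makes the sums meaningful.\<close>

lemma completed_product:
  fixes F :: "'n::super_index \<times> 'n \<Rightarrow> 'n completed" and t :: "'n \<times> 'n \<Rightarrow> nat \<Rightarrow> ('n rll, 'n rll) tensor"
  assumes F: "\<And>i j \<nu>. i < j \<Longrightarrow> F (i, j) \<nu> = (\<Sum>k | (par i j \<longrightarrow> k \<le> 1) \<and> frag_cmul (int k) (root i j) = \<nu>. t (i, j) k)"
    and "distinct ds" "set ds \<subseteq> {(i, j). i < j}"
  shows "foldr completed_mult (map F ds) completed_one
    = (\<lambda>\<nu>. \<Sum>\<kappa> | \<kappa> \<in> exponents ds \<and> weight ds \<kappa> = \<nu>. prod_list (map (\<lambda>\<gamma>. t \<gamma> (\<kappa> \<gamma>)) ds))"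
  using assms(2,3)
proof (induction ds)
  case Nil
  have "{\<kappa>. \<kappa> \<in> exponents ([] :: ('n \<times> 'n) list) \<and> weight [] \<kappa> = \<nu>} = (if \<nu> = 0 then {\<lambda>_. 0} else {})" for \<nu>
    by (auto simp: exponents_def weight_def)
  then show ?case
    by (intro ext) (simp add: completed_one_def)
next
  case (Cons \<gamma> ds)
  obtain i j where ij: "\<gamma> = (i, j)" "i < j"
    using Cons.prems by auto
  have ds: "set ds \<subseteq> {(i, j). i < j}" "\<gamma> \<notin> set ds"
    using Cons.prems by auto
  let ?K = "{k :: nat. par i j \<longrightarrow> k \<le> 1}"
  let ?u = "\<lambda>k. frag_cmul (int k) (root i j)"
  let ?p = "\<lambda>\<kappa>. prod_list (map (\<lambda>\<gamma>. t \<gamma> (\<kappa> \<gamma>)) ds)"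
  have w: "weight (\<gamma> # ds) \<kappa> = ?u (\<kappa> \<gamma>) + weight ds \<kappa>" for \<kappa>
    by (simp add: weight_def ij)
  have upd: "weight ds (\<kappa>(\<gamma> := k)) = weight ds \<kappa>" "?p (\<kappa>(\<gamma> := k)) = ?p \<kappa>" for \<kappa> k
    unfolding weight_def using ds(2)
    by (intro arg_cong[of _ _ sum_list] arg_cong[of _ _ prod_list] map_cong refl; force)+
  have ex: "\<kappa>(\<gamma> := k) \<in> exponents (\<gamma> # ds)" if "\<kappa> \<in> exponents ds" "k \<in> ?K" for \<kappa> k
    using that by (auto simp: exponents_def ij)
  have ex0: "\<kappa>(\<gamma> := 0) \<in> exponents ds" "\<kappa> \<gamma> \<in> ?K" if "\<kappa> \<in> exponents (\<gamma> # ds)" for \<kappa>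
    using that by (auto simp: exponents_def ij)
  have exz: "\<kappa> \<gamma> = 0" if "\<kappa> \<in> exponents ds" for \<kappa>
    using that ds(2) unfolding exponents_def by blast
  let ?S = "\<lambda>\<nu>. {(k, \<kappa>). k \<in> ?K \<and> \<kappa> \<in> exponents ds \<and> ?u k + weight ds \<kappa> = \<nu>}"
  let ?T = "\<lambda>\<nu>. {\<kappa>. \<kappa> \<in> exponents (\<gamma> # ds) \<and> weight (\<gamma> # ds) \<kappa> = \<nu>}"
  \<comment> \<open>An exponent function on \<open>\<gamma> # ds\<close> is the same as its value at \<open>\<gamma>\<close> and one on \<open>ds\<close>.\<close>
  have bij: "bij_betw (\<lambda>\<kappa>. (\<kappa> \<gamma>, \<kappa>(\<gamma> := 0))) (?T \<nu>) (?S \<nu>)" for \<nu>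
  proof (rule bij_betw_byWitness[where f' = "\<lambda>(k, \<kappa>). \<kappa>(\<gamma> := k)"])
    show "\<forall>\<kappa>\<in>?T \<nu>. (case (\<kappa> \<gamma>, \<kappa>(\<gamma> := 0)) of (k, \<kappa>) \<Rightarrow> \<kappa>(\<gamma> := k)) = \<kappa>"
      by simp
    show "\<forall>p\<in>?S \<nu>. ((case p of (k, \<kappa>) \<Rightarrow> \<kappa>(\<gamma> := k)) \<gamma>, (case p of (k, \<kappa>) \<Rightarrow> \<kappa>(\<gamma> := k))(\<gamma> := 0)) = p"
      using exz by (auto simp: fun_upd_idem)
    show "(\<lambda>\<kappa>. (\<kappa> \<gamma>, \<kappa>(\<gamma> := 0))) ` ?T \<nu> \<subseteq> ?S \<nu>"
      using ex0 by (auto simp: w upd)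
    show "(\<lambda>(k, \<kappa>). \<kappa>(\<gamma> := k)) ` ?S \<nu> \<subseteq> ?T \<nu>"
      using ex by (auto simp: w upd)
  qed
  have "set (\<gamma> # ds) \<subseteq> {(i, j). i < j}"
    using ds ij by auto
  note fT = finite_weight_fibre[OF this]
  have "foldr completed_mult (map F (\<gamma> # ds)) completed_one \<nu>
      = completed_mult (\<lambda>\<mu>. \<Sum>k | k \<in> ?K \<and> ?u k = \<mu>. t \<gamma> k)
          (\<lambda>\<mu>. \<Sum>\<kappa> | \<kappa> \<in> exponents ds \<and> weight ds \<kappa> = \<mu>. ?p \<kappa>) \<nu>" for \<nu>
  proof -
    have "F \<gamma> = (\<lambda>\<mu>. \<Sum>k | k \<in> ?K \<and> ?u k = \<mu>. t \<gamma> k)"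
      unfolding ij(1) by (rule ext) (simp add: F[OF ij(2)])
    moreover have "foldr completed_mult (map F ds) completed_one = (\<lambda>\<mu>. \<Sum>\<kappa> | \<kappa> \<in> exponents ds \<and> weight ds \<kappa> = \<mu>. ?p \<kappa>)"
      using Cons.prems by (intro Cons.IH) auto
    ultimately show ?thesis
      by simp
  qed
  also have "\<dots> \<nu> = (\<Sum>(k, \<kappa>)\<in>?S \<nu>. t \<gamma> k * ?p \<kappa>)" for \<nu>
  proof (rule completed_mult_families)
    show "finite (?S \<nu>)"
      using bij_betw_finite[OF bij] fT by simp
  qed
  also have "\<dots> \<nu> = (\<Sum>\<kappa>\<in>?T \<nu>. t \<gamma> (\<kappa> \<gamma>) * ?p \<kappa>)" for \<nu>
    using sum.reindex_bij_betw[OF bij, of "\<lambda>(k, \<kappa>). t \<gamma> k * ?p \<kappa>" \<nu>, symmetric]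
    by (simp only: case_prod_conv upd)
  finally show ?case
    by (intro ext) simp
qed

section \<open>Dual bases and the canonical element\<close>

abbreviation e_mon :: "('n::super_index \<times> 'n \<Rightarrow> nat) \<Rightarrow> 'n rll"
  where "e_mon \<equiv> monomial ebar positive_roots"

abbreviation f_mon :: "('n::super_index \<times> 'n \<Rightarrow> nat) \<Rightarrow> 'n rll"
  where "f_mon \<equiv> monomial fbar positive_roots"

abbreviation PBW :: "('n::super_index \<times> 'n \<Rightarrow> nat) set"
  where "PBW \<equiv> exponents positive_roots"

abbreviation wt :: "('n::super_index \<times> 'n \<Rightarrow> nat) \<Rightarrow> 'n weight"
  where "wt \<equiv> weight positive_roots"

text \<open>Rescaling \<open>e\<close> and \<open>f\<close> multiplies \<open>e\<^sup>k \<otimes> f\<^sup>k\<close> and \<open>(f\<^sup>k, e\<^sup>k)\<close> by the same scalar.\<close>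

lemma root_factor_pure:
  assumes B: "rll_pairing B" and "i < j"
  shows "root_factor B (i, j) \<nu>
    = (\<Sum>k | (par i j \<longrightarrow> k \<le> 1) \<and> frag_cmul (int k) (root i j) = \<nu>. pure_factor B (i, j) k)"
proof -
  interpret rll_paired B by unfold_locales (rule B)
  obtain a b where ab: "a \<noteq> 0" "root_e i j = a *\<^sub>Q ebar (i, j)" "b \<noteq> 0" "root_f j i = b *\<^sub>Q fbar (i, j)"
    by (rule root_vectors_bar)
  have "inverse (B (root_f j i ^ k) (root_e i j ^ k)) *\<^sub>Q ((root_e i j ^ k) \<otimes> (root_f j i ^ k)) = pure_factor B (i, j) k" for k
  proof -
    let ?e = "ebar (i, j) ^ k" and ?f = "fbar (i, j) ^ k"
    have in_U: "?e \<in> U_ge" "?f \<in> U_le"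
      by (intro ge_closed le_closed ebar_in fbar_in)+
    have "B (b ^ k *\<^sub>Q ?f) (a ^ k *\<^sub>Q ?e) = b ^ k * (a ^ k * B ?f ?e)"
      by (simp only: B_scale_left[OF in_U(2) ge_closed(4)[OF in_U(1)]] B_scale_right[OF in_U(2,1)])
    then have "inverse (B (root_f j i ^ k) (root_e i j ^ k)) * (b ^ k * a ^ k)
        = inverse (b ^ k) * b ^ k * (inverse (a ^ k) * a ^ k) * inverse (B ?f ?e)"
      by (simp only: ab power_scaleQ inverse_mult_distrib ac_simps)
    also have "\<dots> = inverse (B ?f ?e)"
      by (simp only: left_inverse[OF power_not_zero[OF ab(1)]] left_inverse[OF power_not_zero[OF ab(3)]] mult_1_left)
    finally show ?thesis
      by (simp only: ab(2,4) power_scaleQ tens_scale_left tens_scale_right scaleQ_scaleQ pure_factor_def mult.assoc)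
  qed
  then show ?thesis
    by (simp only: root_factor_def case_prod_conv)
qed

lemma descending_product_monomials:
  fixes B :: "'n::super_index rll \<Rightarrow> 'n rll \<Rightarrow> cq"
  assumes B: "rll_pairing B"
  shows "descending_product (root_factor B) = (\<lambda>\<nu>. \<Sum>\<kappa> | \<kappa> \<in> PBW \<and> wt \<kappa> = \<nu>.
    inverse (B (f_mon \<kappa>) (e_mon \<kappa>)) *\<^sub>Q
      (e_mon \<kappa> \<otimes> f_mon \<kappa>))"
proof -
  interpret rll_paired B by unfold_locales (rule B)
  let ?\<Phi> = "positive_roots :: ('n \<times> 'n) list"
  have rev: "exponents (rev ?\<Phi>) = exponents ?\<Phi>" "weight (rev ?\<Phi>) = weight ?\<Phi>"
    by (auto simp: exponents_def weight_def fun_eq_iff rev_map[symmetric] sum_list_rev)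
  have "descending_product (root_factor B)
    = (\<lambda>\<nu>. \<Sum>\<kappa> | \<kappa> \<in> exponents (rev ?\<Phi>) \<and> weight (rev ?\<Phi>) \<kappa> = \<nu>.
        prod_list (map (\<lambda>\<gamma>. pure_factor B \<gamma> (\<kappa> \<gamma>)) (rev ?\<Phi>)))"
    unfolding descending_product_def
    by (rule completed_product) (simp_all add: root_factor_pure[OF B] positive_roots)
  then show ?thesis
    by (simp only: rev prod_pure_factors[OF positive_roots(1) order_refl])
qed

lemma rll_component_power: "x \<in> rll_component \<nu> \<Longrightarrow> x ^ k \<in> rll_component (frag_cmul (int k) \<nu>)"
proof (induction k)
  case 0
  then show ?case
    by (simp add: rll_component_closed)
next
  case (Suc k)
  then have "x * x ^ k \<in> rll_component (\<nu> + frag_cmul (int k) \<nu>)"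
    by (intro rll_component_closed)
  moreover have "frag_cmul (int (Suc k)) \<nu> = \<nu> + frag_cmul (int k) \<nu>"
    using frag_cmul_distrib[of 1 "int k" \<nu>] by simp
  ultimately show ?case
    by simp
qed

lemma rll_component_monomials:
  "monomial ebar rs \<kappa> \<in> rll_component (weight rs \<kappa>)" "monomial fbar rs \<kappa> \<in> rll_component (- weight rs \<kappa>)"
proof -
  have bar: "ebar \<gamma> \<in> rll_component (root (fst \<gamma>) (snd \<gamma>))" "fbar \<gamma> \<in> rll_component (- root (fst \<gamma>) (snd \<gamma>))"
    for \<gamma> :: "'a \<times> 'a"
  proof -
    have "lm (fst \<gamma>) (fst \<gamma>) * lp (fst \<gamma>) (snd \<gamma>) \<in> rll_component (root (fst \<gamma>) (fst \<gamma>) + root (fst \<gamma>) (snd \<gamma>))"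
      "lm (snd \<gamma>) (fst \<gamma>) * lp (fst \<gamma>) (fst \<gamma>) \<in> rll_component (root (snd \<gamma>) (fst \<gamma>) + root (fst \<gamma>) (fst \<gamma>))"
      by (intro rll_component_closed)+
    then show "ebar \<gamma> \<in> rll_component (root (fst \<gamma>) (snd \<gamma>))" "fbar \<gamma> \<in> rll_component (- root (fst \<gamma>) (snd \<gamma>))"
      by (simp_all add: ebar_def fbar_def case_prod_unfold root_def)
  qed
  show "monomial ebar rs \<kappa> \<in> rll_component (weight rs \<kappa>)"
  proof (induction rs)
    case (Cons \<gamma> rs)
    have "monomial ebar (\<gamma> # rs) \<kappa> \<in> rll_component (weight rs \<kappa> + frag_cmul (int (\<kappa> \<gamma>)) (root (fst \<gamma>) (snd \<gamma>)))"
      unfolding monomial_simps by (intro rll_component_closed(2) rll_component_power bar Cons)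
    then show ?case
      by (simp add: weight_def add.commute)
  qed (simp add: weight_def rll_component_closed)
  show "monomial fbar rs \<kappa> \<in> rll_component (- weight rs \<kappa>)"
  proof (induction rs)
    case (Cons \<gamma> rs)
    have "monomial fbar (\<gamma> # rs) \<kappa> \<in> rll_component (- weight rs \<kappa> + frag_cmul (int (\<kappa> \<gamma>)) (- root (fst \<gamma>) (snd \<gamma>)))"
      unfolding monomial_simps by (intro rll_component_closed(2) rll_component_power bar Cons)
    moreover have "frag_cmul c (- \<nu>) = - frag_cmul c \<nu>" for c and \<nu> :: "'a weight"
      by (rule poly_mapping_eqI) simp
    ultimately show ?case
      by (simp add: weight_def)
  qed (simp add: weight_def rll_component_closed)
qed

context rll_paired
begin

lemma U_gt_ge: "x \<in> U_gt \<Longrightarrow> x \<in> U_ge" and U_lt_le: "x \<in> U_lt \<Longrightarrow> x \<in> U_le"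
  by (simp_all add: U_gt_bar U_lt_bar hull_ebar_U_ge hull_fbar_U_le)

lemma B_sum_right: "a \<in> U_le \<Longrightarrow> (\<And>i. i \<in> S \<Longrightarrow> x i \<in> U_ge) \<Longrightarrow> B a (\<Sum>i\<in>S. c i *\<^sub>Q x i) = (\<Sum>i\<in>S. c i * B a (x i))"
proof (induction S rule: infinite_finite_induct)
  case (insert i S)
  have "(\<Sum>i\<in>S. c i *\<^sub>Q x i) \<in> U_ge"
    using insert.prems by (intro cq.subspace_sum cq.subspace_scale subalgebra_subspace U_ge_le_subalgebra) auto
  then show ?case
    using insert by (simp add: B_add_right B_scale_right ge_closed)
qed (simp_all add: B_zero)

lemma B_sum_left: "b \<in> U_ge \<Longrightarrow> (\<And>i. i \<in> S \<Longrightarrow> x i \<in> U_le) \<Longrightarrow> B (\<Sum>i\<in>S. c i *\<^sub>Q x i) b = (\<Sum>i\<in>S. c i * B (x i) b)"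
proof (induction S rule: infinite_finite_induct)
  case (insert i S)
  have "(\<Sum>i\<in>S. c i *\<^sub>Q x i) \<in> U_le"
    using insert.prems by (intro cq.subspace_sum cq.subspace_scale subalgebra_subspace U_ge_le_subalgebra) auto
  then show ?case
    using insert by (simp add: B_add_left B_scale_left le_closed)
qed (simp_all add: B_zero)

definition pbw_norm :: "('n \<times> 'n \<Rightarrow> nat) \<Rightarrow> cq"
  where "pbw_norm \<kappa> = B (f_mon \<kappa>) (e_mon \<kappa>)"

text \<open>Only meaningful on ordered monomials, from which \<open>\<kappa>\<close> can be recovered.\<close>

definition pbw_dual :: "'n rll \<Rightarrow> 'n rll"
  where "pbw_dual u = (let \<kappa> = the_inv_into PBW e_mon u
    in inverse (pbw_norm \<kappa>) *\<^sub>Q f_mon \<kappa>)"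

definition pbw_basis :: "'n rll set"
  where "pbw_basis = e_mon ` PBW"

lemma pbw_norm_nonzero: "\<kappa> \<in> PBW \<Longrightarrow> pbw_norm \<kappa> \<noteq> 0"
  unfolding pbw_norm_def
  by (rule pairing_monomials_nonzero[OF positive_roots(1) order_refl]) (auto simp: exponents_def)

lemma pbw_orthogonal:
  assumes "\<kappa> \<in> PBW" "\<kappa>' \<in> PBW"
  shows "B (f_mon \<kappa>) (e_mon \<kappa>') = (if \<kappa> = \<kappa>' then pbw_norm \<kappa> else 0)"
proof (cases "\<kappa> = \<kappa>'")
  case True
  then show ?thesis by (simp add: pbw_norm_def)
next
  case False
  then obtain \<gamma> where \<gamma>: "\<kappa> \<gamma> \<noteq> \<kappa>' \<gamma>" by blast
  moreover have "\<gamma> \<in> set positive_roots"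
  proof (rule ccontr)
    assume "\<gamma> \<notin> set positive_roots"
    then have "\<kappa> \<gamma> = 0" "\<kappa>' \<gamma> = 0"
      using assms unfolding exponents_def by blast+
    with \<gamma> show False by simp
  qed
  ultimately have "B (f_mon \<kappa>) (e_mon \<kappa>') = 0"
    by (intro pairing_monomials_distinct[OF positive_roots(1) order_refl])
  with False show ?thesis by simp
qed

lemma inj_monomial: "inj_on (e_mon :: _ \<Rightarrow> 'n rll) PBW"
proof (rule inj_onI)
  fix \<kappa> \<kappa>' :: "'n \<times> 'n \<Rightarrow> nat"
  assume *: "\<kappa> \<in> PBW" "\<kappa>' \<in> PBW"
    "e_mon \<kappa> = e_mon \<kappa>'"
  show "\<kappa> = \<kappa>'"
  proof (rule ccontr)
    assume "\<kappa> \<noteq> \<kappa>'"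
    then have "B (f_mon \<kappa>) (e_mon \<kappa>) = 0"
      using pbw_orthogonal[OF *(1,2)] *(3) by simp
    then show False
      using pbw_norm_nonzero[OF *(1)] by (simp add: pbw_norm_def)
  qed
qed

lemma pbw_dual_monomial:
  "\<kappa> \<in> PBW \<Longrightarrow>
    pbw_dual (e_mon \<kappa>) = inverse (pbw_norm \<kappa>) *\<^sub>Q f_mon \<kappa>"
  by (simp add: pbw_dual_def the_inv_into_f_f[OF inj_monomial])

lemma ordered_monomial_in: "e_mon \<kappa> \<in> U_ge" "f_mon \<kappa> \<in> U_le"
  by (rule hull_ebar_U_ge[OF monomial_hull] hull_fbar_U_le[OF monomial_hull])+

lemma pbw_dual_pairing:
  assumes "u \<in> pbw_basis" "v \<in> pbw_basis"
  shows "B (pbw_dual u) v = (if u = v then 1 else 0)"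
proof -
  obtain \<kappa> \<kappa>' where \<kappa>: "\<kappa> \<in> PBW" "u = e_mon \<kappa>"
    "\<kappa>' \<in> PBW" "v = e_mon \<kappa>'"
    using assms unfolding pbw_basis_def by blast
  have "B (pbw_dual u) v = inverse (pbw_norm \<kappa>) * (if \<kappa> = \<kappa>' then pbw_norm \<kappa> else 0)"
    by (simp only: \<kappa>(2,4) pbw_dual_monomial[OF \<kappa>(1)] B_scale_left ordered_monomial_in pbw_orthogonal[OF \<kappa>(1,3)])
  moreover have "u = v \<longleftrightarrow> \<kappa> = \<kappa>'"
    using inj_on_eq_iff[OF inj_monomial \<kappa>(1,3)] \<kappa>(2,4) by simp
  ultimately show ?thesis
    using left_inverse[OF pbw_norm_nonzero[OF \<kappa>(1)]] by (cases "\<kappa> = \<kappa>'") simp_all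
qed

lemma dual_independent:
  assumes E: "E \<subseteq> U_ge" and g: "\<And>u. u \<in> E \<Longrightarrow> g u \<in> U_le"
    and dual: "\<And>u v. u \<in> E \<Longrightarrow> v \<in> E \<Longrightarrow> B (g u) v = (if u = v then 1 else 0)"
  shows "cq.independent E" "inj_on g E" "cq.independent (g ` E)"
proof -
  show inj: "inj_on g E"
  proof (rule inj_onI)
    fix u v
    assume "u \<in> E" "v \<in> E" "g u = g v"
    then show "u = v"
      using dual[of u v] dual[of v v] by (cases "u = v") simp_all
  qed
  show "cq.independent E"
    unfolding cq.independent_explicit_finite_subsets
  proof (intro allI impI ballI)
    fix S c v
    assume S: "S \<subseteq> E" "finite S" "(\<Sum>u\<in>S. c u *\<^sub>Q u) = 0" "v \<in> S"
    then have v: "v \<in> E" by blast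
    have "(\<Sum>u\<in>S. c u * B (g v) u) = B (g v) 0"
      unfolding S(3)[symmetric] using S(1) E by (intro B_sum_right[symmetric] g v) auto
    also have "(\<Sum>u\<in>S. c u * B (g v) u) = (\<Sum>u\<in>S. if u = v then c u else 0)"
      using S(1) by (intro sum.cong refl) (auto simp: dual[OF v])
    finally show "c v = 0"
      using S(2,4) by (simp add: B_zero g v)
  qed
  show "cq.independent (g ` E)"
    unfolding cq.independent_explicit_finite_subsets
  proof (intro allI impI ballI)
    fix S c w
    assume S: "S \<subseteq> g ` E" "finite S" "(\<Sum>w\<in>S. c w *\<^sub>Q w) = 0" "w \<in> S"
    then obtain v where v: "v \<in> E" "w = g v" by blast
    have vU: "v \<in> U_ge" using v E by blast
    have "(\<Sum>w\<in>S. c w * B w v) = B 0 v"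
      unfolding S(3)[symmetric] using S(1) g by (intro B_sum_left[symmetric] vU) auto
    also have "(\<Sum>w\<in>S. c w * B w v) = (\<Sum>w'\<in>S. if w' = w then c w' else 0)"
    proof (rule sum.cong[OF refl])
      fix w'
      assume "w' \<in> S"
      then obtain u where u: "u \<in> E" "w' = g u" using S(1) by blast
      then show "c w' * B w' v = (if w' = w then c w' else 0)"
        using v inj_on_eq_iff[OF inj u(1) v(1)] by (simp add: dual)
    qed
    finally show "c w = 0"
      using S(2,4) by (simp add: B_zero vU)
  qed
qed

lemma pbw_basis_span: "cq.span pbw_basis = U_gt" "cq.span (pbw_dual ` pbw_basis) = U_lt"
proof -
  show "cq.span pbw_basis = U_gt"
    unfolding pbw_basis_def U_gt_bar by (rule monomials_span[OF straightening_ebar])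
  have "cq.span (pbw_dual ` pbw_basis) = cq.span (f_mon ` PBW)"
  proof (rule antisym; rule cq.span_minimal[OF _ cq.subspace_span])
    show "pbw_dual ` pbw_basis \<subseteq> cq.span (f_mon ` PBW)"
    proof
      fix w
      assume "w \<in> pbw_dual ` pbw_basis"
      then obtain \<kappa> where \<kappa>: "\<kappa> \<in> PBW" "w = pbw_dual (e_mon \<kappa>)"
        unfolding pbw_basis_def by blast
      show "w \<in> cq.span (f_mon ` PBW)"
        unfolding \<kappa>(2) pbw_dual_monomial[OF \<kappa>(1)] by (intro cq.span_scale cq.span_base imageI \<kappa>(1))
    qed
    show "f_mon ` PBW \<subseteq> cq.span (pbw_dual ` pbw_basis)"
    proof (rule image_subsetI)
      fix \<kappa> :: "'n \<times> 'n \<Rightarrow> nat"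
      assume \<kappa>: "\<kappa> \<in> PBW"
      then have "pbw_dual (e_mon \<kappa>) \<in> cq.span (pbw_dual ` pbw_basis)"
        unfolding pbw_basis_def by (intro cq.span_base imageI)
      then have "pbw_norm \<kappa> *\<^sub>Q pbw_dual (e_mon \<kappa>) \<in> cq.span (pbw_dual ` pbw_basis)"
        by (rule cq.span_scale)
      then show "f_mon \<kappa> \<in> cq.span (pbw_dual ` pbw_basis)"
        by (simp only: pbw_dual_monomial[OF \<kappa>] scaleQ_scaleQ right_inverse[OF pbw_norm_nonzero[OF \<kappa>]] scaleQ_one)
    qed
  qed
  then show "cq.span (pbw_dual ` pbw_basis) = U_lt"
    unfolding U_lt_bar by (simp only: monomials_span[OF straightening_fbar])
qed

lemma dual_bases_pbw: "dual_bases B pbw_basis pbw_dual"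
proof -
  have in_U: "pbw_basis \<subseteq> U_ge" "\<And>u. u \<in> pbw_basis \<Longrightarrow> pbw_dual u \<in> U_le"
  proof -
    show "pbw_basis \<subseteq> U_ge"
      unfolding pbw_basis_def using ordered_monomial_in by blast
    fix u
    assume "u \<in> pbw_basis"
    then obtain \<kappa> where \<kappa>: "\<kappa> \<in> PBW" "u = e_mon \<kappa>"
      unfolding pbw_basis_def by blast
    show "pbw_dual u \<in> U_le"
      unfolding \<kappa>(2) pbw_dual_monomial[OF \<kappa>(1)] by (intro le_closed ordered_monomial_in)
  qed
  note indep = dual_independent[OF in_U pbw_dual_pairing]
  have "\<exists>\<nu>. u \<in> rll_component \<nu>" "\<exists>\<nu>. pbw_dual u \<in> rll_component \<nu>" if u: "u \<in> pbw_basis" for u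
  proof -
    obtain \<kappa> where \<kappa>: "\<kappa> \<in> PBW" "u = e_mon \<kappa>"
      using u unfolding pbw_basis_def by blast
    show "\<exists>\<nu>. u \<in> rll_component \<nu>"
      unfolding \<kappa>(2) using rll_component_monomials(1) by blast
    show "\<exists>\<nu>. pbw_dual u \<in> rll_component \<nu>"
      unfolding \<kappa>(2) pbw_dual_monomial[OF \<kappa>(1)] using rll_component_monomials(2) rll_component_closed(3) by blast
  qed
  then show ?thesis
    unfolding dual_bases_def using indep pbw_basis_span pbw_dual_pairing by blast
qed

lemma dual_basesD:
  assumes "dual_bases B E g"
  shows "E \<subseteq> U_ge" "\<And>u. u \<in> E \<Longrightarrow> g u \<in> U_le" "\<And>u v. u \<in> E \<Longrightarrow> v \<in> E \<Longrightarrow> B (g u) v = (if u = v then 1 else 0)"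
    "inj_on g E" "cq.span E = U_gt" "cq.span (g ` E) = U_lt" "cq.independent E"
    "\<And>u. u \<in> E \<Longrightarrow> \<exists>\<nu>. u \<in> rll_component \<nu>" "\<And>u. u \<in> E \<Longrightarrow> u \<noteq> 0"
proof -
  note d = assms[unfolded dual_bases_def]
  show "inj_on g E" "cq.span E = U_gt" "cq.span (g ` E) = U_lt" "cq.independent E"
    "\<And>u v. u \<in> E \<Longrightarrow> v \<in> E \<Longrightarrow> B (g u) v = (if u = v then 1 else 0)"
    "\<And>u. u \<in> E \<Longrightarrow> \<exists>\<nu>. u \<in> rll_component \<nu>"
    using d by blast+
  then show "E \<subseteq> U_ge" "\<And>u. u \<in> E \<Longrightarrow> g u \<in> U_le" "\<And>u. u \<in> E \<Longrightarrow> u \<noteq> 0"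
    using cq.span_base[of _ E] cq.span_base[of _ "g ` E"] U_gt_ge U_lt_le cq.dependent_zero by blast+
qed

lemma dual_expansion_gt:
  assumes D: "dual_bases B E g" and x: "x \<in> U_gt"
  obtains t where "finite t" "t \<subseteq> E" "x = (\<Sum>u\<in>t. B (g u) x *\<^sub>Q u)" "\<forall>u\<in>E - t. B (g u) x = 0"
proof -
  note E = dual_basesD(1)[OF D] and g = dual_basesD(2)[OF D] and dual = dual_basesD(3)[OF D]
  have "x \<in> cq.span E"
    using x dual_basesD(5)[OF D] by simp
  then obtain t c where t: "finite t" "t \<subseteq> E" "x = (\<Sum>u\<in>t. c u *\<^sub>Q u)"
    unfolding cq.span_explicit by blast
  have coeff: "B (g v) x = (if v \<in> t then c v else 0)" if "v \<in> E" for v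
  proof -
    have "B (g v) x = (\<Sum>u\<in>t. c u * B (g v) u)"
      unfolding t(3) using t(2) E by (intro B_sum_right g that) auto
    also have "\<dots> = (\<Sum>u\<in>t. if u = v then c u else 0)"
      using t(2) by (intro sum.cong refl) (auto simp: dual[OF that])
    finally show ?thesis
      using t(1) by simp
  qed
  have "x = (\<Sum>u\<in>t. B (g u) x *\<^sub>Q u)"
    unfolding t(3) using t(2) coeff by (intro sum.cong refl) (auto simp flip: t(3))
  then show ?thesis
    using coeff by (intro that[OF t(1,2)]) auto
qed

lemma dual_expansion_lt:
  assumes D: "dual_bases B E g" and y: "y \<in> U_lt"
  obtains t where "finite t" "t \<subseteq> E" "y = (\<Sum>u\<in>t. B y u *\<^sub>Q g u)" "\<forall>u\<in>E - t. B y u = 0"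
proof -
  note E = dual_basesD(1)[OF D] and g = dual_basesD(2)[OF D] and dual = dual_basesD(3)[OF D]
    and inj = dual_basesD(4)[OF D]
  have "y \<in> cq.span (g ` E)"
    using y dual_basesD(6)[OF D] by simp
  then obtain T c where T: "finite T" "T \<subseteq> g ` E" "y = (\<Sum>w\<in>T. c w *\<^sub>Q w)"
    unfolding cq.span_explicit by blast
  obtain t where t: "finite t" "t \<subseteq> E" "T = g ` t"
    using T(1,2) by (meson finite_subset_image)
  have y: "y = (\<Sum>u\<in>t. c (g u) *\<^sub>Q g u)"
    unfolding T(3) t(3) by (rule sum.reindex[unfolded o_def]) (rule inj_on_subset[OF inj t(2)])
  have coeff: "B y v = (if v \<in> t then c (g v) else 0)" if "v \<in> E" for v
  proof -
    have "B y v = (\<Sum>u\<in>t. c (g u) * B (g u) v)"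
      unfolding y using t(2) E g that by (intro B_sum_left) auto
    also have "\<dots> = (\<Sum>u\<in>t. if u = v then c (g u) else 0)"
      using t(2) that by (intro sum.cong refl) (auto simp: dual)
    finally show ?thesis
      using t(1) by simp
  qed
  have "y = (\<Sum>u\<in>t. B y u *\<^sub>Q g u)"
    unfolding y using t(2) coeff by (intro sum.cong refl) (auto simp flip: y)
  then show ?thesis
    using coeff by (intro that[OF t(1,2)]) auto
qed

text \<open>Applying the projection to the component to an expansion of \<open>x\<close> shows that only basis vectors of the
  same weight contribute.\<close>

lemma component_expansion:
  assumes D: "dual_bases B E g" and x: "x \<in> U_gt" "x \<in> rll_component \<nu>"
  obtains t where "finite t" "t \<subseteq> E \<inter> rll_component \<nu>" "x = (\<Sum>u\<in>t. B (g u) x *\<^sub>Q u)"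
    "\<forall>u\<in>E - t. B (g u) x = 0"
proof -
  note d = dual_basesD[OF D]
  obtain t where t: "finite t" "t \<subseteq> E" "x = (\<Sum>u\<in>t. B (g u) x *\<^sub>Q u)"
    "\<forall>u\<in>E - t. B (g u) x = 0"
    by (rule dual_expansion_gt[OF D x(1)])
  have proj_sum: "weight_proj \<nu> (\<Sum>u\<in>S. f u) = (\<Sum>u\<in>S. weight_proj \<nu> (f u))" for S :: "'n rll set" and f
    by (induction S rule: infinite_finite_induct) (simp_all add: weight_proj_linear)
  have proj: "weight_proj \<nu> u = (if u \<in> rll_component \<nu> then u else 0)" if u: "u \<in> E" for u
  proof -
    obtain \<mu> where \<mu>: "u \<in> rll_component \<mu>" using d(8) u by blast
    show ?thesis
    proof (cases "u \<in> rll_component \<nu>")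
      case True
      then show ?thesis using weight_proj_component[OF True, of \<nu>] by simp
    next
      case False
      with \<mu> have "\<nu> \<noteq> \<mu>" by blast
      then show ?thesis using weight_proj_component[OF \<mu>, of \<nu>] False by simp
    qed
  qed
  let ?t = "t \<inter> rll_component \<nu>"
  have "x = weight_proj \<nu> x"
    using weight_proj_component[OF x(2), of \<nu>] by simp
  also have "\<dots> = (\<Sum>u\<in>t. B (g u) x *\<^sub>Q weight_proj \<nu> u)"
    by (subst t(3)) (simp only: proj_sum weight_proj_linear)
  also have "\<dots> = (\<Sum>u\<in>t. if u \<in> rll_component \<nu> then B (g u) x *\<^sub>Q u else 0)"
    using t(2) by (intro sum.cong refl) (auto simp: proj)
  also have "\<dots> = (\<Sum>u\<in>?t. B (g u) x *\<^sub>Q u)"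
    using t(1) by (simp add: sum.inter_restrict)
  finally have eq: "x = (\<Sum>u\<in>?t. B (g u) x *\<^sub>Q u)" .
  show ?thesis
  proof (rule that[OF _ _ eq])
    show "finite ?t" "?t \<subseteq> E \<inter> rll_component \<nu>"
      using t(1,2) by auto
    show "\<forall>v\<in>E - ?t. B (g v) x = 0"
    proof
      fix v
      assume "v \<in> E - ?t"
      then have v: "v \<in> E" "v \<notin> ?t" by blast+
      have "B (g v) x = (\<Sum>u\<in>?t. B (g u) x * B (g v) u)"
        by (subst eq, rule B_sum_right[OF d(2)[OF v(1)]]) (use t(2) d(1) in auto)
      also have "\<dots> = 0"
      proof (rule sum.neutral, rule ballI)
        fix u
        assume "u \<in> ?t"
        then have "u \<in> E" "v \<noteq> u"
          using v t(2) by auto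
        then show "B (g u) x * B (g v) u = 0"
          by (simp only: d(3)[OF v(1)] if_False mult_zero_right)
      qed
      finally show "B (g v) x = 0" .
    qed
  qed
qed

lemma finite_pbw_component: "finite (pbw_basis \<inter> rll_component \<nu>)"
  and pbw_component: "pbw_basis \<inter> rll_component \<nu>
    = e_mon ` {\<kappa> \<in> PBW. wt \<kappa> = \<nu>}"
proof -
  have "wt \<kappa> = \<nu>"
    if "\<kappa> \<in> PBW" "e_mon \<kappa> \<in> rll_component \<nu>" for \<kappa>
  proof (rule ccontr)
    \<comment> \<open>Components of different weights meet only in \<open>0\<close>, and basis vectors are nonzero.\<close>
    assume "wt \<kappa> \<noteq> \<nu>"
    then have "e_mon \<kappa> = 0"
      using weight_proj_component[OF that(2), of \<nu>] weight_proj_component[OF rll_component_monomials(1)[of positive_roots \<kappa>], of \<nu>]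
      by simp
    then show False
      using dual_basesD(9)[OF dual_bases_pbw] that(1) unfolding pbw_basis_def by blast
  qed
  then show eq: "pbw_basis \<inter> rll_component \<nu>
    = e_mon ` {\<kappa> \<in> PBW. wt \<kappa> = \<nu>}"
    unfolding pbw_basis_def using rll_component_monomials(1)[of positive_roots] by auto
  show "finite (pbw_basis \<inter> rll_component \<nu>)"
    unfolding eq by (intro finite_imageI finite_weight_fibre) (simp add: positive_roots)
qed

text \<open>An independent subset of the span of the finitely many ordered monomials of weight \<open>\<nu>\<close>.\<close>

lemma finite_dual_component:
  assumes D: "dual_bases B E g"
  shows "finite (E \<inter> rll_component \<nu>)"
proof -
  have "E \<inter> rll_component \<nu> \<subseteq> cq.span (pbw_basis \<inter> rll_component \<nu>)"
  proof
    fix x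
    assume x: "x \<in> E \<inter> rll_component \<nu>"
    then have "x \<in> U_gt"
      using dual_basesD(5)[OF D] cq.span_base by blast
    moreover have "x \<in> rll_component \<nu>"
      using x by blast
    ultimately obtain t where "finite t" and t: "t \<subseteq> pbw_basis \<inter> rll_component \<nu>"
      "x = (\<Sum>u\<in>t. B (pbw_dual u) x *\<^sub>Q u)"
      by (rule component_expansion[OF dual_bases_pbw])
    have "(\<Sum>u\<in>t. B (pbw_dual u) x *\<^sub>Q u) \<in> cq.span (pbw_basis \<inter> rll_component \<nu>)"
      by (intro cq.span_sum cq.span_scale cq.span_base subsetD[OF t(1)])
    then show "x \<in> cq.span (pbw_basis \<inter> rll_component \<nu>)"
      by (simp only: t(2)[symmetric])
  qed
  moreover have "cq.independent (E \<inter> rll_component \<nu>)"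
    using dual_basesD(7)[OF D] cq.independent_mono by blast
  ultimately show ?thesis
    using cq.independent_span_bound[OF finite_pbw_component] by blast
qed

text \<open>The usual argument: write \<open>u\<close> as \<open>\<Sum>\<^sub>v (g v, u) v\<close>, move the scalars across the tensor sign, and
  recognise \<open>\<Sum>\<^sub>u (g v, u) g' u\<close> as \<open>g v\<close>.  Restricting to a fixed weight is harmless because \<open>(g v, u) = 0\<close> for \<open>u\<close> and \<open>v\<close>
  of different weights.\<close>

lemma canonical_unique:
  assumes D: "dual_bases B E g" and D': "dual_bases B E' g'"
  shows "(\<Sum>u\<in>E' \<inter> rll_component \<nu>. u \<otimes> g' u) = (\<Sum>v\<in>E \<inter> rll_component \<nu>. v \<otimes> g v)"
proof -
  note d = dual_basesD[OF D] and d' = dual_basesD[OF D']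
  let ?E = "E \<inter> rll_component \<nu>" and ?E' = "E' \<inter> rll_component \<nu>"
  have fin: "finite ?E" "finite ?E'"
    by (rule finite_dual_component, fact)+
  have exp: "u = (\<Sum>v\<in>?E. B (g v) u *\<^sub>Q v)" if u: "u \<in> ?E'" for u
  proof -
    have u': "u \<in> U_gt" "u \<in> rll_component \<nu>"
      using u d'(5) cq.span_base by blast+
    obtain t where t: "finite t" "t \<subseteq> ?E" "u = (\<Sum>v\<in>t. B (g v) u *\<^sub>Q v)"
      "\<forall>v\<in>E - t. B (g v) u = 0"
      by (rule component_expansion[OF D u'])
    have "(\<Sum>v\<in>t. B (g v) u *\<^sub>Q v) = (\<Sum>v\<in>?E. B (g v) u *\<^sub>Q v)"
      by (rule sum.mono_neutral_left[OF fin(1) t(2)]) (use t(4) in auto)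
    with t(3) show ?thesis by (rule trans)
  qed
  have dual_exp: "(\<Sum>u\<in>?E'. B (g v) u *\<^sub>Q g' u) = g v" if v: "v \<in> ?E" for v
  proof -
    have gv: "g v \<in> U_lt"
      using v cq.span_base[of "g v" "g ` E"] d(6) by blast
    obtain t where t: "finite t" "t \<subseteq> E'" "g v = (\<Sum>u\<in>t. B (g v) u *\<^sub>Q g' u)"
      "\<forall>u\<in>E' - t. B (g v) u = 0"
      by (rule dual_expansion_lt[OF D' gv])
    have zero: "B (g v) u = 0" if u: "u \<in> E'" "u \<notin> rll_component \<nu>" for u
    proof -
      obtain \<mu> where \<mu>: "u \<in> rll_component \<mu>" using d'(8) u by blast
      have uU: "u \<in> U_gt" using u d'(5) cq.span_base by blast
      obtain s where s: "finite s" "s \<subseteq> E \<inter> rll_component \<mu>"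
        "u = (\<Sum>v\<in>s. B (g v) u *\<^sub>Q v)" "\<forall>v\<in>E - s. B (g v) u = 0"
        by (rule component_expansion[OF D uU \<mu>])
      have "v \<notin> rll_component \<mu>"
      proof
        assume "v \<in> rll_component \<mu>"
        moreover have "\<nu> \<noteq> \<mu>" using \<mu> u(2) by blast
        ultimately have "v = 0"
          using weight_proj_component[of v \<mu> \<nu>] weight_proj_component[of v \<nu> \<nu>] v by simp
        then show False using d(9) v by blast
      qed
      then show ?thesis using s(2,4) v by blast
    qed
    have "(\<Sum>u\<in>?E'. B (g v) u *\<^sub>Q g' u) = (\<Sum>u\<in>t \<union> ?E'. B (g v) u *\<^sub>Q g' u)"
      by (rule sum.mono_neutral_left) (use t(1,2) fin zero in auto)
    also have "\<dots> = (\<Sum>u\<in>t. B (g v) u *\<^sub>Q g' u)"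
      by (rule sum.mono_neutral_right) (use t(1,4) fin in auto)
    finally show ?thesis
      by (rule trans) (rule t(3)[symmetric])
  qed
  have "(\<Sum>u\<in>?E'. u \<otimes> g' u) = (\<Sum>u\<in>?E'. (\<Sum>v\<in>?E. B (g v) u *\<^sub>Q v) \<otimes> g' u)"
    by (intro sum.cong refl arg_cong2[where f = tens] exp)
  also have "\<dots> = (\<Sum>u\<in>?E'. \<Sum>v\<in>?E. v \<otimes> (B (g v) u *\<^sub>Q g' u))"
    by (simp only: tens_sum_left tens_scale_left tens_scale_right)
  also have "\<dots> = (\<Sum>v\<in>?E. \<Sum>u\<in>?E'. v \<otimes> (B (g v) u *\<^sub>Q g' u))"
    by (rule sum.swap)
  also have "\<dots> = (\<Sum>v\<in>?E. v \<otimes> g v)"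
    by (intro sum.cong refl) (simp only: dual_exp flip: tens_sum_right)
  finally show ?thesis .
qed

lemma canonical_element_pbw:
  "canonical_element B = (\<lambda>\<nu>. \<Sum>u\<in>pbw_basis \<inter> rll_component \<nu>. u \<otimes> pbw_dual u)"
  unfolding canonical_element_def
proof (rule the_equality)
  show "\<exists>E g. dual_bases B E g \<and> (\<lambda>\<nu>. \<Sum>u\<in>pbw_basis \<inter> rll_component \<nu>. u \<otimes> pbw_dual u)
      = (\<lambda>\<nu>. \<Sum>u\<in>E \<inter> rll_component \<nu>. u \<otimes> g u)"
    using dual_bases_pbw by blast
  fix X
  assume "\<exists>E g. dual_bases B E g \<and> X = (\<lambda>\<nu>. \<Sum>u\<in>E \<inter> rll_component \<nu>. u \<otimes> g u)"
  then show "X = (\<lambda>\<nu>. \<Sum>u\<in>pbw_basis \<inter> rll_component \<nu>. u \<otimes> pbw_dual u)"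
    using canonical_unique[OF dual_bases_pbw] by auto
qed

end

theorem proposition3p89:
  fixes B :: "'n::super_index rll \<Rightarrow> 'n rll \<Rightarrow> cq"
  assumes "rll_pairing B"
  shows "canonical_element B = descending_product (root_factor B)"
proof (rule ext)
  interpret rll_paired B by unfold_locales (rule assms)
  fix \<nu> :: "'n weight"
  let ?K = "{\<kappa> \<in> PBW. wt \<kappa> = \<nu>}"
  have "canonical_element B \<nu> = (\<Sum>u\<in>e_mon ` ?K. u \<otimes> pbw_dual u)"
    by (simp only: canonical_element_pbw pbw_component)
  also have "\<dots> = (\<Sum>\<kappa>\<in>?K. e_mon \<kappa> \<otimes> pbw_dual (e_mon \<kappa>))"
    by (rule sum.reindex[unfolded o_def]) (rule inj_on_subset[OF inj_monomial], blast)
  also have "\<dots> = (\<Sum>\<kappa>\<in>?K. inverse (B (f_mon \<kappa>) (e_mon \<kappa>)) *\<^sub>Q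
      (e_mon \<kappa> \<otimes> f_mon \<kappa>))"
    by (rule sum.cong[OF refl]) (simp add: pbw_dual_monomial pbw_norm_def tens_scale_right)
  also have "\<dots> = descending_product (root_factor B) \<nu>"
    by (simp only: descending_product_monomials[OF assms])
  finally show "canonical_element B \<nu> = descending_product (root_factor B) \<nu>" .
qed

end
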